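(* Let $(\mathfrak g,[-,-]_{\mathfrak g},(-,-)^{\mathfrak g})$ be a quadratic Lie algebra and $M$ a smooth manifold with an open cover $\{U_i\}$. A transitive Courant data $C_c=(\theta_i,B_i;\phi_{ij},\tau_{ij},\beta_{ij})$ over $\{U_i\}$ gives rise to a transitive Courant algebroid $(C,[\![-,-]\!],\langle-,-\rangle,\rho)$ over $M$ with a connection.
   Context: A quadratic Lie algebra is a Lie algebra with a nondegenerate ad-invariant symmetric bilinear form. A Courant algebroid is a vector bundle $C\to M$ with a bundle map $\rho:C\to TM$, a nondegenerate symmetric bilinear form $\langle-,-\rangle$ and a bracket $[\![-,-]\!]$ on $\Gamma(C)$ such that $(\Gamma(C),[\![-,-]\!])$ is a Leibniz algebra, $\langle[\![e_1,e_1]\!],e_2\rangle=\tfrac12\rho(e_2)\langle e_1,e_1\rangle$, and $\rho(e_1)\langle e_2,e_3\rangle=\langle[\![e_1,e_2]\!],e_3\rangle+\langle e_2,[\![e_1,e_3]\!]\rangle$. It is transitive if $\rho$ is surjective; then $\mathcal G=\ker\rho/(\ker\rho)^\perp$ is a bundle of quadratic Lie algebras. A connection of a transitive Courant algebroid consists of an isotropic splitting $s:TM\to C$ of $0\to\ker\rho\to C\to TM\to0$ and a splitting $\sigma_s:\mathcal G\to\ker\rho$ of $0\to(\ker\rho)^\perp\to\ker\rho\to\mathcal G\to0$ with $\langle s(X),\sigma_s(a)\rangle=0$ for all $X\in\Gamma(TM)$, $a\in\Gamma(\mathcal G)$. Standard transitive Courant algebroid on a manifold $U$: $\mathbb T_{\mathfrak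 g}U=TU\oplus(U\times\mathfrak g)\oplus T^*U$, anchor the projection to $TU$, pairing $\langle X+a+\xi,Y+b+\eta\rangle^T=\tfrac12(\xi(Y)+\eta(X))+(a,b)^{\mathfrak g}$, bracket $[\![X+a+\xi,Y+b+\eta]\!]_S^T=[X,Y]+X(b)-Y(a)+[a,b]_{\mathfrak g}+L_X\eta-\iota_Yd\xi+\mathcal P(a,b)$ with $\mathcal P(a,b)(Y)=2(b,Y(a))^{\mathfrak g}$. Transitive Courant data over $\{U_i\}$: the standard transitive Courant algebroids $\mathbb T_{\mathfrak g}U_i$ together with $\theta_i\in\Omega^1(U_i,\mathfrak g)$, $B_i\in\Omega^2(U_i)$, and on each $U_{ij}$ an automorphism $\Lambda_{ij}=\begin{pmatrix}1&0&0\\\phi_{ij}&\tau_{ij}&0\\\beta_{ij}&-2\phi_{ij}^\star\tau_{ij}&1\end{pmatrix}$ of the standard transitive Courant algebroid $\mathbb T_{\mathfrak g}U_{ij}$ (preserving bracket, pairing and anchor), where $\phi_{ij}:TU_{ij}\to U_{ij}\times\mathfrak g$ and $\beta_{ij}:TU_{ij}\to T^*U_{ij}$ are bundle maps, $\tau_{ij}$ is an orthogonal automorphism of the bundle of quadratic Lie algebras $U_{ij}\times\mathfrak g$, and $\phi^\star(a)(X)=(a,\phi(X))^{\mathfrak g}$, such that $\theta_i(X)=\tau_{ij}\theta_j(X)+\phi_{ij}(X)$, $\iota_X(B_j-B_i)=\beta_{ij}(X)+(\theta_i,\theta_i(X))^{\mathfrak g}-(\theta_j,\theta_j(X))^{\mathfrak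 g}-2\phi_{ij}^\star\tau_{ij}(\theta_j(X))$, $\mathrm{cs}_3(\theta_j)-\mathrm{cs}_3(\theta_i)=d(B_j-B_i)$ on $U_{ij}$, and $\Lambda_{ij}\Lambda_{jk}=\Lambda_{ik}$ on $U_{ijk}$. Here $\mathrm{cs}_3(\theta)=(\theta,d\theta)^{\mathfrak g}+\tfrac13(\theta,[\theta,\theta]_{\mathfrak g})^{\mathfrak g}$, and $(\theta,\theta(X))^{\mathfrak g}$ denotes the 1-form $Y\mapsto(\theta(Y),\theta(X))^{\mathfrak g}$. *)

theory Defs
  imports "HOL-Analysis.Analysis"
begin

section \<open>Quadratic Lie algebras\<close>

text \<open>
  Finite dimension is a predicate on a normed space rather than the class
  \<^class>\<open>euclidean_space\<close>, because that class excludes dimension 0.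
\<close>

definition finite_dim :: "'a::real_vector itself \<Rightarrow> bool" where
  "finite_dim _ \<longleftrightarrow> (\<exists>B::'a set. finite B \<and> span B = UNIV)"

locale quadratic_lie_algebra =
  fixes lb :: "'g::real_normed_vector \<Rightarrow> 'g \<Rightarrow> 'g"
    and ip :: "'g \<Rightarrow> 'g \<Rightarrow> real"
  assumes dim: "finite_dim TYPE('g)"
    and lb_bilinear: "bilinear lb"
    and lb_alternating: "lb a a = 0"
    and lb_jacobi: "lb a (lb b c) + lb b (lb c a) + lb c (lb a b) = 0"
    and ip_bilinear: "bilinear ip"
    and ip_sym: "ip a b = ip b a"
    and ip_nondegenerate: "(\<forall>b. ip a b = 0) \<Longrightarrow> a = 0"
    and ip_invariant: "ip (lb a b) c + ip b (lb a c) = 0"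


section \<open>Smooth manifolds\<close>

text \<open>
  For \<open>S\<close> open in a finite-dimensional space, being $C^{k+1}$ means being differentiable with
  all directional derivatives of class $C^k$.
\<close>

primrec Ck_on :: "nat \<Rightarrow> 'a::real_normed_vector set \<Rightarrow> ('a \<Rightarrow> 'b::real_normed_vector) \<Rightarrow> bool" where
  "Ck_on 0 S f \<longleftrightarrow> continuous_on S f"
| "Ck_on (Suc k) S f \<longleftrightarrow>
     (\<forall>x\<in>S. f differentiable (at x)) \<and> (\<forall>v. Ck_on k S (\<lambda>x. frechet_derivative f (at x) v))"

definition smooth_on :: "'a::real_normed_vector set \<Rightarrow> ('a \<Rightarrow> 'b::real_normed_vector) \<Rightarrow> bool" where
  "smooth_on S f \<longleftrightarrow> (\<forall>k. Ck_on k S f)"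

type_synonym ('m, 'e) chart = "'m set \<times> ('m \<Rightarrow> 'e)"

definition chart_inv :: "('m, 'e) chart \<Rightarrow> 'e \<Rightarrow> 'm" where
  "chart_inv c = inv_into (fst c) (snd c)"

text \<open>The manifold is the whole type \<open>'m\<close>, with the smooth structure given by the atlas \<open>A\<close>.\<close>

locale smooth_manifold =
  fixes A :: "('m::{t2_space,second_countable_topology}, 'e::real_normed_vector) chart set"
  assumes dim: "finite_dim TYPE('e)"
    and charts: "c \<in> A \<Longrightarrow> open (fst c) \<and> open (snd c ` fst c) \<and>
                   homeomorphism (fst c) (snd c ` fst c) (snd c) (chart_inv c)"
    and cover: "(\<Union>c\<in>A. fst c) = UNIV"
    and compatible: "c \<in> A \<Longrightarrow> c' \<in> A \<Longrightarrow>
                   smooth_on (snd c ` (fst c \<inter> fst c')) (snd c' \<circ> chart_inv c)"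

definition smooth_map ::
  "('m, 'e::real_normed_vector) chart set \<Rightarrow> 'm set \<Rightarrow> ('m \<Rightarrow> 'f::real_normed_vector) \<Rightarrow> bool" where
  "smooth_map A U f \<longleftrightarrow> (\<forall>c\<in>A. smooth_on (snd c ` (U \<inter> fst c)) (f \<circ> chart_inv c))"


section \<open>Vector bundles\<close>

text \<open>
  A bundle over the manifold has fibre \<open>fiber E x\<close>, a subspace of the ambient vector space \<open>'v\<close>,
  over \<open>x\<close>; its smooth structure is given by a set of local trivializations \<open>(V, t)\<close> with
  \<open>t x\<close> a linear isomorphism from the fibre over \<open>x \<in> V\<close> to the model fibre \<open>'f\<close>.
\<close>

record ('m, 'v, 'f) vbundle =
  fiber :: "'m \<Rightarrow> 'v set"
  trivs :: "('m set \<times> ('m \<Rightarrow> 'v \<Rightarrow> 'f)) set"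

definition lin_on :: "'a::real_vector set \<Rightarrow> ('a \<Rightarrow> 'b::real_vector) \<Rightarrow> bool" where
  "lin_on S f \<longleftrightarrow> (\<forall>u\<in>S. \<forall>v\<in>S. f (u + v) = f u + f v) \<and> (\<forall>r. \<forall>u\<in>S. f (r *\<^sub>R u) = r *\<^sub>R f u)"

definition vector_bundle ::
  "('m::topological_space, 'e::real_normed_vector) chart set \<Rightarrow>
   ('m, 'v::real_vector, 'f::real_normed_vector, 'z) vbundle_scheme \<Rightarrow> bool" where
  "vector_bundle A E \<longleftrightarrow>
     finite_dim TYPE('f) \<and>
     (\<forall>x. subspace (fiber E x)) \<and>
     (\<forall>(V, t)\<in>trivs E. open V \<and>
        (\<forall>x\<in>V. lin_on (fiber E x) (t x) \<and> bij_betw (t x) (fiber E x) UNIV)) \<and>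
     (\<Union>(V, t)\<in>trivs E. V) = UNIV \<and>
     (\<forall>(V, t)\<in>trivs E. \<forall>(V', t')\<in>trivs E. \<forall>w.
        smooth_map A (V \<inter> V') (\<lambda>x. t' x (inv_into (fiber E x) (t x) w)))"

text \<open>Smooth sections over an open set \<open>U\<close>; their values outside \<open>U\<close> are irrelevant.\<close>

definition sections ::
  "('m, 'e::real_normed_vector) chart set \<Rightarrow> 'm set \<Rightarrow>
   ('m, 'v, 'f::real_normed_vector, 'z) vbundle_scheme \<Rightarrow> ('m \<Rightarrow> 'v) set" where
  "sections A U E = {e. (\<forall>x\<in>U. e x \<in> fiber E x) \<and>
     (\<forall>(V, t)\<in>trivs E. smooth_map A (U \<inter> V) (\<lambda>x. t x (e x)))}"

text \<open>
  Smooth vector bundle maps over \<open>U\<close> covering the identity: fibrewise linear and mapping smooth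
  local sections to smooth local sections.
\<close>

definition bundle_map ::
  "('m::topological_space, 'e::real_normed_vector) chart set \<Rightarrow> 'm set \<Rightarrow>
   ('m, 'v::real_vector, 'f::real_normed_vector, 'y) vbundle_scheme \<Rightarrow>
   ('m, 'w::real_vector, 'h::real_normed_vector, 'z) vbundle_scheme \<Rightarrow>
   ('m \<Rightarrow> 'v \<Rightarrow> 'w) \<Rightarrow> bool" where
  "bundle_map A U E F h \<longleftrightarrow>
     (\<forall>x\<in>U. lin_on (fiber E x) (h x) \<and> h x ` fiber E x \<subseteq> fiber F x) \<and>
     (\<forall>W e. open W \<longrightarrow> W \<subseteq> U \<longrightarrow> e \<in> sections A W E \<longrightarrow> (\<lambda>x. h x (e x)) \<in> sections A W F)"


section \<open>Calculus of vector fields and forms\<close>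

text \<open>
  Every point \<open>p\<close> has a preferred chart, and $T_pM$ is identified with the model space \<open>'e\<close>
  through it.  Correspondingly $T^*_pM$ is \<open>'e \<Rightarrow>\<^sub>L real\<close>.
  The smooth structure on $TM$ does not come from these (discontinuous in \<open>p\<close>)
  identifications: \<open>tcoord A c p\<close> gives the coordinates of a tangent vector at \<open>p\<close> in an arbitrary
  chart \<open>c\<close> around \<open>p\<close>, and these are the local trivializations.
\<close>

definition chart_at :: "('m, 'e) chart set \<Rightarrow> 'm \<Rightarrow> ('m, 'e) chart" where
  "chart_at A p = (SOME c. c \<in> A \<and> p \<in> fst c)"

definition tcoord ::
  "('m, 'e::real_normed_vector) chart set \<Rightarrow> ('m, 'e) chart \<Rightarrow> 'm \<Rightarrow> 'e \<Rightarrow> 'e" where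
  "tcoord A c p v =
     frechet_derivative (snd c \<circ> chart_inv (chart_at A p)) (at (snd (chart_at A p) p)) v"

text \<open>The vector field on the domain of \<open>c\<close> whose coordinates in \<open>c\<close> are the constant \<open>w\<close>.\<close>

definition chart_field ::
  "('m, 'e::real_normed_vector) chart set \<Rightarrow> ('m, 'e) chart \<Rightarrow> 'e \<Rightarrow> 'm \<Rightarrow> 'e" where
  "chart_field A c w p =
     frechet_derivative (snd (chart_at A p) \<circ> chart_inv c) (at (snd c p)) w"

definition tangent_bundle ::
  "('m, 'e::real_normed_vector) chart set \<Rightarrow> ('m, 'e, 'e) vbundle" where
  "tangent_bundle A = \<lparr>fiber = (\<lambda>_. UNIV), trivs = (\<lambda>c. (fst c, tcoord A c)) ` A\<rparr>"

definition cotangent_coord ::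
  "('m, 'e::real_normed_vector) chart set \<Rightarrow> ('m, 'e) chart \<Rightarrow> 'm \<Rightarrow>
   ('e \<Rightarrow>\<^sub>L real) \<Rightarrow> ('e \<Rightarrow>\<^sub>L real)" where
  "cotangent_coord A c p \<xi> = Blinfun (\<lambda>w. blinfun_apply \<xi> (chart_field A c w p))"

definition cotangent_bundle ::
  "('m, 'e::real_normed_vector) chart set \<Rightarrow> ('m, 'e \<Rightarrow>\<^sub>L real, 'e \<Rightarrow>\<^sub>L real) vbundle" where
  "cotangent_bundle A =
     \<lparr>fiber = (\<lambda>_. UNIV), trivs = (\<lambda>c. (fst c, cotangent_coord A c)) ` A\<rparr>"

definition trivial_bundle :: "('m, 'g, 'g) vbundle" where
  "trivial_bundle = \<lparr>fiber = (\<lambda>_. UNIV), trivs = {(UNIV, \<lambda>_ a. a)}\<rparr>"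

text \<open>The derivative of \<open>f\<close> at \<open>p\<close> along the tangent vector \<open>v\<close>.\<close>

definition dir_deriv ::
  "('m, 'e::real_normed_vector) chart set \<Rightarrow> ('m \<Rightarrow> 'f::real_normed_vector) \<Rightarrow> 'm \<Rightarrow> 'e \<Rightarrow> 'f" where
  "dir_deriv A f p v =
     frechet_derivative (f \<circ> chart_inv (chart_at A p)) (at (snd (chart_at A p) p)) v"

definition lie_bracket ::
  "('m, 'e::real_normed_vector) chart set \<Rightarrow> ('m \<Rightarrow> 'e) \<Rightarrow> ('m \<Rightarrow> 'e) \<Rightarrow> 'm \<Rightarrow> 'e" where
  "lie_bracket A X Y p =
     dir_deriv A (\<lambda>q. tcoord A (chart_at A p) q (Y q)) p (X p)
     - dir_deriv A (\<lambda>q. tcoord A (chart_at A p) q (X q)) p (Y p)"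

text \<open>
  Forms are differentiated by the invariant (Cartan) formulas, in which a tangent vector \<open>v\<close> at
  \<open>p\<close> is extended to the local vector field with constant coordinates in the preferred chart;
  such extensions commute, so the terms with their Lie brackets are absent.
\<close>

definition extend ::
  "('m, 'e::real_normed_vector) chart set \<Rightarrow> 'm \<Rightarrow> 'e \<Rightarrow> 'm \<Rightarrow> 'e" where
  "extend A p v = chart_field A (chart_at A p) v"

definition ext_deriv1 ::
  "('m, 'e::real_normed_vector) chart set \<Rightarrow> ('m \<Rightarrow> 'e \<Rightarrow> 'f::real_normed_vector) \<Rightarrow>
   'm \<Rightarrow> 'e \<Rightarrow> 'e \<Rightarrow> 'f" where
  "ext_deriv1 A \<omega> p u v =
     dir_deriv A (\<lambda>q. \<omega> q (extend A p v q)) p u - dir_deriv A (\<lambda>q. \<omega> q (extend A p u q)) p v"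

definition ext_deriv2 ::
  "('m, 'e::real_normed_vector) chart set \<Rightarrow> ('m \<Rightarrow> 'e \<Rightarrow> 'e \<Rightarrow> 'f::real_normed_vector) \<Rightarrow>
   'm \<Rightarrow> 'e \<Rightarrow> 'e \<Rightarrow> 'e \<Rightarrow> 'f" where
  "ext_deriv2 A \<omega> p u v w =
     dir_deriv A (\<lambda>q. \<omega> q (extend A p v q) (extend A p w q)) p u
     + dir_deriv A (\<lambda>q. \<omega> q (extend A p w q) (extend A p u q)) p v
     + dir_deriv A (\<lambda>q. \<omega> q (extend A p u q) (extend A p v q)) p w"

text \<open>$(L_X\eta)(v) = X(\eta(\tilde v)) - \eta([X, \tilde v])$ for an extension $\tilde v$ of $v$.\<close>

definition lie_deriv1 ::
  "('m, 'e::real_normed_vector) chart set \<Rightarrow> ('m \<Rightarrow> 'e) \<Rightarrow> ('m \<Rightarrow> 'e \<Rightarrow> 'f::real_normed_vector) \<Rightarrow>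
   'm \<Rightarrow> 'e \<Rightarrow> 'f" where
  "lie_deriv1 A X \<eta> p v =
     dir_deriv A (\<lambda>q. \<eta> q (extend A p v q)) p (X p) - \<eta> p (lie_bracket A X (extend A p v) p)"

definition one_form ::
  "('m::topological_space, 'e::real_normed_vector) chart set \<Rightarrow> 'm set \<Rightarrow>
   ('m \<Rightarrow> 'e \<Rightarrow> 'g::real_normed_vector) \<Rightarrow> bool" where
  "one_form A U \<theta> \<longleftrightarrow> bundle_map A U (tangent_bundle A) trivial_bundle \<theta>"

text \<open>A 2-form \<open>B\<close> is given by the bundle map \<open>v \<mapsto> \<iota>\<^sub>v B\<close>.\<close>

definition two_form ::
  "('m::topological_space, 'e::real_normed_vector) chart set \<Rightarrow> 'm set \<Rightarrow>
   ('m \<Rightarrow> 'e \<Rightarrow> ('e \<Rightarrow>\<^sub>L real)) \<Rightarrow> bool" where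
  "two_form A U B \<longleftrightarrow>
     bundle_map A U (tangent_bundle A) (cotangent_bundle A) B \<and>
     (\<forall>x\<in>U. \<forall>v. blinfun_apply (B x v) v = 0)"


section \<open>Transitive Courant algebroids and connections\<close>

record ('m, 'v, 'f, 'e) courant = "('m, 'v, 'f) vbundle" +
  anchor :: "'m \<Rightarrow> 'v \<Rightarrow> 'e"
  pairing :: "'m \<Rightarrow> 'v \<Rightarrow> 'v \<Rightarrow> real"
  cbracket :: "('m \<Rightarrow> 'v) \<Rightarrow> ('m \<Rightarrow> 'v) \<Rightarrow> 'm \<Rightarrow> 'v"

locale courant_algebroid =
  fixes A :: "('m::{t2_space,second_countable_topology}, 'e::real_normed_vector) chart set"
    and C :: "('m, 'v::real_vector, 'f::real_normed_vector, 'e) courant"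
  assumes vbundle: "vector_bundle A C"
    and anchor: "bundle_map A UNIV C (tangent_bundle A) (anchor C)"
    and pairing_linear: "u \<in> fiber C x \<Longrightarrow> lin_on (fiber C x) (pairing C x u)"
    and pairing_sym: "u \<in> fiber C x \<Longrightarrow> v \<in> fiber C x \<Longrightarrow> pairing C x u v = pairing C x v u"
    and pairing_nondegenerate:
      "u \<in> fiber C x \<Longrightarrow> (\<forall>v\<in>fiber C x. pairing C x u v = 0) \<Longrightarrow> u = 0"
    and pairing_smooth: "open W \<Longrightarrow> e1 \<in> sections A W C \<Longrightarrow> e2 \<in> sections A W C \<Longrightarrow>
      smooth_map A W (\<lambda>x. pairing C x (e1 x) (e2 x))"
    and bracket_closed: "e1 \<in> sections A UNIV C \<Longrightarrow> e2 \<in> sections A UNIV C \<Longrightarrow>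
      cbracket C e1 e2 \<in> sections A UNIV C"
    and bracket_linear_right: "e1 \<in> sections A UNIV C \<Longrightarrow> e2 \<in> sections A UNIV C \<Longrightarrow>
      e3 \<in> sections A UNIV C \<Longrightarrow>
      cbracket C e1 (\<lambda>x. r *\<^sub>R e2 x + e3 x) x = r *\<^sub>R cbracket C e1 e2 x + cbracket C e1 e3 x"
    and bracket_linear_left: "e1 \<in> sections A UNIV C \<Longrightarrow> e2 \<in> sections A UNIV C \<Longrightarrow>
      e3 \<in> sections A UNIV C \<Longrightarrow>
      cbracket C (\<lambda>x. r *\<^sub>R e1 x + e2 x) e3 x = r *\<^sub>R cbracket C e1 e3 x + cbracket C e2 e3 x"
    and leibniz: "e1 \<in> sections A UNIV C \<Longrightarrow> e2 \<in> sections A UNIV C \<Longrightarrow>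
      e3 \<in> sections A UNIV C \<Longrightarrow>
      cbracket C e1 (cbracket C e2 e3) x =
        cbracket C (cbracket C e1 e2) e3 x + cbracket C e2 (cbracket C e1 e3) x"
    and bracket_diag: "e1 \<in> sections A UNIV C \<Longrightarrow> e2 \<in> sections A UNIV C \<Longrightarrow>
      pairing C x (cbracket C e1 e1 x) (e2 x) =
        1/2 * dir_deriv A (\<lambda>y. pairing C y (e1 y) (e1 y)) x (anchor C x (e2 x))"
    and pairing_invariant: "e1 \<in> sections A UNIV C \<Longrightarrow> e2 \<in> sections A UNIV C \<Longrightarrow>
      e3 \<in> sections A UNIV C \<Longrightarrow>
      dir_deriv A (\<lambda>y. pairing C y (e2 y) (e3 y)) x (anchor C x (e1 x)) =
        pairing C x (cbracket C e1 e2 x) (e3 x) + pairing C x (e2 x) (cbracket C e1 e3 x)"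

locale transitive_courant_algebroid = courant_algebroid +
  assumes transitive: "anchor C x ` fiber C x = UNIV"

definition ker_anchor :: "('m, 'v, 'f, 'e::zero) courant \<Rightarrow> 'm \<Rightarrow> 'v set" where
  "ker_anchor C x = {v \<in> fiber C x. anchor C x v = 0}"

definition ker_perp :: "('m, 'v, 'f, 'e::zero) courant \<Rightarrow> 'm \<Rightarrow> 'v set" where
  "ker_perp C x = {v \<in> fiber C x. \<forall>w\<in>ker_anchor C x. pairing C x v w = 0}"

text \<open>
  The class of \<open>u \<in> ker_anchor C x\<close> in the quotient $\mathcal G_x$ of \<open>ker_anchor C x\<close> by
  \<open>ker_perp C x\<close>, as a coset.
\<close>

definition g_class :: "('m, 'v::real_vector, 'f, 'e::zero) courant \<Rightarrow> 'm \<Rightarrow> 'v \<Rightarrow> 'v set" where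
  "g_class C x u = {w \<in> ker_anchor C x. w - u \<in> ker_perp C x}"

locale courant_connection =
  fixes A :: "('m::{t2_space,second_countable_topology}, 'e::real_normed_vector) chart set"
    and C :: "('m, 'v::real_vector, 'f::real_normed_vector, 'e) courant"
    and s :: "'m \<Rightarrow> 'e \<Rightarrow> 'v"
    and \<sigma> :: "'m \<Rightarrow> 'v set \<Rightarrow> 'v"
  assumes s_bundle_map: "bundle_map A UNIV (tangent_bundle A) C s"
    and s_splitting: "anchor C x (s x v) = v"
    and s_isotropic: "pairing C x (s x v) (s x w) = 0"
    and \<sigma>_splitting: "u \<in> ker_anchor C x \<Longrightarrow> \<sigma> x (g_class C x u) \<in> g_class C x u"
    and \<sigma>_linear: "lin_on (ker_anchor C x) (\<lambda>u. \<sigma> x (g_class C x u))"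
    and \<sigma>_smooth: "open W \<Longrightarrow> e \<in> sections A W C \<Longrightarrow> (\<forall>x\<in>W. e x \<in> ker_anchor C x) \<Longrightarrow>
      (\<lambda>x. \<sigma> x (g_class C x (e x))) \<in> sections A W C"
    and s_\<sigma>_orthogonal: "u \<in> ker_anchor C x \<Longrightarrow> pairing C x (s x v) (\<sigma> x (g_class C x u)) = 0"

text \<open>
  Isomorphism, over an open set \<open>U\<close>, of bundles with anchor, pairing and bracket. The bracket is
  compared on the sections in \<open>S\<close>: for automorphisms of the standard algebroid over \<open>U\<close> this is
  the set of all sections over \<open>U\<close>; for the restriction to \<open>U\<close> of a Courant algebroid \<open>C\<close> over the
  whole manifold it is the set of global sections of \<open>C\<close>, on which the bracket of \<open>C\<close> lives.
\<close>

definition courant_iso ::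
  "('m::topological_space, 'e::real_normed_vector) chart set \<Rightarrow> 'm set \<Rightarrow> ('m \<Rightarrow> 'v) set \<Rightarrow>
   ('m, 'v::real_vector, 'f::real_normed_vector, 'e) courant \<Rightarrow>
   ('m, 'w::real_vector, 'h::real_normed_vector, 'e) courant \<Rightarrow>
   ('m \<Rightarrow> 'v \<Rightarrow> 'w) \<Rightarrow> bool" where
  "courant_iso A U S C C' h \<longleftrightarrow>
     bundle_map A U C C' h \<and>
     (\<forall>x\<in>U. bij_betw (h x) (fiber C x) (fiber C' x)) \<and>
     (\<forall>x\<in>U. \<forall>u\<in>fiber C x. anchor C' x (h x u) = anchor C x u) \<and>
     (\<forall>x\<in>U. \<forall>u\<in>fiber C x. \<forall>v\<in>fiber C x. pairing C' x (h x u) (h x v) = pairing C x u v) \<and>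
     (\<forall>e1\<in>S. \<forall>e2\<in>S. \<forall>x\<in>U.
        h x (cbracket C e1 e2 x) = cbracket C' (\<lambda>y. h y (e1 y)) (\<lambda>y. h y (e2 y)) x)"


section \<open>The standard transitive Courant algebroid\<close>

type_synonym ('e, 'g) std_fiber = "'e \<times> 'g \<times> ('e \<Rightarrow>\<^sub>L real)"

definition std_bracket ::
  "('m, 'e::real_normed_vector) chart set \<Rightarrow>
   ('g::real_normed_vector \<Rightarrow> 'g \<Rightarrow> 'g) \<Rightarrow> ('g \<Rightarrow> 'g \<Rightarrow> real) \<Rightarrow>
   ('m \<Rightarrow> ('e, 'g) std_fiber) \<Rightarrow> ('m \<Rightarrow> ('e, 'g) std_fiber) \<Rightarrow> 'm \<Rightarrow> ('e, 'g) std_fiber" where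
  "std_bracket A lb ip e1 e2 p =
    (let X = (\<lambda>q. fst (e1 q)); a = (\<lambda>q. fst (snd (e1 q))); \<xi> = (\<lambda>q. blinfun_apply (snd (snd (e1 q))));
         Y = (\<lambda>q. fst (e2 q)); b = (\<lambda>q. fst (snd (e2 q))); \<eta> = (\<lambda>q. blinfun_apply (snd (snd (e2 q))))
     in (lie_bracket A X Y p,
         dir_deriv A b p (X p) - dir_deriv A a p (Y p) + lb (a p) (b p),
         Blinfun (\<lambda>v. lie_deriv1 A X \<eta> p v - ext_deriv1 A \<xi> p (Y p) v
                       + 2 * ip (b p) (dir_deriv A a p v))))"

text \<open>
  The standard algebroid over an open subset \<open>U\<close> is obtained by using sections over \<open>U\<close>; the
  bracket is a differential operator and makes sense on these.
\<close>

definition std_courant ::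
  "('m, 'e::real_normed_vector) chart set \<Rightarrow>
   ('g::real_normed_vector \<Rightarrow> 'g \<Rightarrow> 'g) \<Rightarrow> ('g \<Rightarrow> 'g \<Rightarrow> real) \<Rightarrow>
   ('m, ('e, 'g) std_fiber, ('e, 'g) std_fiber, 'e) courant" where
  "std_courant A lb ip =
    \<lparr>fiber = (\<lambda>_. UNIV),
     trivs = (\<lambda>c. (fst c, \<lambda>x (v, a, \<xi>). (tcoord A c x v, a, cotangent_coord A c x \<xi>))) ` A,
     anchor = (\<lambda>x (v, a, \<xi>). v),
     pairing = (\<lambda>x (v, a, \<xi>) (w, b, \<eta>). 1/2 * (blinfun_apply \<xi> w + blinfun_apply \<eta> v) + ip a b),
     cbracket = std_bracket A lb ip\<rparr>"


section \<open>Transitive Courant data\<close>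

text \<open>
  $\phi^\star(a)(v) = (a, \phi(v))$. The 1-form $(\theta, \theta(X))$ is
  \<open>star ip \<theta> (\<theta> X)\<close>.
\<close>

definition star ::
  "('g \<Rightarrow> 'g \<Rightarrow> real) \<Rightarrow> ('e::real_normed_vector \<Rightarrow> 'g) \<Rightarrow> 'g \<Rightarrow> ('e \<Rightarrow>\<^sub>L real)" where
  "star ip \<phi> a = Blinfun (\<lambda>v. ip a (\<phi> v))"

definition gluing_map ::
  "('g::real_normed_vector \<Rightarrow> 'g \<Rightarrow> real) \<Rightarrow> ('m \<Rightarrow> 'e::real_normed_vector \<Rightarrow> 'g) \<Rightarrow>
   ('m \<Rightarrow> 'g \<Rightarrow> 'g) \<Rightarrow> ('m \<Rightarrow> 'e \<Rightarrow> ('e \<Rightarrow>\<^sub>L real)) \<Rightarrow>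
   'm \<Rightarrow> ('e, 'g) std_fiber \<Rightarrow> ('e, 'g) std_fiber" where
  "gluing_map ip \<phi> \<tau> \<beta> x =
    (\<lambda>(v, a, \<xi>). (v, \<phi> x v + \<tau> x a, \<beta> x v - 2 *\<^sub>R star ip (\<phi> x) (\<tau> x a) + \<xi>))"

text \<open>
  The 3-form $(\theta, d\theta) + \frac13 (\theta, [\theta, \theta])$ with the usual wedge conventions:
  $[\theta,\theta](v,w) = 2\,[\theta(v),\theta(w)]$, and the product of a 1-form and a 2-form is the
  cyclic sum.
\<close>

definition cs3 ::
  "('m, 'e::real_normed_vector) chart set \<Rightarrow>
   ('g::real_normed_vector \<Rightarrow> 'g \<Rightarrow> 'g) \<Rightarrow> ('g \<Rightarrow> 'g \<Rightarrow> real) \<Rightarrow>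
   ('m \<Rightarrow> 'e \<Rightarrow> 'g) \<Rightarrow> 'm \<Rightarrow> 'e \<Rightarrow> 'e \<Rightarrow> 'e \<Rightarrow> real" where
  "cs3 A lb ip \<theta> x u v w =
    (let d\<theta> = ext_deriv1 A \<theta> x; \<theta>\<theta> = (\<lambda>v w. 2 *\<^sub>R lb (\<theta> x v) (\<theta> x w));
         wedge = (\<lambda>\<omega>. ip (\<theta> x u) (\<omega> v w) + ip (\<theta> x v) (\<omega> w u) + ip (\<theta> x w) (\<omega> u v))
     in wedge d\<theta> + 1/3 * wedge \<theta>\<theta>)"

locale transitive_courant_data =
  fixes A :: "('m::{t2_space,second_countable_topology}, 'e::real_normed_vector) chart set"
    and lb :: "'g::real_normed_vector \<Rightarrow> 'g \<Rightarrow> 'g"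
    and ip :: "'g \<Rightarrow> 'g \<Rightarrow> real"
    and U :: "'i \<Rightarrow> 'm set"
    and \<theta> :: "'i \<Rightarrow> 'm \<Rightarrow> 'e \<Rightarrow> 'g"
    and B :: "'i \<Rightarrow> 'm \<Rightarrow> 'e \<Rightarrow> ('e \<Rightarrow>\<^sub>L real)"
    and \<phi> :: "'i \<Rightarrow> 'i \<Rightarrow> 'm \<Rightarrow> 'e \<Rightarrow> 'g"
    and \<tau> :: "'i \<Rightarrow> 'i \<Rightarrow> 'm \<Rightarrow> 'g \<Rightarrow> 'g"
    and \<beta> :: "'i \<Rightarrow> 'i \<Rightarrow> 'm \<Rightarrow> 'e \<Rightarrow> ('e \<Rightarrow>\<^sub>L real)"
  assumes \<theta>_form: "one_form A (U i) (\<theta> i)"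
    and B_form: "two_form A (U i) (B i)"
    and \<phi>_map: "bundle_map A (U i \<inter> U j) (tangent_bundle A) trivial_bundle (\<phi> i j)"
    and \<beta>_map: "bundle_map A (U i \<inter> U j) (tangent_bundle A) (cotangent_bundle A) (\<beta> i j)"
    and \<tau>_map: "bundle_map A (U i \<inter> U j) trivial_bundle trivial_bundle (\<tau> i j)"
    and \<tau>_bij: "x \<in> U i \<inter> U j \<Longrightarrow> bij (\<tau> i j x)"
    and \<tau>_bracket: "x \<in> U i \<inter> U j \<Longrightarrow> \<tau> i j x (lb a b) = lb (\<tau> i j x a) (\<tau> i j x b)"
    and \<tau>_orthogonal: "x \<in> U i \<inter> U j \<Longrightarrow> ip (\<tau> i j x a) (\<tau> i j x b) = ip a b"
    and automorphism:
      "courant_iso A (U i \<inter> U j) (sections A (U i \<inter> U j) (std_courant A lb ip))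
         (std_courant A lb ip) (std_courant A lb ip) (gluing_map ip (\<phi> i j) (\<tau> i j) (\<beta> i j))"
    and \<theta>_compatible: "x \<in> U i \<inter> U j \<Longrightarrow> \<theta> i x v = \<tau> i j x (\<theta> j x v) + \<phi> i j x v"
    and B_compatible: "x \<in> U i \<inter> U j \<Longrightarrow>
      B j x v - B i x v =
        \<beta> i j x v + star ip (\<theta> i x) (\<theta> i x v) - star ip (\<theta> j x) (\<theta> j x v)
        - 2 *\<^sub>R star ip (\<phi> i j x) (\<tau> i j x (\<theta> j x v))"
    and cs3_compatible: "x \<in> U i \<inter> U j \<Longrightarrow>
      cs3 A lb ip (\<theta> j) x u v w - cs3 A lb ip (\<theta> i) x u v w =
        ext_deriv2 A (\<lambda>y u v. blinfun_apply (B j y u - B i y u) v) x u v w"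
    and cocycle: "x \<in> U i \<inter> U j \<inter> U k \<Longrightarrow>
      gluing_map ip (\<phi> i j) (\<tau> i j) (\<beta> i j) x
        (gluing_map ip (\<phi> j k) (\<tau> j k) (\<beta> j k) x e) =
      gluing_map ip (\<phi> i k) (\<tau> i k) (\<beta> i k) x e"

text \<open>
  The transitive Courant algebroid \<open>C\<close> over the manifold with connection \<open>(s, \<sigma>)\<close> is obtained from
  the data: \<open>C\<close> is glued from the standard algebroids over the \<open>U i\<close> along the transition maps
  \<open>gluing_map\<close> (with local identifications \<open>\<Psi> i\<close>), and the local expression of \<open>s\<close> is
  $X \mapsto X + \theta_i(X) - \iota_X B_i - (\theta_i, \theta_i(X))$.
  By orthogonality and nondegeneracy, \<open>s\<close> determines \<open>\<sigma>\<close>, with local expression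
  $a \mapsto a - 2\,(\theta_i, a)$.
\<close>

definition arises_from_data ::
  "('m::topological_space, 'e::real_normed_vector) chart set \<Rightarrow>
   ('g::real_normed_vector \<Rightarrow> 'g \<Rightarrow> 'g) \<Rightarrow> ('g \<Rightarrow> 'g \<Rightarrow> real) \<Rightarrow> ('i \<Rightarrow> 'm set) \<Rightarrow>
   ('i \<Rightarrow> 'm \<Rightarrow> 'e \<Rightarrow> 'g) \<Rightarrow> ('i \<Rightarrow> 'm \<Rightarrow> 'e \<Rightarrow> ('e \<Rightarrow>\<^sub>L real)) \<Rightarrow>
   ('i \<Rightarrow> 'i \<Rightarrow> 'm \<Rightarrow> 'e \<Rightarrow> 'g) \<Rightarrow> ('i \<Rightarrow> 'i \<Rightarrow> 'm \<Rightarrow> 'g \<Rightarrow> 'g) \<Rightarrow>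
   ('i \<Rightarrow> 'i \<Rightarrow> 'm \<Rightarrow> 'e \<Rightarrow> ('e \<Rightarrow>\<^sub>L real)) \<Rightarrow>
   ('m, 'v::real_vector, 'f::real_normed_vector, 'e) courant \<Rightarrow> ('m \<Rightarrow> 'e \<Rightarrow> 'v) \<Rightarrow> bool" where
  "arises_from_data A lb ip U \<theta> B \<phi> \<tau> \<beta> C s \<longleftrightarrow>
    (\<exists>\<Psi> :: 'i \<Rightarrow> 'm \<Rightarrow> 'v \<Rightarrow> ('e, 'g) std_fiber.
      (\<forall>i. courant_iso A (U i) (sections A UNIV C) C (std_courant A lb ip) (\<Psi> i)) \<and>
      (\<forall>i j. \<forall>x\<in>U i \<inter> U j. \<forall>e\<in>fiber C x.
         \<Psi> i x e = gluing_map ip (\<phi> i j) (\<tau> i j) (\<beta> i j) x (\<Psi> j x e)) \<and>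
      (\<forall>i. \<forall>x\<in>U i. \<forall>v.
         \<Psi> i x (s x v) = (v, \<theta> i x v, - B i x v - star ip (\<theta> i x) (\<theta> i x v))))"

end

theory Submission
  imports Defs
begin

text \<open>
  The bundle \<open>C\<close> is glued from the standard algebroids by the cocycle of automorphisms; since these
  preserve anchor, pairing and bracket, the structure descends, and each axiom can be checked over
  one \<open>U i\<close>, that is, for the standard bracket. There the local expressions
  $X \mapsto X + \theta_i(X) - \iota_X B_i - (\theta_i, \theta_i(X))$ and $a \mapsto a - 2(\theta_i, a)$ agree on
  overlaps by the compatibility conditions, hence define the connection.

  In a chart the standard bracket has the compact form
  $De_2(\rho e_1) - De_1(\rho e_2) + [a_1, a_2] + 2\langle De_1, e_2\rangle$, the last term being a 1-form.
  Pairing it with an arbitrary vector, the Leibniz identity becomes an identity between the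
  2-jets of the sections, which holds by symmetry of second derivatives and the Jacobi identity.
  Since the bracket at a point is defined through the preferred chart of that point, a nested
  bracket mixes charts, and the formula has to be shown invariant under changes of chart.
\<close>

section \<open>Finite-dimensional spaces\<close>

text \<open>Finite dimension is a predicate on normed spaces, so bounded coordinate functionals have
  to be constructed first. They are needed whenever a derivative is applied to a direction that
  varies with the point: \<open>Ck_on\<close> controls derivatives in fixed directions only, and an
  expansion in coordinates separates the two dependences. The covector part of the bracket is given
  only by its values. Pairing with a constant \<open>w\<close> makes it the scalar <De1(rho w), e2>,
  in which the factor 2 cancels the 1/2 of the pairing; nondegeneracy returns the vector identity.
  The derivative of a bracket is obtained in the same way. Besides the preferred chart, the index
  \<open>idx x\<close> used to describe the glued fibre also jumps with \<open>x\<close>. Hence no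
  formula at \<open>x\<close> may be differentiated before it has been transferred to a fixed
  \<open>U i\<close>. Moreover a global section of the glued bundle is only a local section of the
  standard one over \<open>U i\<close>. For both reasons the facts about the standard bracket are
  proved over arbitrary open sets, together with its locality.\<close>

lemma independent_coeff_bound:
  fixes B :: "'a::real_normed_vector set"
  assumes "finite B" "independent B"
  shows "\<exists>K>0. \<forall>c. (\<Sum>b\<in>B. \<bar>c b\<bar>) \<le> K * norm (\<Sum>b\<in>B. c b *\<^sub>R b)"
  using assms
proof (induction B rule: finite_induct)
  case empty
  show ?case by (auto intro: exI[of _ 1])
next
  case (insert a B)
  then have indB: "independent B" and a: "a \<notin> span B"
    by (auto simp: independent_insert)
  from insert.IH[OF indB] obtain K where K: "K > 0"
    "\<And>c. (\<Sum>b\<in>B. \<bar>c b\<bar>) \<le> K * norm (\<Sum>b\<in>B. c b *\<^sub>R b)" by blast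
  \<comment> \<open>This \<open>d\<close> is a positive distance of \<open>a\<close> from the span
    of \<open>B\<close>. Vectors of the span tending to \<open>-a\<close> would have Cauchy
    coefficients by the induction hypothesis, and the limits of these would put \<open>a\<close>
    into the span. Only completeness of the reals is used.\<close>
  have "\<exists>d>0. \<forall>c. d \<le> norm (a + (\<Sum>b\<in>B. c b *\<^sub>R b))"
  proof (rule ccontr)
    assume neg: "\<not> ?thesis"
    have "\<exists>c. norm (a + (\<Sum>b\<in>B. c b *\<^sub>R b)) < inverse (Suc n)" for n
      using neg by (meson not_le of_nat_0_less_iff positive_imp_inverse_positive zero_less_Suc)
    then obtain c where c: "\<And>n. norm (a + (\<Sum>b\<in>B. c n b *\<^sub>R b)) < inverse (Suc n)"
      by metis
    have lim: "(\<lambda>n. a + (\<Sum>b\<in>B. c n b *\<^sub>R b)) \<longlonglongrightarrow> 0"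
      by (rule LIMSEQ_norm_0) (use c in \<open>simp add: inverse_eq_divide\<close>)
    then have "Cauchy (\<lambda>n. a + (\<Sum>b\<in>B. c n b *\<^sub>R b))"
      by (rule LIMSEQ_imp_Cauchy)
    moreover have bd: "\<bar>c m b - c n b\<bar> \<le> K * dist (a + (\<Sum>b\<in>B. c m b *\<^sub>R b)) (a + (\<Sum>b\<in>B. c n b *\<^sub>R b))"
      if "b \<in> B" for b m n
    proof -
      have "\<bar>c m b - c n b\<bar> \<le> (\<Sum>b\<in>B. \<bar>c m b - c n b\<bar>)"
        by (rule member_le_sum[OF that]) (use insert in auto)
      also have "\<dots> \<le> K * norm (\<Sum>b\<in>B. (c m b - c n b) *\<^sub>R b)"
        by (rule K(2))
      finally show ?thesis
        by (simp add: dist_norm scaleR_diff_left sum_subtractf)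
    qed
    ultimately have Cau: "Cauchy (\<lambda>n. c n b)" if "b \<in> B" for b
      unfolding Cauchy_def
    proof (intro allI impI)
      fix e :: real assume C: "\<forall>e>0. \<exists>M. \<forall>m\<ge>M. \<forall>n\<ge>M. dist (a + (\<Sum>b\<in>B. c m b *\<^sub>R b)) (a + (\<Sum>b\<in>B. c n b *\<^sub>R b)) < e"
        and "e > 0"
      with K(1) obtain M where M: "\<forall>m\<ge>M. \<forall>n\<ge>M. dist (a + (\<Sum>b\<in>B. c m b *\<^sub>R b)) (a + (\<Sum>b\<in>B. c n b *\<^sub>R b)) < e / K"
        by (meson divide_pos_pos)
      have "dist (c m b) (c n b) < e" if "m \<ge> M" "n \<ge> M" for m n
      proof -
        have "dist (c m b) (c n b) \<le> K * dist (a + (\<Sum>b\<in>B. c m b *\<^sub>R b)) (a + (\<Sum>b\<in>B. c n b *\<^sub>R b))"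
          using bd[OF \<open>b \<in> B\<close>, of m n] by (simp add: dist_real_def)
        also have "\<dots> < K * (e / K)"
          using M that K(1) by (intro mult_strict_left_mono) auto
        finally show ?thesis using K(1) by simp
      qed
      then show "\<exists>M. \<forall>m\<ge>M. \<forall>n\<ge>M. dist (c m b) (c n b) < e" by blast
    qed
    then have "\<exists>l. (\<lambda>n. c n b) \<longlonglongrightarrow> l" if "b \<in> B" for b
      using that Cauchy_convergent convergent_def by blast
    then obtain l where l: "\<And>b. b \<in> B \<Longrightarrow> (\<lambda>n. c n b) \<longlonglongrightarrow> l b" by metis
    have "(\<lambda>n. a + (\<Sum>b\<in>B. c n b *\<^sub>R b)) \<longlonglongrightarrow> a + (\<Sum>b\<in>B. l b *\<^sub>R b)"
      by (intro tendsto_intros l)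
    with lim have "a + (\<Sum>b\<in>B. l b *\<^sub>R b) = 0"
      using LIMSEQ_unique by blast
    then have "a = - (\<Sum>b\<in>B. l b *\<^sub>R b)" by (simp add: add_eq_0_iff2)
    then have "a \<in> span B"
      by (auto intro!: span_neg span_sum span_scale intro: span_base)
    with a show False by contradiction
  qed
  then obtain d where d: "d > 0" "\<And>c. d \<le> norm (a + (\<Sum>b\<in>B. c b *\<^sub>R b))" by blast
  have da: "\<bar>c a\<bar> * d \<le> norm (c a *\<^sub>R a + (\<Sum>b\<in>B. c b *\<^sub>R b))" for c
  proof (cases "c a = 0")
    case False
    have "\<bar>c a\<bar> * d \<le> \<bar>c a\<bar> * norm (a + (\<Sum>b\<in>B. (c b / c a) *\<^sub>R b))"
      by (intro mult_left_mono d(2)) simp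
    also have "\<dots> = norm (c a *\<^sub>R (a + (\<Sum>b\<in>B. (c b / c a) *\<^sub>R b)))" by simp
    also have "c a *\<^sub>R (a + (\<Sum>b\<in>B. (c b / c a) *\<^sub>R b)) = c a *\<^sub>R a + (\<Sum>b\<in>B. c b *\<^sub>R b)"
      using False by (simp add: scaleR_add_right scaleR_sum_right)
    finally show ?thesis .
  qed simp
  show ?case
  \<comment> \<open>With N the norm of the whole sum, the coefficient of \<open>a\<close> is at most
    N/d, so the part in the span of \<open>B\<close> has norm at most N (1 + norm a / d), and the
    bound \<open>K\<close> applies to it.\<close>
  proof (intro exI[of _ "1/d + K * (1 + norm a / d)"] conjI allI)
    show "0 < 1/d + K * (1 + norm a / d)"
      using d K by (simp add: add_pos_nonneg)
    fix c :: "'a \<Rightarrow> real"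
    let ?s = "\<Sum>b\<in>B. c b *\<^sub>R b" and ?N = "norm (c a *\<^sub>R a + (\<Sum>b\<in>B. c b *\<^sub>R b))"
    have 1: "\<bar>c a\<bar> \<le> ?N / d"
      using da[of c] d(1) by (simp add: pos_le_divide_eq)
    have "norm ?s \<le> ?N + norm (c a *\<^sub>R a)"
      using norm_triangle_ineq4[of "c a *\<^sub>R a + ?s" "c a *\<^sub>R a"] by simp
    also have "norm (c a *\<^sub>R a) \<le> ?N / d * norm a"
      using mult_right_mono[OF 1 norm_ge_zero[of a]] by simp
    finally have 2: "norm ?s \<le> ?N * (1 + norm a / d)"
      by (simp add: algebra_simps)
    have "(\<Sum>b\<in>insert a B. \<bar>c b\<bar>) = \<bar>c a\<bar> + (\<Sum>b\<in>B. \<bar>c b\<bar>)"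
      using insert by simp
    also have "\<dots> \<le> ?N / d + K * norm ?s" by (intro add_mono 1 K(2))
    also have "\<dots> \<le> ?N / d + K * (?N * (1 + norm a / d))"
      using mult_left_mono[OF 2, of K] K(1) by simp
    also have "\<dots> = (1/d + K * (1 + norm a / d)) * norm (\<Sum>b\<in>insert a B. c b *\<^sub>R b)"
      using insert by (simp add: algebra_simps)
    finally show "(\<Sum>b\<in>insert a B. \<bar>c b\<bar>) \<le> (1/d + K * (1 + norm a / d)) * norm (\<Sum>b\<in>insert a B. c b *\<^sub>R b)" .
  qed
qed

text \<open>Later proofs use finite dimension mainly in this form. The coordinates belong to a basis
  extracted from the finite spanning set and are bounded by \<open>independent_coeff_bound\<close>;
  an empty basis covers dimension 0.\<close>

lemma finite_dim_coordinates:
  assumes "finite_dim TYPE('a::real_normed_vector)"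
  obtains B :: "'a::real_normed_vector set" and k where "finite B" "\<And>b. bounded_linear (k b)"
    "\<And>x. x = (\<Sum>b\<in>B. k b x *\<^sub>R b)"
proof -
  obtain B0 :: "'a set" where B0: "finite B0" "span B0 = UNIV"
    using assms by (auto simp: finite_dim_def)
  obtain B where B: "B \<subseteq> B0" "independent B" "B0 \<subseteq> span B"
    by (rule maximal_independent_subset)
  have fB: "finite B" using B(1) B0(1) by (rule finite_subset)
  have sB: "span B = UNIV"
    using span_minimal[OF B(3) subspace_span] B0(2) by auto
  let ?k = "\<lambda>b x. representation B x b"
  have sum: "x = (\<Sum>b\<in>B. ?k b x *\<^sub>R b)" for x
    by (rule sum_representation_eq[symmetric]) (use B fB sB in auto)
  obtain K where K: "K > 0" "\<And>c. (\<Sum>b\<in>B. \<bar>c b\<bar>) \<le> K * norm (\<Sum>b\<in>B. c b *\<^sub>R b)"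
    using independent_coeff_bound[OF fB B(2)] by blast
  have "bounded_linear (?k b)" for b
  proof (rule bounded_linear_intro[where K=K])
    show "?k b (x + y) = ?k b x + ?k b y" for x y
      using B sB by (simp add: representation_add)
    show "?k b (r *\<^sub>R x) = r *\<^sub>R ?k b x" for r x
      using B sB by (simp add: representation_scale)
    fix x
    show "norm (?k b x) \<le> norm x * K"
    proof (cases "b \<in> B")
      case True
      have "norm (?k b x) \<le> (\<Sum>b\<in>B. \<bar>?k b x\<bar>)"
        using member_le_sum[of b B "\<lambda>b. \<bar>?k b x\<bar>"] fB True by simp
      also have "\<dots> \<le> K * norm x" using K(2)[of "\<lambda>b. ?k b x"] by (simp only: sum[of x, symmetric])
      finally show ?thesis by (simp add: mult.commute)
    next
      case False
      then have "?k b x = 0" using representation_ne_zero by blast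
      with K show ?thesis by simp
    qed
  qed
  from that[OF fB this sum] show thesis .
qed

lemma linear_imp_bounded_linear:
  fixes f :: "'a::real_normed_vector \<Rightarrow> 'b::real_normed_vector"
  assumes fd: "finite_dim TYPE('a)" and f: "linear f"
  shows "bounded_linear f"
proof -
  obtain B :: "'a set" and k where B: "finite B" "\<And>b. bounded_linear (k b)"
    "\<And>x. x = (\<Sum>b\<in>B. k b x *\<^sub>R b)" by (rule finite_dim_coordinates[OF fd]) (rule that; assumption)
  have "f x = (\<Sum>b\<in>B. k b x *\<^sub>R f b)" for x
  proof -
    have "f x = f (\<Sum>b\<in>B. k b x *\<^sub>R b)" by (rule arg_cong[OF B(3)])
    also have "\<dots> = (\<Sum>b\<in>B. k b x *\<^sub>R f b)" using f by (simp add: linear_sum linear_scale)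
    finally show ?thesis .
  qed
  from this[symmetric] have eq: "(\<lambda>x. \<Sum>b\<in>B. k b x *\<^sub>R f b) = f" by (rule ext)
  have "bounded_linear (\<lambda>x. \<Sum>b\<in>B. k b x *\<^sub>R f b)"
    by (intro bounded_linear_sum bounded_linear_scaleR_const B)
  then show ?thesis unfolding eq .
qed

lemma bilinear_imp_bounded_bilinear:
  fixes h :: "'a::real_normed_vector \<Rightarrow> 'b::real_normed_vector \<Rightarrow> 'c::real_normed_vector"
  assumes fda: "finite_dim TYPE('a)" and fdb: "finite_dim TYPE('b)" and h: "bilinear h"
  shows "bounded_bilinear h"
proof -
  obtain B :: "'a set" and k where B: "finite B" "\<And>b. bounded_linear (k b)"
    "\<And>x. x = (\<Sum>b\<in>B. k b x *\<^sub>R b)" by (rule finite_dim_coordinates[OF fda]) (rule that; assumption)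
  have l1: "linear (\<lambda>x. h x y)" and l2: "linear (h x)" for x y
    using h by (auto simp: bilinear_def)
  \<comment> \<open>Only the first argument is expanded; for each basis vector the second one is
    covered by the linear case.\<close>
  have eq: "h x y = (\<Sum>b\<in>B. k b x *\<^sub>R h b y)" for x y
  proof -
    have "h x y = h (\<Sum>b\<in>B. k b x *\<^sub>R b) y" by (rule arg_cong[OF B(3)])
    also have "\<dots> = (\<Sum>b\<in>B. h (k b x *\<^sub>R b) y)" by (rule linear_sum[OF l1])
    also have "\<dots> = (\<Sum>b\<in>B. k b x *\<^sub>R h b y)" by (simp add: bilinear_lmul[OF h])
    finally show ?thesis .
  qed
  have bl: "bounded_linear (h b)" for b by (rule linear_imp_bounded_linear[OF fdb l2])
  show ?thesis
  proof
    show "h (a + a') b = h a b + h a' b" for a a' b using h by (rule bilinear_ladd)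
    show "h a (b + b') = h a b + h a b'" for a b b' using h by (rule bilinear_radd)
    show "h (r *\<^sub>R a) b = r *\<^sub>R h a b" for r a b using h by (rule bilinear_lmul)
    show "h a (r *\<^sub>R b) = r *\<^sub>R h a b" for r a b using h by (rule bilinear_rmul)
    show "\<exists>K. \<forall>a b. norm (h a b) \<le> norm a * norm b * K"
    proof (intro exI allI)
      fix x y
      have "norm (h x y) \<le> (\<Sum>b\<in>B. norm (k b x *\<^sub>R h b y))"
        unfolding eq[of x y] by (rule norm_sum)
      also have "\<dots> \<le> (\<Sum>b\<in>B. (onorm (k b) * norm x) * (onorm (h b) * norm y))"
        unfolding norm_scaleR
      proof (rule sum_mono, rule mult_mono)
        fix b
        show "\<bar>k b x\<bar> \<le> onorm (k b) * norm x"
          using onorm[OF B(2)[of b], of x] by simp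
        show "norm (h b y) \<le> onorm (h b) * norm y"
          by (rule onorm[OF bl])
        show "0 \<le> onorm (k b) * norm x"
          using onorm_pos_le[OF B(2)[of b]] by simp
      qed simp
      also have "\<dots> = norm x * norm y * (\<Sum>b\<in>B. onorm (k b) * onorm (h b))"
        by (simp add: sum_distrib_left algebra_simps)
      finally show "norm (h x y) \<le> norm x * norm y * (\<Sum>b\<in>B. onorm (k b) * onorm (h b))" .
    qed
  qed
qed

lemma finite_dim_prod:
  assumes "finite_dim TYPE('a::real_normed_vector)" "finite_dim TYPE('b::real_normed_vector)"
  shows "finite_dim TYPE('a \<times> 'b)"
proof -
  obtain A :: "'a set" where A: "finite A" "span A = UNIV"
    using assms by (auto simp: finite_dim_def)
  obtain B :: "'b set" where B: "finite B" "span B = UNIV"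
    using assms by (auto simp: finite_dim_def)
  let ?C = "(\<lambda>x. (x, 0)) ` A \<union> (\<lambda>x. (0, x)) ` B"
  have 1: "linear (\<lambda>x. (x::'a, 0::'b))" and 2: "linear (\<lambda>x. (0::'a, x::'b))"
    by (auto intro!: linearI)
  have "(x, y) \<in> span ?C" for x y
  proof -
    have "(x, 0::'b) \<in> span ((\<lambda>x. (x, 0)) ` A)"
      unfolding linear_span_image[OF 1] using A by simp
    moreover have "(0::'a, y) \<in> span ((\<lambda>x. (0, x)) ` B)"
      unfolding linear_span_image[OF 2] using B by simp
    ultimately have "(x, 0) \<in> span ?C" "(0, y) \<in> span ?C"
      by (meson span_mono subsetD sup_ge1 sup_ge2)+
    then have "(x, 0) + (0, y) \<in> span ?C" by (rule span_add)
    then show ?thesis by simp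
  qed
  then have "span ?C = UNIV" by auto
  moreover have "finite ?C" using A B by simp
  ultimately show ?thesis unfolding finite_dim_def by blast
qed

text \<open>Each summand depends only on the value of the operator at one basis vector. This yields
  both finite dimension of the dual space and smoothness of operator-valued maps from smoothness of
  their values.\<close>

lemma blinfun_coordinates:
  fixes \<xi> :: "'a::real_normed_vector \<Rightarrow>\<^sub>L 'b::real_normed_vector"
  assumes "\<And>b. bounded_linear (k b)" "\<And>x. x = (\<Sum>b\<in>B. k b x *\<^sub>R b)"
  shows "\<xi> = (\<Sum>b\<in>B. Blinfun (\<lambda>x. k b x *\<^sub>R blinfun_apply \<xi> b))"
proof (rule blinfun_eqI)
  fix x
  have "blinfun_apply \<xi> x = blinfun_apply \<xi> (\<Sum>b\<in>B. k b x *\<^sub>R b)" by (rule arg_cong[OF assms(2)])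
  also have "\<dots> = (\<Sum>b\<in>B. k b x *\<^sub>R blinfun_apply \<xi> b)"
    by (simp add: blinfun.sum_right blinfun.scaleR_right)
  also have "\<dots> = blinfun_apply (\<Sum>b\<in>B. Blinfun (\<lambda>x. k b x *\<^sub>R blinfun_apply \<xi> b)) x"
    by (simp add: blinfun.sum_left bounded_linear_Blinfun_apply bounded_linear_scaleR_const assms(1))
  finally show "blinfun_apply \<xi> x = \<dots>" .
qed

lemma finite_dim_dual:
  assumes "finite_dim TYPE('a::real_normed_vector)"
  shows "finite_dim TYPE('a \<Rightarrow>\<^sub>L real)"
proof -
  obtain B :: "'a set" and k where B: "finite B" "\<And>b. bounded_linear (k b)"
    "\<And>x. x = (\<Sum>b\<in>B. k b x *\<^sub>R b)" by (rule finite_dim_coordinates[OF assms]) (rule that; assumption)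
  have "\<xi> \<in> span ((\<lambda>b. Blinfun (k b)) ` B)" for \<xi> :: "'a \<Rightarrow>\<^sub>L real"
  proof -
    have eq: "Blinfun (\<lambda>x. k b x *\<^sub>R blinfun_apply \<xi> b) = blinfun_apply \<xi> b *\<^sub>R Blinfun (k b)" for b
      by (rule blinfun_eqI)
        (simp add: bounded_linear_Blinfun_apply B blinfun.scaleR_left bounded_linear_mult_const)
    have "\<xi> = (\<Sum>b\<in>B. Blinfun (\<lambda>x. k b x *\<^sub>R blinfun_apply \<xi> b))"
      by (rule blinfun_coordinates[OF B(2,3)])
    also have "\<dots> = (\<Sum>b\<in>B. blinfun_apply \<xi> b *\<^sub>R Blinfun (k b))"
      by (simp only: eq)
    also have "\<dots> \<in> span ((\<lambda>b. Blinfun (k b)) ` B)"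
      by (intro span_sum span_scale span_base) auto
    finally show ?thesis .
  qed
  then show ?thesis using B(1) unfolding finite_dim_def by blast
qed

section \<open>Calculus of smooth maps\<close>

abbreviation FD :: "('a::real_normed_vector \<Rightarrow> 'b::real_normed_vector) \<Rightarrow> 'a \<Rightarrow> 'a \<Rightarrow> 'b" where
  "FD f x \<equiv> frechet_derivative f (at x)"

lemma FD_has_derivative: "f differentiable (at x) \<Longrightarrow> (f has_derivative FD f x) (at x)"
  by (simp add: frechet_derivative_works)

lemma FD_eq: "(f has_derivative f') (at x) \<Longrightarrow> FD f x = f'"
  using frechet_derivative_at by metis

text \<open>No differentiability is assumed: \<open>f\<close> and \<open>g\<close> have the same
  derivatives at \<open>x\<close>, so the choice operator inside \<open>frechet_derivative\<close>
  picks the same one.\<close>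

lemma FD_cong:
  assumes "open S" "x \<in> S" "\<And>y. y \<in> S \<Longrightarrow> f y = g y"
  shows "FD f x = FD g x"
proof -
  have "(f has_derivative f') (at x) \<longleftrightarrow> (g has_derivative f') (at x)" for f'
    using assms has_derivative_transform_within_open[OF _ assms(1,2)] by metis
  then show ?thesis unfolding frechet_derivative_def by simp
qed

lemma differentiable_cong:
  assumes "open S" "x \<in> S" "\<And>y. y \<in> S \<Longrightarrow> f y = g y" "f differentiable (at x)"
  shows "g differentiable (at x)"
  using assms has_derivative_transform_within_open[OF _ assms(1,2)] unfolding differentiable_def by metis

lemma Ck_on_cong:
  assumes "open S" "\<And>y. y \<in> S \<Longrightarrow> f y = g y" "Ck_on k S f"
  shows "Ck_on k S g"
  using assms(2,3)
proof (induction k arbitrary: f g)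
  case 0
  then show ?case by (simp cong: continuous_on_cong)
next
  case (Suc k)
  have "FD f y v = FD g y v" if "y \<in> S" for y v
    using FD_cong[OF assms(1) that Suc.prems(1)] by simp
  moreover have "Ck_on k S (\<lambda>x. FD f x v)" for v
    using Suc.prems(2) by simp
  ultimately have "Ck_on k S (\<lambda>x. FD g x v)" for v
    by (rule Suc.IH)
  moreover have "g differentiable (at y)" if "y \<in> S" for y
    using differentiable_cong[OF assms(1) that Suc.prems(1)] Suc.prems(2) that by simp
  ultimately show ?case by simp
qed

text \<open>\<open>T\<close> may be any subset: the differentiability clauses refer to full
  neighbourhoods of points, and only continuity at order 0 is relative to the set.\<close>

lemma Ck_on_subset: "Ck_on k S f \<Longrightarrow> T \<subseteq> S \<Longrightarrow> Ck_on k T f"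
proof (induction k arbitrary: f)
  case 0
  then show ?case by (simp add: continuous_on_subset)
next
  case (Suc k)
  then show ?case by (simp add: subset_iff)
qed

lemma Ck_on_local:
  assumes "\<And>x. x \<in> S \<Longrightarrow> \<exists>T. open T \<and> x \<in> T \<and> Ck_on k T f"
  shows "Ck_on k S f"
  using assms
proof (induction k arbitrary: f)
  case 0
  have "isCont f x" if "x \<in> S" for x
    using 0[OF that] continuous_on_eq_continuous_at by auto
  then show ?case by (simp add: continuous_at_imp_continuous_on)
next
  case (Suc k)
  have "Ck_on k S (\<lambda>x. FD f x v)" for v
    by (rule Suc.IH) (use Suc.prems in force)
  moreover have "\<forall>x\<in>S. f differentiable (at x)"
    using Suc.prems by force
  ultimately show ?case by simp
qed

lemma Ck_on_SucD: "Ck_on (Suc k) S f \<Longrightarrow> Ck_on k S f"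
proof (induction k arbitrary: f)
  case 0
  then show ?case
    by (auto intro!: continuous_at_imp_continuous_on differentiable_imp_continuous_within)
next
  case (Suc k)
  then show ?case by auto
qed

text \<open>Eliminates the order \<open>k\<close>, so that smoothness passes to directional
  derivatives without counting.\<close>

lemma smooth_on_iff:
  "smooth_on S f \<longleftrightarrow> (\<forall>x\<in>S. f differentiable (at x)) \<and> (\<forall>v. smooth_on S (\<lambda>x. FD f x v))"
    (is "?l = ?r")
proof
  assume l: ?l
  then have "Ck_on (Suc k) S f" for k unfolding smooth_on_def by blast
  then show ?r unfolding smooth_on_def by auto
next
  assume r: ?r
  have "Ck_on (Suc k) S f" for k using r by (auto simp: smooth_on_def)
  then have "Ck_on k S f" for k using Ck_on_SucD by blast
  then show ?l by (simp add: smooth_on_def)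
qed

lemma smooth_on_differentiable: "smooth_on S f \<Longrightarrow> x \<in> S \<Longrightarrow> f differentiable (at x)"
  using smooth_on_iff by blast

lemma smooth_on_has_derivative: "smooth_on S f \<Longrightarrow> x \<in> S \<Longrightarrow> (f has_derivative FD f x) (at x)"
  by (simp add: FD_has_derivative smooth_on_differentiable)

lemma smooth_on_FD: "smooth_on S f \<Longrightarrow> smooth_on S (\<lambda>x. FD f x v)"
  using smooth_on_iff by blast

lemma smooth_on_cong: "open S \<Longrightarrow> (\<And>y. y \<in> S \<Longrightarrow> f y = g y) \<Longrightarrow> smooth_on S f \<Longrightarrow> smooth_on S g"
  unfolding smooth_on_def using Ck_on_cong by blast

lemma smooth_on_subset: "smooth_on S f \<Longrightarrow> T \<subseteq> S \<Longrightarrow> smooth_on T f"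
  unfolding smooth_on_def using Ck_on_subset by blast

lemma smooth_on_local:
  "(\<And>x. x \<in> S \<Longrightarrow> \<exists>T. open T \<and> x \<in> T \<and> smooth_on T f) \<Longrightarrow> smooth_on S f"
  unfolding smooth_on_def using Ck_on_local by metis

section \<open>Closure of smooth maps under linear operations, products and composition\<close>

lemma Ck_on_const: "Ck_on k S (\<lambda>x. c)"
  by (induction k arbitrary: c) auto

lemma Ck_on_add: "open S \<Longrightarrow> Ck_on k S f \<Longrightarrow> Ck_on k S g \<Longrightarrow> Ck_on k S (\<lambda>x. f x + g x)"
proof (induction k arbitrary: f g)
  case 0
  then show ?case by (simp add: continuous_on_add)
next
  case (Suc k)
  have d: "((\<lambda>x. f x + g x) has_derivative (\<lambda>v. FD f x v + FD g x v)) (at x)" if "x \<in> S" for x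
    using Suc.prems that by (auto intro!: has_derivative_add FD_has_derivative)
  have "Ck_on k S (\<lambda>x. FD f x v + FD g x v)" for v
    using Suc.prems by (intro Suc.IH) auto
  then have "Ck_on k S (\<lambda>x. FD (\<lambda>x. f x + g x) x v)" for v
    by (rule Ck_on_cong[OF Suc.prems(1), rotated]) (simp add: FD_eq[OF d])
  then show ?case using d by (auto simp: differentiable_def)
qed

lemma Ck_on_bilinear:
  assumes h: "bounded_bilinear h" and S: "open S"
  shows "Ck_on k S f \<Longrightarrow> Ck_on k S g \<Longrightarrow> Ck_on k S (\<lambda>x. h (f x) (g x))"
proof (induction k arbitrary: f g)
  case 0
  then show ?case using bounded_bilinear.continuous_on[OF h] by simp
next
  case (Suc k)
  have d: "((\<lambda>x. h (f x) (g x)) has_derivative (\<lambda>v. h (f x) (FD g x v) + h (FD f x v) (g x))) (at x)"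
    if "x \<in> S" for x
    using Suc.prems that by (auto intro!: bounded_bilinear.FDERIV[OF h] FD_has_derivative)
  \<comment> \<open>The product rule mixes orders: the undifferentiated factors are lowered from
    \<open>Suc k\<close> to \<open>k\<close> by \<open>Ck_on_SucD\<close>.\<close>
  have "Ck_on k S (\<lambda>x. h (f x) (FD g x v) + h (FD f x v) (g x))" for v
    using Suc.prems by (intro Ck_on_add Suc.IH S) (auto intro: Ck_on_SucD simp del: Ck_on.simps(2), auto)
  then have "Ck_on k S (\<lambda>x. FD (\<lambda>x. h (f x) (g x)) x v)" for v
    by (rule Ck_on_cong[OF S, rotated]) (simp add: FD_eq[OF d])
  then show ?case using d by (auto simp: differentiable_def)
qed

lemma Ck_on_linear:
  assumes h: "bounded_linear h" and S: "open S"
  shows "Ck_on k S f \<Longrightarrow> Ck_on k S (\<lambda>x. h (f x))"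
proof (induction k arbitrary: f)
  case 0
  then show ?case using bounded_linear.continuous_on[OF h] by simp
next
  case (Suc k)
  have d: "((\<lambda>x. h (f x)) has_derivative (\<lambda>v. h (FD f x v))) (at x)" if "x \<in> S" for x
    using Suc.prems that by (auto intro!: bounded_linear.has_derivative[OF h] FD_has_derivative)
  have "Ck_on k S (\<lambda>x. h (FD f x v))" for v
    using Suc.prems by (intro Suc.IH) auto
  then have "Ck_on k S (\<lambda>x. FD (\<lambda>x. h (f x)) x v)" for v
    by (rule Ck_on_cong[OF S, rotated]) (simp add: FD_eq[OF d])
  then show ?case using d by (auto simp: differentiable_def)
qed

lemma Ck_on_sum:
  assumes "open S" "\<And>i. i \<in> I \<Longrightarrow> Ck_on k S (f i)"
  shows "Ck_on k S (\<lambda>x. \<Sum>i\<in>I. f i x)"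
  using assms(2) by (induction I rule: infinite_finite_induct) (auto intro: Ck_on_const Ck_on_add assms(1))

lemma smooth_on_const: "smooth_on S (\<lambda>x. c)"
  by (simp add: smooth_on_def Ck_on_const)

lemma smooth_on_add: "open S \<Longrightarrow> smooth_on S f \<Longrightarrow> smooth_on S g \<Longrightarrow> smooth_on S (\<lambda>x. f x + g x)"
  by (simp add: smooth_on_def Ck_on_add)

lemma smooth_on_bilinear:
  "bounded_bilinear h \<Longrightarrow> open S \<Longrightarrow> smooth_on S f \<Longrightarrow> smooth_on S g \<Longrightarrow> smooth_on S (\<lambda>x. h (f x) (g x))"
  by (simp add: smooth_on_def Ck_on_bilinear)

lemma smooth_on_linear:
  "bounded_linear h \<Longrightarrow> open S \<Longrightarrow> smooth_on S f \<Longrightarrow> smooth_on S (\<lambda>x. h (f x))"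
  by (simp add: smooth_on_def Ck_on_linear)

lemma smooth_on_sum:
  "open S \<Longrightarrow> (\<And>i. i \<in> I \<Longrightarrow> smooth_on S (f i)) \<Longrightarrow> smooth_on S (\<lambda>x. \<Sum>i\<in>I. f i x)"
  by (simp add: smooth_on_def Ck_on_sum)

lemma smooth_on_scaleR_left: "open S \<Longrightarrow> smooth_on S f \<Longrightarrow> smooth_on S (\<lambda>x. r *\<^sub>R f x)"
  by (rule smooth_on_linear[OF bounded_linear_scaleR_right])

lemma smooth_on_minus: "open S \<Longrightarrow> smooth_on S f \<Longrightarrow> smooth_on S (\<lambda>x. - f x)"
  by (rule smooth_on_linear[OF bounded_linear_minus[OF bounded_linear_ident]])

lemma smooth_on_diff: "open S \<Longrightarrow> smooth_on S f \<Longrightarrow> smooth_on S g \<Longrightarrow> smooth_on S (\<lambda>x. f x - g x)"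
  using smooth_on_add[OF _ _ smooth_on_minus, of S f g] by simp

lemma smooth_on_fst: "open S \<Longrightarrow> smooth_on S f \<Longrightarrow> smooth_on S (\<lambda>x. fst (f x))"
  and smooth_on_snd: "open S \<Longrightarrow> smooth_on S f \<Longrightarrow> smooth_on S (\<lambda>x. snd (f x))"
  by (erule (1) smooth_on_linear[OF bounded_linear_fst] smooth_on_linear[OF bounded_linear_snd])+

lemma smooth_on_Pair:
  assumes "open S" "smooth_on S f" "smooth_on S g"
  shows "smooth_on S (\<lambda>x. (f x, g x))"
proof -
  have "bounded_linear (\<lambda>x. (x, 0))" "bounded_linear (\<lambda>x. (0, x))"
    by (intro bounded_linear_Pair bounded_linear_ident bounded_linear_zero)+
  from smooth_on_add[OF assms(1) smooth_on_linear[OF this(1) assms(1,2)] smooth_on_linear[OF this(2) assms(1,3)]]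
  show ?thesis by simp
qed

lemma linear_coordinates:
  fixes f :: "'a::real_normed_vector \<Rightarrow> 'b::real_normed_vector"
  assumes "linear f" "\<And>x. x = (\<Sum>b\<in>B. k b x *\<^sub>R b)"
  shows "f x = (\<Sum>b\<in>B. k b x *\<^sub>R f b)"
proof -
  have "f x = f (\<Sum>b\<in>B. k b x *\<^sub>R b)" by (rule arg_cong[OF assms(2)])
  also have "\<dots> = (\<Sum>b\<in>B. k b x *\<^sub>R f b)" using assms(1) by (simp add: linear_sum linear_scale)
  finally show ?thesis .
qed

text \<open>In the chain rule the derivative of \<open>f\<close> is taken in the direction
  \<open>FD g x v\<close>, which moves with \<open>x\<close>. Writing that direction in coordinates
  gives a sum of products of a scalar function with a derivative of \<open>f\<close> in a fixed
  direction, to which the induction hypothesis applies.\<close>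

lemma Ck_on_compose:
  fixes f :: "'a::real_normed_vector \<Rightarrow> 'b::real_normed_vector" and g :: "'c::real_normed_vector \<Rightarrow> 'a"
  assumes fd: "finite_dim TYPE('a)" and S: "open S" and gS: "g ` S \<subseteq> T"
  shows "Ck_on k T f \<Longrightarrow> Ck_on k S g \<Longrightarrow> Ck_on k S (\<lambda>x. f (g x))"
proof (induction k arbitrary: f)
  case 0
  then show ?case using gS by (auto intro: continuous_on_compose2)
next
  case (Suc k)
  obtain B :: "'a set" and c where B: "finite B" "\<And>b. bounded_linear (c b)"
    "\<And>x. x = (\<Sum>b\<in>B. c b x *\<^sub>R b)" by (rule finite_dim_coordinates[OF fd]) (rule that; assumption)
  have df: "f differentiable (at (g x))" and dg: "g differentiable (at x)" if "x \<in> S" for x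
    using Suc.prems that gS by auto
  have d: "((\<lambda>x. f (g x)) has_derivative (\<lambda>v. FD f (g x) (FD g x v))) (at x)" if "x \<in> S" for x
    using diff_chain_at[OF FD_has_derivative[OF dg] FD_has_derivative[OF df]] that
    by (simp add: o_def)
  have "Ck_on k S (\<lambda>x. \<Sum>b\<in>B. c b (FD g x v) *\<^sub>R FD f (g x) b)" for v
  proof (intro Ck_on_sum S Ck_on_bilinear[OF bounded_bilinear_scaleR])
    fix b
    show "Ck_on k S (\<lambda>x. c b (FD g x v))"
      by (rule Ck_on_linear[OF B(2) S]) (use Suc.prems(2) in simp)
    show "Ck_on k S (\<lambda>x. FD f (g x) b)"
      by (rule Suc.IH[of "\<lambda>y. FD f y b", OF _ Ck_on_SucD[OF Suc.prems(2)]])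
        (use Suc.prems(1) in simp)
  qed
  then have "Ck_on k S (\<lambda>x. FD (\<lambda>x. f (g x)) x v)" for v
  proof (rule Ck_on_cong[OF S, rotated])
    fix y assume y: "y \<in> S"
    show "(\<Sum>b\<in>B. c b (FD g y v) *\<^sub>R FD f (g y) b) = FD (\<lambda>x. f (g x)) y v"
      unfolding FD_eq[OF d[OF y]]
      by (rule linear_coordinates[OF linear_frechet_derivative[OF df[OF y]] B(3), symmetric])
  qed
  then show ?case using d by (auto simp: differentiable_def)
qed

lemma smooth_on_compose:
  fixes f :: "'a::real_normed_vector \<Rightarrow> 'b::real_normed_vector"
  assumes "finite_dim TYPE('a)" "open S" "g ` S \<subseteq> T" "smooth_on T f" "smooth_on S g"
  shows "smooth_on S (\<lambda>x. f (g x))"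
  unfolding smooth_on_def
  by (rule allI, rule Ck_on_compose[OF assms(1-3)]) (use assms(4,5) in \<open>simp_all add: smooth_on_def\<close>)

text \<open>Meant for terms such as De2(rho e1), where the direction is itself a smooth function of
  the point.\<close>

lemma smooth_on_FD_field:
  fixes f :: "'a::real_normed_vector \<Rightarrow> 'b::real_normed_vector"
  assumes fd: "finite_dim TYPE('a)" and S: "open S" and f: "smooth_on S f" and h: "smooth_on S h"
  shows "smooth_on S (\<lambda>x. FD f x (h x))"
proof -
  obtain B :: "'a set" and c where B: "finite B" "\<And>b. bounded_linear (c b)"
    "\<And>x. x = (\<Sum>b\<in>B. c b x *\<^sub>R b)" by (rule finite_dim_coordinates[OF fd]) (rule that; assumption)
  have "smooth_on S (\<lambda>x. \<Sum>b\<in>B. c b (h x) *\<^sub>R FD f x b)"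
    by (intro smooth_on_sum S smooth_on_bilinear[OF bounded_bilinear_scaleR]
        smooth_on_linear[OF B(2)] h smooth_on_FD f)
  then show ?thesis
  proof (rule smooth_on_cong[OF S, rotated])
    fix y assume y: "y \<in> S"
    show "(\<Sum>b\<in>B. c b (h y) *\<^sub>R FD f y b) = FD f y (h y)"
      by (rule linear_coordinates[OF linear_frechet_derivative[OF smooth_on_differentiable[OF f y]] B(3), symmetric])
  qed
qed

text \<open>The operator is rebuilt from its values at basis vectors by the maps sending
  \<open>y\<close> to the operator x |-> c b x y. These are linear in \<open>y\<close> and bounded
  by \<open>onorm (c b)\<close>, hence preserve smoothness.\<close>

lemma smooth_on_blinfunI:
  fixes f :: "'c::real_normed_vector \<Rightarrow> 'a::real_normed_vector \<Rightarrow>\<^sub>L 'b::real_normed_vector"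
  assumes fd: "finite_dim TYPE('a)" and S: "open S" and f: "\<And>w. smooth_on S (\<lambda>x. blinfun_apply (f x) w)"
  shows "smooth_on S f"
proof -
  obtain B :: "'a set" and c where B: "finite B" "\<And>b. bounded_linear (c b)"
    "\<And>x. x = (\<Sum>b\<in>B. c b x *\<^sub>R b)" by (rule finite_dim_coordinates[OF fd]) (rule that; assumption)
  have "bounded_linear (\<lambda>y. Blinfun (\<lambda>x. c b x *\<^sub>R (y::'b)))" for b
  proof -
    show ?thesis
    proof (rule bounded_linear_intro[where K="onorm (c b)"])
      show "Blinfun (\<lambda>x. c b x *\<^sub>R (y + z)) = Blinfun (\<lambda>x. c b x *\<^sub>R y) + Blinfun (\<lambda>x. c b x *\<^sub>R (z::'b))" for y z
        by (rule blinfun_eqI)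
          (simp add: bounded_linear_Blinfun_apply bounded_linear_scaleR_const bounded_linear_add B blinfun.add_left scaleR_add_right)
      show "Blinfun (\<lambda>x. c b x *\<^sub>R r *\<^sub>R y) = r *\<^sub>R Blinfun (\<lambda>x. c b x *\<^sub>R (y::'b))" for r y
        by (rule blinfun_eqI)
          (simp add: bounded_linear_Blinfun_apply bounded_linear_scaleR_const B blinfun.scaleR_left
            mult.commute del: scaleR_scaleR, simp add: mult.commute)
      show "norm (Blinfun (\<lambda>x. c b x *\<^sub>R y)) \<le> norm (y::'b) * onorm (c b)" for y
      proof (rule norm_blinfun_bound)
        show "0 \<le> norm y * onorm (c b)" using onorm_pos_le[OF B(2)] by simp
        show "norm (blinfun_apply (Blinfun (\<lambda>x. c b x *\<^sub>R y)) x) \<le> norm y * onorm (c b) * norm x" for x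
          using mult_left_mono[OF onorm[OF B(2)[of b], of x] norm_ge_zero[of y]]
          by (simp add: bounded_linear_Blinfun_apply bounded_linear_scaleR_const B algebra_simps)
      qed
    qed
  qed
  then have "smooth_on S (\<lambda>x. \<Sum>b\<in>B. Blinfun (\<lambda>y. c b y *\<^sub>R blinfun_apply (f x) b))"
    by (intro smooth_on_sum[OF S]) (rule smooth_on_linear[OF _ S f])
  then show ?thesis
    by (rule smooth_on_cong[OF S, rotated]) (rule blinfun_coordinates[OF B(2,3), symmetric])
qed

text \<open>The mean value inequality is applied to the second difference, corrected by its expected
  value, as a function of the step \<open>t\<close> in direction \<open>u\<close>. The derivative of
  this function is a corrected first difference of y |-> FD f y u, which differentiability at the
  single point \<open>x\<close> makes small compared with \<open>h\<close>.\<close>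

lemma second_difference_approx:
  fixes f :: "'a::real_normed_vector \<Rightarrow> 'b::real_normed_vector"
  assumes S: "open S" "x \<in> S" and f: "\<And>y. y \<in> S \<Longrightarrow> f differentiable (at y)"
    and f2: "(\<lambda>y. FD f y u) differentiable (at x)" and e: "e > 0"
  shows "\<exists>d>0. \<forall>h. 0 < h \<and> h < d \<longrightarrow>
    norm (f (x + h *\<^sub>R u + h *\<^sub>R v) - f (x + h *\<^sub>R u) - f (x + h *\<^sub>R v) + f x
      - (h * h) *\<^sub>R FD (\<lambda>y. FD f y u) x v) \<le> e * (h * h)"
proof -
  \<comment> \<open>\<open>?N\<close> bounds both displacements together: norm (t u + h v) + norm (t
    u) is at most h (2 norm u + norm v) for t between 0 and h. The additional 1 keeps
    \<open>?N\<close> positive.\<close>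
  let ?G = "\<lambda>y. FD f y u" and ?N = "2 * norm u + norm v + 1"
  let ?A = "FD ?G x"
  have N: "?N > 0" by (simp add: add_nonneg_pos)
  have dG: "(?G has_derivative ?A) (at x)" using f2 by (rule FD_has_derivative)
  then have linA: "linear ?A" using has_derivative_linear by blast
  have "\<exists>d>0. \<forall>y. norm (y - x) < d \<longrightarrow> norm (?G y - ?G x - ?A (y - x)) \<le> (e / ?N) * norm (y - x)"
    using dG divide_pos_pos[OF e N] unfolding has_derivative_at_alt by blast
  then obtain d1 where d1: "d1 > 0"
    "\<And>y. norm (y - x) < d1 \<Longrightarrow> norm (?G y - ?G x - ?A (y - x)) \<le> (e / ?N) * norm (y - x)"
    by blast
  obtain r where r: "r > 0" "ball x r \<subseteq> S" using S open_contains_ball by blast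
  show ?thesis
  proof (intro exI[of _ "min d1 r / ?N"] conjI allI impI)
    show "0 < min d1 r / ?N" using d1 r N by simp
    fix h :: real assume h: "0 < h \<and> h < min d1 r / ?N"
    then have hN: "h * ?N < min d1 r" using N by (simp add: pos_less_divide_eq)
    have nrm: "norm (t *\<^sub>R u + s *\<^sub>R v) \<le> h * (norm u + norm v)" if "0 \<le> t" "t \<le> h" "0 \<le> s" "s \<le> h" for t s
    proof -
      have "norm (t *\<^sub>R u + s *\<^sub>R v) \<le> t * norm u + s * norm v"
        using norm_triangle_ineq[of "t *\<^sub>R u" "s *\<^sub>R v"] that by simp
      also have "\<dots> \<le> h * norm u + h * norm v"
        using that by (intro add_mono mult_right_mono) auto
      finally show ?thesis by (simp add: algebra_simps)
    qed
    have "h * (norm u + norm v) \<le> h * ?N" using h by (intro mult_left_mono) auto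
    then have small: "norm (t *\<^sub>R u + s *\<^sub>R v) < d1 \<and> x + t *\<^sub>R u + s *\<^sub>R v \<in> S"
      if "0 \<le> t" "t \<le> h" "0 \<le> s" "s \<le> h" for t s
    proof -
      have "norm (t *\<^sub>R u + s *\<^sub>R v) < min d1 r"
        using nrm[OF that] \<open>h * (norm u + norm v) \<le> h * ?N\<close> hN by linarith
      moreover from this have "dist (x + (t *\<^sub>R u + s *\<^sub>R v)) x < r"
        by (simp add: dist_norm)
      then have "x + (t *\<^sub>R u + s *\<^sub>R v) \<in> ball x r"
        by (simp add: dist_commute)
      ultimately show ?thesis using r(2) by (auto simp: add.assoc)
    qed
    let ?g = "\<lambda>t. f (x + t *\<^sub>R u + h *\<^sub>R v) - f (x + t *\<^sub>R u) - (t * h) *\<^sub>R ?A v"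
    let ?g' = "\<lambda>t. ?G (x + t *\<^sub>R u + h *\<^sub>R v) - ?G (x + t *\<^sub>R u) - h *\<^sub>R ?A v"
    have df: "((\<lambda>t. f (x + t *\<^sub>R u + s *\<^sub>R v)) has_derivative (\<lambda>k. k *\<^sub>R ?G (x + t *\<^sub>R u + s *\<^sub>R v))) (at t within {0..h})"
      if "t \<in> {0..h}" "0 \<le> s" "s \<le> h" for t s
    proof -
      let ?y = "x + t *\<^sub>R u + s *\<^sub>R v"
      have y: "?y \<in> S" using small[of t s] that by auto
      have "((\<lambda>t. x + t *\<^sub>R u + s *\<^sub>R v) has_derivative (\<lambda>k. k *\<^sub>R u)) (at t within {0..h})"
        by (auto intro!: derivative_eq_intros)
      moreover have "(f has_derivative FD f ?y) (at ?y)" by (rule FD_has_derivative[OF f[OF y]])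
      ultimately have "((\<lambda>t. f (x + t *\<^sub>R u + s *\<^sub>R v)) has_derivative (\<lambda>k. FD f ?y (k *\<^sub>R u))) (at t within {0..h})"
        by (rule has_derivative_compose)
      then show ?thesis
        by (simp add: linear_scale[OF linear_frechet_derivative[OF f[OF y]]])
    qed
    have dg: "(?g has_derivative (\<lambda>k. k *\<^sub>R ?g' t)) (at t within {0..h})" if t: "t \<in> {0..h}" for t
    proof -
      have "((\<lambda>t. f (x + t *\<^sub>R u + h *\<^sub>R v)) has_derivative (\<lambda>k. k *\<^sub>R ?G (x + t *\<^sub>R u + h *\<^sub>R v))) (at t within {0..h})"
        by (rule df[OF t]) (use h in auto)
      moreover have "((\<lambda>t. f (x + t *\<^sub>R u)) has_derivative (\<lambda>k. k *\<^sub>R ?G (x + t *\<^sub>R u))) (at t within {0..h})"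
        using df[OF t, of 0] h by simp
      moreover have "((\<lambda>t. (t * h) *\<^sub>R ?A v) has_derivative (\<lambda>k. (k * h) *\<^sub>R ?A v)) (at t within {0..h})"
        by (auto intro!: derivative_eq_intros)
      ultimately have "(?g has_derivative (\<lambda>k. k *\<^sub>R ?G (x + t *\<^sub>R u + h *\<^sub>R v) - k *\<^sub>R ?G (x + t *\<^sub>R u) - (k * h) *\<^sub>R ?A v)) (at t within {0..h})"
        by (intro has_derivative_diff)
      then show ?thesis by (simp add: scaleR_diff_right)
    qed
    have bd: "norm (?g' t) \<le> e * h" if t: "t \<in> {0..h}" for t
    proof -
      let ?k = "t *\<^sub>R u + h *\<^sub>R v" and ?l = "t *\<^sub>R u"
      have th: "0 \<le> t" "t \<le> h" using t by auto
      have 1: "norm (?G (x + ?k) - ?G x - ?A ?k) \<le> (e / ?N) * norm ?k"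
        using d1(2)[of "x + ?k"] small[of t h] th h by simp
      have 2: "norm (?G (x + ?l) - ?G x - ?A ?l) \<le> (e / ?N) * norm ?l"
        using d1(2)[of "x + ?l"] small[of t 0] th h by simp
      have Ak: "?A ?k = ?A ?l + h *\<^sub>R ?A v"
        using linA by (simp add: linear_add linear_scale)
      have split: "?g' t = (?G (x + ?k) - ?G x - ?A ?k) - (?G (x + ?l) - ?G x - ?A ?l)"
        unfolding Ak by (simp add: add.assoc)
      have "norm (?g' t) \<le> (e / ?N) * norm ?k + (e / ?N) * norm ?l"
        unfolding split using norm_triangle_ineq4[of "?G (x + ?k) - ?G x - ?A ?k" "?G (x + ?l) - ?G x - ?A ?l"] 1 2
        by linarith
      also have "\<dots> = (e / ?N) * (norm ?k + norm ?l)" by (simp add: algebra_simps)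
      also have "\<dots> \<le> (e / ?N) * (h * ?N)"
      proof (rule mult_left_mono)
        have "norm ?l \<le> h * norm u" using th by (simp add: mult_right_mono)
        moreover have "norm ?k \<le> h * (norm u + norm v)" using nrm[of t h] th h by simp
        ultimately show "norm ?k + norm ?l \<le> h * ?N" using h by (simp add: algebra_simps)
        show "0 \<le> e / ?N" using e N by simp
      qed
      also have "\<dots> = e * h" using N by simp
      finally show ?thesis .
    qed
    have "norm (?g h - ?g 0) \<le> (e * h) * norm (h - 0)"
    proof (rule differentiable_bound[of "{0..h}" ?g "\<lambda>t k. k *\<^sub>R ?g' t"])
      show "onorm (\<lambda>k. k *\<^sub>R ?g' t) \<le> e * h" if "t \<in> {0..h}" for t
        by (rule onorm_le) (use mult_left_mono[OF bd[OF that]] in \<open>simp add: mult.commute\<close>)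
    qed (use dg h in auto)
    moreover have split: "?g h - ?g 0 = f (x + h *\<^sub>R u + h *\<^sub>R v) - f (x + h *\<^sub>R u) - f (x + h *\<^sub>R v) + f x - (h * h) *\<^sub>R ?A v"
      by simp
    ultimately show "norm (f (x + h *\<^sub>R u + h *\<^sub>R v) - f (x + h *\<^sub>R u) - f (x + h *\<^sub>R v) + f x
      - (h * h) *\<^sub>R ?A v) \<le> e * (h * h)"
      unfolding split using h by (simp add: mult.assoc)
  qed
qed

text \<open>The second difference is symmetric in \<open>u\<close> and \<open>v\<close>, and it
  approximates h^2 times either side up to h^2 e/2. Dividing by h^2 for a single admissible
  \<open>h\<close> leaves a difference of at most \<open>e\<close>, which is arbitrary.\<close>

lemma FD_FD_commute:
  fixes f :: "'a::real_normed_vector \<Rightarrow> 'b::real_normed_vector"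
  assumes S: "open S" "x \<in> S" and f: "smooth_on S f"
  shows "FD (\<lambda>y. FD f y u) x v = FD (\<lambda>y. FD f y v) x u"
proof -
  let ?a = "FD (\<lambda>y. FD f y u) x v" and ?b = "FD (\<lambda>y. FD f y v) x u"
  have "norm (?a - ?b) \<le> 0 + e" if e: "e > 0" for e
  proof -
    have d: "(\<lambda>y. FD f y w) differentiable (at x)" for w
      using smooth_on_differentiable[OF smooth_on_FD[OF f] S(2)] .
    have e2: "e / 2 > 0" using e by simp
    obtain d1 where d1: "d1 > 0" "\<And>h. 0 < h \<and> h < d1 \<Longrightarrow>
      norm (f (x + h *\<^sub>R u + h *\<^sub>R v) - f (x + h *\<^sub>R u) - f (x + h *\<^sub>R v) + f x - (h * h) *\<^sub>R ?a) \<le> e/2 * (h * h)"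
      using second_difference_approx[OF S smooth_on_differentiable[OF f] d e2, of u v] by blast
    obtain d2 where d2: "d2 > 0" "\<And>h. 0 < h \<and> h < d2 \<Longrightarrow>
      norm (f (x + h *\<^sub>R v + h *\<^sub>R u) - f (x + h *\<^sub>R v) - f (x + h *\<^sub>R u) + f x - (h * h) *\<^sub>R ?b) \<le> e/2 * (h * h)"
      using second_difference_approx[OF S smooth_on_differentiable[OF f] d e2, of v u] by blast
    define h where "h = min d1 d2 / 2"
    have h: "0 < h" "h < d1" "h < d2" using d1(1) d2(1) by (auto simp: h_def)
    let ?D = "f (x + h *\<^sub>R u + h *\<^sub>R v) - f (x + h *\<^sub>R u) - f (x + h *\<^sub>R v) + f x"
    have 1: "norm (?D - (h * h) *\<^sub>R ?a) \<le> e/2 * (h * h)" using d1(2)[of h] h by simp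
    have swap: "f (x + h *\<^sub>R v + h *\<^sub>R u) - f (x + h *\<^sub>R v) - f (x + h *\<^sub>R u) + f x = ?D"
      by (simp add: add.commute add.left_commute)
    have 2: "norm (?D - (h * h) *\<^sub>R ?b) \<le> e/2 * (h * h)"
      using d2(2)[of h] h unfolding swap by simp
    have split: "(h * h) *\<^sub>R (?a - ?b) = (?D - (h * h) *\<^sub>R ?b) - (?D - (h * h) *\<^sub>R ?a)"
      by (simp add: scaleR_diff_right)
    have "norm ((h * h) *\<^sub>R (?a - ?b)) \<le> e/2 * (h * h) + e/2 * (h * h)"
      unfolding split using norm_triangle_ineq4[of "?D - (h * h) *\<^sub>R ?b" "?D - (h * h) *\<^sub>R ?a"] 1 2 by linarith
    then have "(h * h) * norm (?a - ?b) \<le> (h * h) * e" unfolding norm_scaleR by (simp add: abs_mult mult.commute)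
    then show ?thesis using h(1) by (simp add: mult_le_cancel_left)
  qed
  then have "norm (?a - ?b) \<le> 0" by (rule field_le_epsilon)
  then show ?thesis by simp
qed

lemma has_derivative_FD_field:
  fixes f :: "'a::real_normed_vector \<Rightarrow> 'b::real_normed_vector"
  assumes fd: "finite_dim TYPE('a)" and S: "open S" "x \<in> S" and f: "smooth_on S f"
    and h: "h differentiable (at x)"
  shows "((\<lambda>y. FD f y (h y)) has_derivative
    (\<lambda>v. FD (\<lambda>y. FD f y (h x)) x v + FD f x (FD h x v))) (at x)"
proof -
  obtain B :: "'a set" and c where B: "finite B" "\<And>b. bounded_linear (c b)"
    "\<And>x. x = (\<Sum>b\<in>B. c b x *\<^sub>R b)" by (rule finite_dim_coordinates[OF fd]) (rule that; assumption)
  note lin = linear_coordinates[OF linear_frechet_derivative[OF smooth_on_differentiable[OF f]] B(3), symmetric]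
  have df: "((\<lambda>y. FD f y b) has_derivative FD (\<lambda>y. FD f y b) x) (at x)" for b
    by (rule smooth_on_has_derivative[OF smooth_on_FD[OF f] S(2)])
  have dc: "((\<lambda>y. c b (h y)) has_derivative (\<lambda>v. c b (FD h x v))) (at x)" for b
    by (rule bounded_linear.has_derivative[OF B(2) FD_has_derivative[OF h]])
  have "((\<lambda>y. \<Sum>b\<in>B. c b (h x) *\<^sub>R FD f y b) has_derivative (\<lambda>v. \<Sum>b\<in>B. c b (h x) *\<^sub>R FD (\<lambda>y. FD f y b) x v)) (at x)"
    by (intro has_derivative_sum has_derivative_scaleR_right df)
  then have "((\<lambda>y. FD f y (h x)) has_derivative (\<lambda>v. \<Sum>b\<in>B. c b (h x) *\<^sub>R FD (\<lambda>y. FD f y b) x v)) (at x)"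
    by (rule has_derivative_transform_within_open[OF _ S]) (rule lin)
  then have eq: "FD (\<lambda>y. FD f y (h x)) x = (\<lambda>v. \<Sum>b\<in>B. c b (h x) *\<^sub>R FD (\<lambda>y. FD f y b) x v)"
    by (rule FD_eq)
  have "((\<lambda>y. \<Sum>b\<in>B. c b (h y) *\<^sub>R FD f y b) has_derivative
    (\<lambda>v. \<Sum>b\<in>B. c b (h x) *\<^sub>R FD (\<lambda>y. FD f y b) x v + c b (FD h x v) *\<^sub>R FD f x b)) (at x)"
    by (intro has_derivative_sum has_derivative_scaleR df dc)
  then have "((\<lambda>y. FD f y (h y)) has_derivative
    (\<lambda>v. \<Sum>b\<in>B. c b (h x) *\<^sub>R FD (\<lambda>y. FD f y b) x v + c b (FD h x v) *\<^sub>R FD f x b)) (at x)"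
    by (rule has_derivative_transform_within_open[OF _ S]) (rule lin)
  then show ?thesis
    by (simp add: sum.distrib eq lin[OF S(2)])
qed

section \<open>The standard bracket in coordinates\<close>

text \<open>
  Here \<open>D\<close> and \<open>H\<close> stand for the first and second derivatives of the sections \<open>e1\<close>, \<open>e2\<close>, \<open>e3\<close> at a
  point, \<open>T\<close> for the bracket of the fibre, and \<open>F\<close>, \<open>G\<close> for the brackets and their derivatives.
\<close>

lemma leibniz_jets:
  fixes P :: "'v::real_vector \<Rightarrow> 'v \<Rightarrow> real" and r :: "'v \<Rightarrow> 'e::real_vector" and T :: "'v \<Rightarrow> 'v \<Rightarrow> 'v"
  assumes P: "bilinear P" and Psym: "\<And>u v. P u v = P v u" and r: "linear r"
    and T12: "\<And>u v. T v u = - T u v"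
    and T23: "\<And>u v w. P (T u v) w = - P (T u w) v"
    and rT: "\<And>u v. r (T u v) = 0"
    and jac: "\<And>u v x w. P (T u v) (T x w) + P (T v x) (T u w) + P (T x u) (T v w) = 0"
    and D: "linear D1" "linear D2" "linear D3"
    and H: "\<And>u v. H1 u v = H1 v u" "\<And>u v. H2 u v = H2 v u" "\<And>u v. H3 u v = H3 v u"
    and F12: "\<And>w. P F12 w = P (D2 (r e1)) w - P (D1 (r e2)) w + P (T e1 e2) w + P (D1 (r w)) e2"
    and F13: "\<And>w. P F13 w = P (D3 (r e1)) w - P (D1 (r e3)) w + P (T e1 e3) w + P (D1 (r w)) e3"
    and F23: "\<And>w. P F23 w = P (D3 (r e2)) w - P (D2 (r e3)) w + P (T e2 e3) w + P (D2 (r w)) e3"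
    and r12: "r F12 = r (D2 (r e1)) - r (D1 (r e2))"
    and r13: "r F13 = r (D3 (r e1)) - r (D1 (r e3))"
    and r23: "r F23 = r (D3 (r e2)) - r (D2 (r e3))"
    and G12: "\<And>v w. P (G12 v) w = P (H2 v (r e1)) w + P (D2 (r (D1 v))) w - P (H1 v (r e2)) w
        - P (D1 (r (D2 v))) w + P (T (D1 v) e2) w + P (T e1 (D2 v)) w + P (H1 v (r w)) e2 + P (D1 (r w)) (D2 v)"
    and G13: "\<And>v w. P (G13 v) w = P (H3 v (r e1)) w + P (D3 (r (D1 v))) w - P (H1 v (r e3)) w
        - P (D1 (r (D3 v))) w + P (T (D1 v) e3) w + P (T e1 (D3 v)) w + P (H1 v (r w)) e3 + P (D1 (r w)) (D3 v)"
    and G23: "\<And>v w. P (G23 v) w = P (H3 v (r e2)) w + P (D3 (r (D2 v))) w - P (H2 v (r e3)) w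
        - P (D2 (r (D3 v))) w + P (T (D2 v) e3) w + P (T e2 (D3 v)) w + P (H2 v (r w)) e3 + P (D2 (r w)) (D3 v)"
  shows "P (G23 (r e1)) w - P (D1 (r F23)) w + P (T e1 F23) w + P (D1 (r w)) F23
    = (P (D3 (r F12)) w - P (G12 (r e3)) w + P (T F12 e3) w + P (G12 (r w)) e3)
    + (P (G13 (r e2)) w - P (D2 (r F13)) w + P (T e2 F13) w + P (D2 (r w)) F13)"
proof -
  note lin = linear_diff linear_0 bilinear_lsub[OF P] bilinear_rsub[OF P] bilinear_lneg[OF P] bilinear_rneg[OF P] bilinear_lzero[OF P] bilinear_rzero[OF P]
  have Dr: "P (D1 (r F23)) w = P (D1 (r (D3 (r e2)))) w - P (D1 (r (D2 (r e3)))) w"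
    "P (D3 (r F12)) w = P (D3 (r (D2 (r e1)))) w - P (D3 (r (D1 (r e2)))) w"
    "P (D2 (r F13)) w = P (D2 (r (D3 (r e1)))) w - P (D2 (r (D1 (r e3)))) w"
    unfolding r12 r13 r23 using D by (simp_all add: lin)
  have a: "P (D1 (r w)) F23 = P F23 (D1 (r w))" "P (D2 (r w)) F13 = P F13 (D2 (r w))" by (rule Psym)+
  \<comment> \<open>Antisymmetry in the first two and in the last two arguments makes the trilinear
    form P (T u v) w invariant under rotations.\<close>
  have skew: "P (T u v) w = P (T v w) u" for u v w
    using T23[of u v w] T12[of v u] T23[of v u w] by (simp add: lin)
  have skew2: "P (T u v) w = P (T w u) v" for u v w
    by (rule trans[OF skew skew])
  \<comment> \<open>The inner brackets are moved into the first argument of \<open>P\<close>, the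
    position in which the hypotheses on \<open>F12\<close>, \<open>F13\<close>, \<open>F23\<close>
    expand them.\<close>
  have b: "P (T e1 F23) w = P F23 (T w e1)" "P (T e2 F13) w = P F13 (T w e2)" "P (T F12 e3) w = P F12 (T e3 w)"
    by (rule trans[OF skew2 Psym] trans[OF skew Psym])+
  have z: "P (D1 (r (T u v))) x = 0" "P (D2 (r (T u v))) x = 0" "P (D3 (r (T u v))) x = 0" for u v x
    using D by (simp_all add: rT lin)
  \<comment> \<open>The Jacobi identity, arranged for the terms quadratic in \<open>T\<close> that
    the expansion produces.\<close>
  have j: "P (T e2 e3) (T w e1) = P (T e1 e2) (T e3 w) + P (T e1 e3) (T w e2)"
    using jac[of e1 e2 e3 w] unfolding T12[of w e1] T12[of e1 e3] T12[of w e2] by (simp add: lin)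
  \<comment> \<open>Terms with one \<open>T\<close> are brought to a common form here and in
    \<open>s\<close>; \<open>p\<close> and \<open>h\<close> do the same for products of first
    derivatives and for second derivatives. What remains is linear arithmetic in these
    atoms.\<close>
  have t: "P (T (D2 (r e1)) e3) w = P (D2 (r e1)) (T e3 w)"
    "P (T e2 (D3 (r e1))) w = P (D3 (r e1)) (T w e2)"
    "P (T e1 (D2 (r e3))) w = P (D2 (r e3)) (T w e1)"
    "P (T (D1 (r w)) e2) e3 = P (T e2 e3) (D1 (r w))"
    "P (T (D1 (r e2)) e3) w = P (D1 (r e2)) (T e3 w)"
    "P (T e1 (D3 (r e2))) w = P (D3 (r e2)) (T w e1)"
    by (rule trans[OF skew Psym] trans[OF skew2 Psym] skew)+
  have s: "P (T (D1 (r e3)) e2) w = - P (D1 (r e3)) (T w e2)"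
    "P (T e1 (D2 (r w))) e3 = - P (T e1 e3) (D2 (r w))"
    unfolding skew[of "D1 (r e3)"] skew2[of e1 "D2 (r w)"] T12[of w e2] T12[of e1 e3] Psym[of "D1 (r e3)"]
    by (simp_all add: lin)
  have p: "P (D3 (r e1)) (D2 (r w)) = P (D2 (r w)) (D3 (r e1))"
    "P (D2 (r e1)) (D1 (r w)) = P (D1 (r w)) (D2 (r e1))"
    "P (D3 (r e2)) (D1 (r w)) = P (D1 (r w)) (D3 (r e2))"
    "P (D2 (r e3)) (D1 (r w)) = P (D1 (r w)) (D2 (r e3))"
    "P (D1 (r e3)) (D2 (r w)) = P (D2 (r w)) (D1 (r e3))"
    by (rule Psym)+
  have h: "H2 (r e1) (r e3) = H2 (r e3) (r e1)" "H1 (r e2) (r e3) = H1 (r e3) (r e2)"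
    "H3 (r e1) (r e2) = H3 (r e2) (r e1)" "H2 (r e1) (r w) = H2 (r w) (r e1)"
    "H1 (r e2) (r w) = H1 (r w) (r e2)" "H1 (r e3) (r w) = H1 (r w) (r e3)"
    by (rule H)+
  show ?thesis
    unfolding a b Dr F12 F13 F23 G12 G13 G23 z t h
    using j s p by linarith
qed

text \<open>Projections replace tuple patterns so that the pairing unfolds at values that are not
  literally triples. It is the pairing of \<open>std_courant\<close> by
  \<open>std_courant_simps\<close>.\<close>

definition std_pairing :: "('g \<Rightarrow> 'g \<Rightarrow> real) \<Rightarrow> ('e::real_normed_vector, 'g) std_fiber \<Rightarrow> ('e, 'g) std_fiber \<Rightarrow> real" where
  "std_pairing ip u v = 1/2 * (blinfun_apply (snd (snd u)) (fst v) + blinfun_apply (snd (snd v)) (fst u))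
     + ip (fst (snd u)) (fst (snd v))"

text \<open>In coordinates, the terms of the original bracket in which \<open>e1\<close> is
  differentiated along the free vector v are eta(D_v X) from the Lie derivative, (D_v xi)(Y) from
  the contraction of d xi, and 2 (D_v a, b) from P(a, b). Their sum is exactly twice the pairing of
  D_v e1 with \<open>e2\<close>.\<close>

definition coord_bracket ::
  "('g::real_normed_vector \<Rightarrow> 'g \<Rightarrow> 'g) \<Rightarrow> ('g \<Rightarrow> 'g \<Rightarrow> real) \<Rightarrow>
   ('e::real_normed_vector \<Rightarrow> ('e, 'g) std_fiber) \<Rightarrow> ('e \<Rightarrow> ('e, 'g) std_fiber) \<Rightarrow> 'e \<Rightarrow> ('e, 'g) std_fiber" where
  "coord_bracket lb ip e1 e2 z = FD e2 z (fst (e1 z)) - FD e1 z (fst (e2 z))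
     + (0, lb (fst (snd (e1 z))) (fst (snd (e2 z))), Blinfun (\<lambda>v. 2 * std_pairing ip (FD e1 z v) (e2 z)))"

text \<open>How the values of a section in two charts are related when the transition map has derivative \<open>L\<close>.\<close>

definition coord_related ::
  "('e::real_normed_vector \<Rightarrow> 'e) \<Rightarrow> ('e, 'g::real_normed_vector) std_fiber \<Rightarrow> ('e, 'g) std_fiber \<Rightarrow> bool" where
  "coord_related L u u' \<longleftrightarrow> fst u' = L (fst u) \<and> fst (snd u') = fst (snd u) \<and>
     (\<forall>w. blinfun_apply (snd (snd u')) (L w) = blinfun_apply (snd (snd u)) w)"

text \<open>The type argument carries the base model space: \<open>base_dim\<close> concerns a type
  that occurs in no other parameter.\<close>

locale standard_model = quadratic_lie_algebra lb ip
  for lb :: "'g::real_normed_vector \<Rightarrow> 'g \<Rightarrow> 'g" and ip :: "'g \<Rightarrow> 'g \<Rightarrow> real" +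
  fixes E :: "'e::real_normed_vector itself"
  assumes base_dim: "finite_dim TYPE('e)"
begin

abbreviation pair :: "('e, 'g) std_fiber \<Rightarrow> ('e, 'g) std_fiber \<Rightarrow> real" where
  "pair \<equiv> std_pairing ip"

abbreviation cb :: "('e \<Rightarrow> ('e, 'g) std_fiber) \<Rightarrow> ('e \<Rightarrow> ('e, 'g) std_fiber) \<Rightarrow> 'e \<Rightarrow> ('e, 'g) std_fiber" where
  "cb \<equiv> coord_bracket lb ip"

lemma model_dim: "finite_dim TYPE(('e, 'g) std_fiber)"
  using base_dim dim by (intro finite_dim_prod finite_dim_dual)

lemma bounded_bilinear_ip: "bounded_bilinear ip"
  by (rule bilinear_imp_bounded_bilinear[OF dim dim ip_bilinear])

lemma bounded_bilinear_lb: "bounded_bilinear lb"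
  by (rule bilinear_imp_bounded_bilinear[OF dim dim lb_bilinear])

lemma lb_skew: "lb b a = - lb a b"
proof -
  have "0 = lb (a + b) (a + b)" by (simp add: lb_alternating)
  also have "\<dots> = lb a b + lb b a"
    by (simp only: bilinear_ladd[OF lb_bilinear] bilinear_radd[OF lb_bilinear]) (simp add: lb_alternating)
  finally show ?thesis by (metis add.commute eq_neg_iff_add_eq_0)
qed

lemma bilinear_pair: "bilinear pair"
  unfolding bilinear_def std_pairing_def
  by (auto intro!: linearI simp: blinfun.add_left blinfun.add_right blinfun.scaleR_left blinfun.scaleR_right
    bilinear_ladd[OF ip_bilinear] bilinear_radd[OF ip_bilinear] bilinear_lmul[OF ip_bilinear] bilinear_rmul[OF ip_bilinear]
    algebra_simps add_divide_distrib)

lemma bounded_bilinear_pair: "bounded_bilinear pair"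
  by (rule bilinear_imp_bounded_bilinear[OF model_dim model_dim bilinear_pair])

lemma pair_sym: "pair u v = pair v u"
  by (simp add: std_pairing_def ip_sym)

text \<open>Each summand of the fibre is detected by another one: the covector by tangent vectors,
  the middle component by nondegeneracy of \<open>ip\<close>, and the tangent vector by covectors,
  since the coordinate functionals separate points.\<close>

lemma pair_nondegenerate:
  assumes "\<And>w. pair u w = 0"
  shows "u = 0"
proof -
  have "blinfun_apply (snd (snd u)) x = 0" for x
    using assms[of "(x, 0, 0)"] by (simp add: std_pairing_def bilinear_rzero[OF ip_bilinear])
  then have 1: "snd (snd u) = 0" by (intro blinfun_eqI) simp
  have "ip (fst (snd u)) b = 0" for b
    using assms[of "(0, b, 0)"] by (simp add: std_pairing_def)
  then have 2: "fst (snd u) = 0" using ip_nondegenerate by blast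
  have "blinfun_apply \<xi> (fst u) = 0" for \<xi> :: "'e \<Rightarrow>\<^sub>L real"
    using assms[of "(0, 0, \<xi>)"] by (simp add: std_pairing_def bilinear_rzero[OF ip_bilinear])
  moreover obtain B :: "'e set" and c where B: "finite B" "\<And>b. bounded_linear (c b)"
    "\<And>x. x = (\<Sum>b\<in>B. c b x *\<^sub>R b)" by (rule finite_dim_coordinates[OF base_dim]) (rule that; assumption)
  ultimately have "c b (fst u) = 0" for b
    using bounded_linear_Blinfun_apply[OF B(2)] by metis
  then have "(\<Sum>b\<in>B. c b (fst u) *\<^sub>R b) = 0" by simp
  then have 3: "fst u = 0" using B(3)[of "fst u"] by (rule trans[rotated])
  show ?thesis using 1 2 3 by (metis prod.collapse zero_prod_def)
qed

lemma pair_eqI: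
  assumes "\<And>w. pair u w = pair v w"
  shows "u = v"
  using pair_nondegenerate[of "u - v"] assms by (simp add: bilinear_lsub[OF bilinear_pair])

lemma pair_vertical: "pair (0, a, \<xi>) w = 1/2 * blinfun_apply \<xi> (fst w) + ip a (fst (snd w))"
  by (simp add: std_pairing_def)

lemma bounded_linear_cb_form:
  "e1 differentiable (at z) \<Longrightarrow> bounded_linear (\<lambda>v. 2 * pair (FD e1 z v) u)"
  by (intro bounded_linear_mult_right[THEN bounded_linear_compose]
    bounded_linear_compose[OF bounded_bilinear.bounded_linear_left[OF bounded_bilinear_pair]]
    has_derivative_bounded_linear[OF FD_has_derivative])

text \<open>Pairing evaluates the covector at \<open>fst w\<close> and halves it, so both
  \<open>Blinfun\<close> and the factor 2 disappear.\<close>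

lemma pair_cb:
  assumes "e1 differentiable (at z)"
  shows "pair (cb e1 e2 z) w = pair (FD e2 z (fst (e1 z))) w - pair (FD e1 z (fst (e2 z))) w
    + ip (lb (fst (snd (e1 z))) (fst (snd (e2 z)))) (fst (snd w)) + pair (FD e1 z (fst w)) (e2 z)"
  unfolding coord_bracket_def
  by (simp add: bilinear_ladd[OF bilinear_pair] bilinear_lsub[OF bilinear_pair] pair_vertical
    bounded_linear_Blinfun_apply[OF bounded_linear_cb_form[OF assms]])

lemma fst_cb: "fst (cb e1 e2 z) = fst (FD e2 z (fst (e1 z))) - fst (FD e1 z (fst (e2 z)))"
  by (simp add: coord_bracket_def)

lemma smooth_cb:
  assumes S: "open S" and e: "smooth_on S e1" "smooth_on S e2"
  shows "smooth_on S (cb e1 e2)"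
proof -
  note s = smooth_on_fst[OF S] smooth_on_snd[OF S]
  have 1: "smooth_on S (\<lambda>z. FD e2 z (fst (e1 z)))" "smooth_on S (\<lambda>z. FD e1 z (fst (e2 z)))"
    by (intro smooth_on_FD_field[OF base_dim S] s e)+
  have 2: "smooth_on S (\<lambda>z. lb (fst (snd (e1 z))) (fst (snd (e2 z))))"
    by (intro smooth_on_bilinear[OF bounded_bilinear_lb S] s e)
  have 3: "smooth_on S (\<lambda>z. Blinfun (\<lambda>v. 2 * pair (FD e1 z v) (e2 z)))"
  proof (rule smooth_on_blinfunI[OF base_dim S])
    fix w
    have "smooth_on S (\<lambda>z. 2 * pair (FD e1 z w) (e2 z))"
      by (intro smooth_on_linear[OF bounded_linear_mult_right S]
        smooth_on_bilinear[OF bounded_bilinear_pair S] smooth_on_FD e)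
    then show "smooth_on S (\<lambda>z. blinfun_apply (Blinfun (\<lambda>v. 2 * pair (FD e1 z v) (e2 z))) w)"
      by (rule smooth_on_cong[OF S, rotated])
        (simp add: bounded_linear_Blinfun_apply[OF bounded_linear_cb_form[OF smooth_on_differentiable[OF e(1)]]])
  qed
  show ?thesis
    using smooth_on_add[OF S smooth_on_diff[OF S 1] smooth_on_Pair[OF S smooth_on_const[of _ 0] smooth_on_Pair[OF S 2 3]]]
    unfolding coord_bracket_def .
qed

text \<open>Since \<open>pair_cb\<close> describes the bracket through its pairings, the scalar
  function obtained with a constant \<open>w\<close> is differentiated, and uniqueness of
  derivatives gives the pairing of the derivative. The result has the shape of the hypotheses on
  \<open>G12\<close>, \<open>G13\<close>, \<open>G23\<close> in \<open>leibniz_jets\<close>.\<close>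

lemma pair_FD_cb:
  assumes S: "open S" "z \<in> S" and e: "smooth_on S e1" "smooth_on S e2"
  shows "pair (FD (cb e1 e2) z v) w
    = pair (FD (\<lambda>y. FD e2 y (fst (e1 z))) z v) w + pair (FD e2 z (fst (FD e1 z v))) w
      - pair (FD (\<lambda>y. FD e1 y (fst (e2 z))) z v) w - pair (FD e1 z (fst (FD e2 z v))) w
      + ip (lb (fst (snd (FD e1 z v))) (fst (snd (e2 z)))) (fst (snd w))
      + ip (lb (fst (snd (e1 z))) (fst (snd (FD e2 z v)))) (fst (snd w))
      + pair (FD (\<lambda>y. FD e1 y (fst w)) z v) (e2 z) + pair (FD e1 z (fst w)) (FD e2 z v)"
proof -
  note he = smooth_on_has_derivative[OF e(1) S(2)] smooth_on_has_derivative[OF e(2) S(2)]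
  have f: "(\<lambda>y. fst (e1 y)) differentiable (at z)" "(\<lambda>y. fst (e2 y)) differentiable (at z)"
    using he by (auto simp: differentiable_def intro: has_derivative_fst)
  have ff: "FD (\<lambda>y. fst (e1 y)) z = (\<lambda>v. fst (FD e1 z v))" "FD (\<lambda>y. fst (e2 y)) z = (\<lambda>v. fst (FD e2 z v))"
    using he by (auto intro!: FD_eq has_derivative_fst)
  note d1 = has_derivative_FD_field[OF base_dim S e(2) f(1), unfolded ff]
  note d2 = has_derivative_FD_field[OF base_dim S e(1) f(2), unfolded ff]
  have "((\<lambda>y. pair (FD e2 y (fst (e1 y))) w - pair (FD e1 y (fst (e2 y))) w
    + ip (lb (fst (snd (e1 y))) (fst (snd (e2 y)))) (fst (snd w)) + pair (FD e1 y (fst w)) (e2 y)) has_derivative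
    (\<lambda>v. pair (FD (\<lambda>y. FD e2 y (fst (e1 z))) z v + FD e2 z (fst (FD e1 z v))) w
      - pair (FD (\<lambda>y. FD e1 y (fst (e2 z))) z v + FD e1 z (fst (FD e2 z v))) w
      + ip (lb (fst (snd (e1 z))) (fst (snd (FD e2 z v))) + lb (fst (snd (FD e1 z v))) (fst (snd (e2 z)))) (fst (snd w))
      + (pair (FD e1 z (fst w)) (FD e2 z v) + pair (FD (\<lambda>y. FD e1 y (fst w)) z v) (e2 z)))) (at z)"
    by (intro has_derivative_add has_derivative_diff
        bounded_linear.has_derivative[OF bounded_bilinear.bounded_linear_left[OF bounded_bilinear_pair]]
        bounded_linear.has_derivative[OF bounded_bilinear.bounded_linear_left[OF bounded_bilinear_ip]]
        bounded_bilinear.FDERIV[OF bounded_bilinear_pair] bounded_bilinear.FDERIV[OF bounded_bilinear_lb]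
        has_derivative_fst has_derivative_snd d1 d2 he smooth_on_has_derivative[OF smooth_on_FD[OF e(1)] S(2)])
  then have A: "((\<lambda>y. pair (cb e1 e2 y) w) has_derivative
    (\<lambda>v. pair (FD (\<lambda>y. FD e2 y (fst (e1 z))) z v + FD e2 z (fst (FD e1 z v))) w
      - pair (FD (\<lambda>y. FD e1 y (fst (e2 z))) z v + FD e1 z (fst (FD e2 z v))) w
      + ip (lb (fst (snd (e1 z))) (fst (snd (FD e2 z v))) + lb (fst (snd (FD e1 z v))) (fst (snd (e2 z)))) (fst (snd w))
      + (pair (FD e1 z (fst w)) (FD e2 z v) + pair (FD (\<lambda>y. FD e1 y (fst w)) z v) (e2 z)))) (at z)"
    by (rule has_derivative_transform_within_open[OF _ S])
      (simp add: pair_cb[OF smooth_on_differentiable[OF e(1)]])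
  have B: "((\<lambda>y. pair (cb e1 e2 y) w) has_derivative (\<lambda>v. pair (FD (cb e1 e2) z v) w)) (at z)"
    by (intro bounded_linear.has_derivative[OF bounded_bilinear.bounded_linear_left[OF bounded_bilinear_pair]]
      smooth_on_has_derivative[OF smooth_cb[OF S(1) e] S(2)])
  show ?thesis
    using fun_cong[OF has_derivative_unique[OF B A], of v]
    by (simp add: bilinear_ladd[OF bilinear_pair] bilinear_ladd[OF ip_bilinear])
qed

lemma cb_leibniz:
  assumes S: "open S" "z \<in> S" and e: "smooth_on S e1" "smooth_on S e2" "smooth_on S e3"
  shows "cb e1 (cb e2 e3) z = cb (cb e1 e2) e3 z + cb e2 (cb e1 e3) z"
proof (rule pair_eqI)
  fix w
  \<comment> \<open>The Lie bracket is extended by zero to the whole fibre. Its contribution to a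
    bracket then becomes a pairing (\<open>ipT\<close>), as \<open>leibniz_jets\<close>
    expects.\<close>
  define T :: "('e, 'g) std_fiber \<Rightarrow> ('e, 'g) std_fiber \<Rightarrow> ('e, 'g) std_fiber"
    where "T u v = (0, lb (fst (snd u)) (fst (snd v)), 0)" for u v
  have ipT: "ip (lb (fst (snd u)) (fst (snd v))) (fst (snd x)) = pair (T u v) x" for u v x
    by (simp add: T_def pair_vertical)
  have inv: "ip (lb a b) c = - ip (lb a c) b" for a b c
    using ip_invariant[of a b c] ip_sym[of b "lb a c"] by simp
  have T12: "T v u = - T u v" for u v
    by (simp add: T_def lb_skew[of "fst (snd v)"])
  have T23: "pair (T u v) w = - pair (T u w) v" for u v w
    by (simp add: T_def pair_vertical inv[of _ "fst (snd v)"])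
  have jac: "pair (T u v) (T x w) + pair (T v x) (T u w) + pair (T x u) (T v w) = 0" for u v x w
  proof -
    define a b c d where "a = fst (snd u)" "b = fst (snd v)" "c = fst (snd x)" "d = fst (snd w)"
    \<comment> \<open>Invariance turns the product of two brackets into a double bracket paired with
      the fixed vector \<open>d\<close>, so that the Jacobi identity applies.\<close>
    have s: "ip (lb a b) (lb c d) = - ip (lb c (lb a b)) d" for a b c d
      using inv[of c d "lb a b"] ip_sym by metis
    have "ip (lb a b) (lb c d) + ip (lb b c) (lb a d) + ip (lb c a) (lb b d)
      = - ip (lb a (lb b c) + lb b (lb c a) + lb c (lb a b)) d"
      unfolding s by (simp add: bilinear_ladd[OF ip_bilinear])
    also have "\<dots> = 0" by (simp add: lb_jacobi bilinear_lzero[OF ip_bilinear])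
    finally show ?thesis by (simp add: T_def pair_vertical a_b_c_d_def)
  qed
  note d = smooth_on_differentiable[OF e(1) S(2)] smooth_on_differentiable[OF e(2) S(2)] smooth_on_differentiable[OF e(3) S(2)]
  note c = smooth_cb[OF S(1) e(1,2)] smooth_cb[OF S(1) e(1,3)] smooth_cb[OF S(1) e(2,3)]
  note dc = smooth_on_differentiable[OF c(1) S(2)]
  show "pair (cb e1 (cb e2 e3) z) w = pair (cb (cb e1 e2) e3 z + cb e2 (cb e1 e3) z) w"
    unfolding bilinear_ladd[OF bilinear_pair] pair_cb[OF d(1), of "cb e2 e3"] pair_cb[OF d(2), of "cb e1 e3"]
      pair_cb[OF dc, of e3] ipT
  proof (rule leibniz_jets[where r=fst and T=T and
      ?D1.0="FD e1 z" and ?D2.0="FD e2 z" and ?D3.0="FD e3 z" and ?e1.0="e1 z" and ?e2.0="e2 z" and ?e3.0="e3 z" and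
      ?G12.0="FD (cb e1 e2) z" and ?G13.0="FD (cb e1 e3) z" and ?G23.0="FD (cb e2 e3) z" and
      ?H1.0="\<lambda>v w. FD (\<lambda>y. FD e1 y w) z v" and ?H2.0="\<lambda>v w. FD (\<lambda>y. FD e2 y w) z v" and ?H3.0="\<lambda>v w. FD (\<lambda>y. FD e3 y w) z v"])
    show "linear (fst :: ('e, 'g) std_fiber \<Rightarrow> 'e)" by (rule linear_fst)
    show "fst (T u v) = 0" for u v by (simp add: T_def)
  qed (fact bilinear_pair pair_sym T12 T23 jac fst_cb
      linear_frechet_derivative[OF d(1)] linear_frechet_derivative[OF d(2)] linear_frechet_derivative[OF d(3)]
      FD_FD_commute[OF S e(1)] FD_FD_commute[OF S e(2)] FD_FD_commute[OF S e(3)]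
      pair_cb[OF d(1), unfolded ipT] pair_cb[OF d(2), unfolded ipT]
      pair_FD_cb[OF S e(1,2), unfolded ipT] pair_FD_cb[OF S e(1,3), unfolded ipT] pair_FD_cb[OF S e(2,3), unfolded ipT])+
qed

text \<open>The component relations are differentiated along \<open>v\<close>, and uniqueness of
  derivatives compares the result with the chain rule for \<open>e'\<close> after \<psi>. The second
  derivative of \<psi> enters the tangent and the covector part with opposite signs, because the
  derivative of \<psi> acts on vectors on one side and on arguments of covectors on the
  other.\<close>

lemma coord_related_derivative:
  fixes \<psi> :: "'e \<Rightarrow> 'e" and e e' :: "'e \<Rightarrow> ('e, 'g) std_fiber"
  assumes S: "open S" "z \<in> S" and \<psi>: "smooth_on S \<psi>"
    and e: "e differentiable (at z)" and e': "e' differentiable (at (\<psi> z))"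
    and rel: "\<And>y. y \<in> S \<Longrightarrow> coord_related (FD \<psi> y) (e y) (e' (\<psi> y))"
  shows "fst (FD e' (\<psi> z) (FD \<psi> z v)) = FD (\<lambda>y. FD \<psi> y (fst (e z))) z v + FD \<psi> z (fst (FD e z v))"
    and "fst (snd (FD e' (\<psi> z) (FD \<psi> z v))) = fst (snd (FD e z v))"
    and "blinfun_apply (snd (snd (FD e' (\<psi> z) (FD \<psi> z v)))) (FD \<psi> z w)
      = blinfun_apply (snd (snd (FD e z v))) w - blinfun_apply (snd (snd (e' (\<psi> z)))) (FD (\<lambda>y. FD \<psi> y w) z v)"
proof -
  note he = FD_has_derivative[OF e]
  have hc: "((\<lambda>y. e' (\<psi> y)) has_derivative (\<lambda>v. FD e' (\<psi> z) (FD \<psi> z v))) (at z)"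
    by (rule has_derivative_compose[OF smooth_on_has_derivative[OF \<psi> S(2)] FD_has_derivative[OF e']])
  have f: "(\<lambda>y. fst (e y)) differentiable (at z)" "FD (\<lambda>y. fst (e y)) z = (\<lambda>v. fst (FD e z v))"
    using he by (auto simp: differentiable_def intro: has_derivative_fst intro!: FD_eq)
  have "((\<lambda>y. fst (e' (\<psi> y))) has_derivative (\<lambda>v. FD (\<lambda>y. FD \<psi> y (fst (e z))) z v + FD \<psi> z (fst (FD e z v)))) (at z)"
    by (rule has_derivative_transform_within_open[OF has_derivative_FD_field[OF base_dim S \<psi> f(1), unfolded f(2)] S])
      (use rel in \<open>simp add: coord_related_def\<close>)
  from has_derivative_unique[OF has_derivative_fst[OF hc] this]
  show "fst (FD e' (\<psi> z) (FD \<psi> z v)) = FD (\<lambda>y. FD \<psi> y (fst (e z))) z v + FD \<psi> z (fst (FD e z v))"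
    by (rule fun_cong)
  have "((\<lambda>y. fst (snd (e' (\<psi> y)))) has_derivative (\<lambda>v. fst (snd (FD e z v)))) (at z)"
    by (rule has_derivative_transform_within_open[OF has_derivative_fst[OF has_derivative_snd[OF he]] S])
      (use rel in \<open>simp add: coord_related_def\<close>)
  from has_derivative_unique[OF has_derivative_fst[OF has_derivative_snd[OF hc]] this]
  show "fst (snd (FD e' (\<psi> z) (FD \<psi> z v))) = fst (snd (FD e z v))" by (rule fun_cong)
  have "((\<lambda>y. blinfun_apply (snd (snd (e y))) w) has_derivative (\<lambda>v. blinfun_apply (snd (snd (FD e z v))) w)) (at z)"
    by (intro bounded_linear.has_derivative[OF bounded_bilinear.bounded_linear_left[OF bounded_bilinear_blinfun_apply]]
      has_derivative_snd he)
  then have "((\<lambda>y. blinfun_apply (snd (snd (e' (\<psi> y)))) (FD \<psi> y w)) has_derivative (\<lambda>v. blinfun_apply (snd (snd (FD e z v))) w)) (at z)"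
    by (rule has_derivative_transform_within_open[OF _ S]) (use rel in \<open>simp add: coord_related_def\<close>)
  from has_derivative_unique[OF bounded_bilinear.FDERIV[OF bounded_bilinear_blinfun_apply
    has_derivative_snd[OF has_derivative_snd[OF hc]] smooth_on_has_derivative[OF smooth_on_FD[OF \<psi>] S(2)]] this]
  show "blinfun_apply (snd (snd (FD e' (\<psi> z) (FD \<psi> z v)))) (FD \<psi> z w)
      = blinfun_apply (snd (snd (FD e z v))) w - blinfun_apply (snd (snd (e' (\<psi> z)))) (FD (\<lambda>y. FD \<psi> y w) z v)"
    by (auto dest: fun_cong[of _ _ v])
qed

text \<open>The second derivatives of the transition map cancel by their symmetry.\<close>

lemma coord_related_cb:
  fixes \<psi> :: "'e \<Rightarrow> 'e" and e1 e2 e1' e2' :: "'e \<Rightarrow> ('e, 'g) std_fiber"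
  assumes S: "open S" "z \<in> S" and \<psi>: "smooth_on S \<psi>"
    and e1: "e1 differentiable (at z)" "e1' differentiable (at (\<psi> z))"
    and e2: "e2 differentiable (at z)" "e2' differentiable (at (\<psi> z))"
    and rel1: "\<And>y. y \<in> S \<Longrightarrow> coord_related (FD \<psi> y) (e1 y) (e1' (\<psi> y))"
    and rel2: "\<And>y. y \<in> S \<Longrightarrow> coord_related (FD \<psi> y) (e2 y) (e2' (\<psi> y))"
  shows "coord_related (FD \<psi> z) (cb e1 e2 z) (cb e1' e2' (\<psi> z))"
proof -
  note D1 = coord_related_derivative[OF S \<psi> e1 rel1]
  note D2 = coord_related_derivative[OF S \<psi> e2 rel2]
  have L: "linear (FD \<psi> z)"
    by (rule linear_frechet_derivative[OF smooth_on_differentiable[OF \<psi> S(2)]])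
  have r1: "fst (e1' (\<psi> z)) = FD \<psi> z (fst (e1 z))" "fst (snd (e1' (\<psi> z))) = fst (snd (e1 z))"
    "blinfun_apply (snd (snd (e1' (\<psi> z)))) (FD \<psi> z w) = blinfun_apply (snd (snd (e1 z))) w" for w
    using rel1[OF S(2)] by (auto simp: coord_related_def)
  have r2: "fst (e2' (\<psi> z)) = FD \<psi> z (fst (e2 z))" "fst (snd (e2' (\<psi> z))) = fst (snd (e2 z))"
    "blinfun_apply (snd (snd (e2' (\<psi> z)))) (FD \<psi> z w) = blinfun_apply (snd (snd (e2 z))) w" for w
    using rel2[OF S(2)] by (auto simp: coord_related_def)
  have H: "FD (\<lambda>y. FD \<psi> y u) z v = FD (\<lambda>y. FD \<psi> y v) z u" for u v
    by (rule FD_FD_commute[OF S \<psi>])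
  note ap = bounded_linear_Blinfun_apply[OF bounded_linear_cb_form[OF e1(1)]]
    bounded_linear_Blinfun_apply[OF bounded_linear_cb_form[OF e1(2)]]
  show ?thesis
    unfolding coord_related_def
  proof (intro conjI allI)
    show "fst (cb e1' e2' (\<psi> z)) = FD \<psi> z (fst (cb e1 e2 z))"
      by (simp add: coord_bracket_def r1 r2 D1 D2 linear_diff[OF L] H[of "fst (e1 z)" "fst (e2 z)"])
    show "fst (snd (cb e1' e2' (\<psi> z))) = fst (snd (cb e1 e2 z))"
      by (simp add: coord_bracket_def r1 r2 D1 D2)
    fix w
    \<comment> \<open>The second derivatives of \<psi> in the two directional-derivative terms
      cancel those in the pairing term, once \<open>H\<close> has exchanged their arguments.\<close>
    show "blinfun_apply (snd (snd (cb e1' e2' (\<psi> z)))) (FD \<psi> z w) = blinfun_apply (snd (snd (cb e1 e2 z))) w"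
      by (simp add: coord_bracket_def blinfun.add_left blinfun.diff_left ap)
        (simp add: std_pairing_def r1 r2 D1 D2 blinfun.add_right H[of w] algebra_simps)
  qed
qed

end

section \<open>Charts\<close>

abbreviation transition :: "('m, 'e) chart \<Rightarrow> ('m, 'e) chart \<Rightarrow> 'e \<Rightarrow> 'e" where
  "transition c c' \<equiv> snd c' \<circ> chart_inv c"

context smooth_manifold
begin

lemma chart_inv_chart: "c \<in> A \<Longrightarrow> p \<in> fst c \<Longrightarrow> chart_inv c (snd c p) = p"
  using charts homeomorphism_apply1 by metis

lemma chart_chart_inv: "c \<in> A \<Longrightarrow> z \<in> snd c ` fst c \<Longrightarrow> snd c (chart_inv c z) = z"
  using charts homeomorphism_apply2 by metis

lemma open_chart_dom: "c \<in> A \<Longrightarrow> open (fst c)"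
  using charts by blast

lemma open_chart_image:
  assumes "c \<in> A" "open W"
  shows "open (snd c ` (W \<inter> fst c))"
proof -
  have h: "homeomorphism (fst c) (snd c ` fst c) (snd c) (chart_inv c)" and o: "open (snd c ` fst c)"
    using charts assms(1) by blast+
  have "openin (top_of_set (fst c)) (W \<inter> fst c)"
    using assms(2) by (metis Int_commute openin_open_Int)
  from homeomorphism_imp_open_map[OF h this] show ?thesis
    using o openin_open_trans by blast
qed

lemma chart_image_inv:
  "c \<in> A \<Longrightarrow> z \<in> snd c ` (W \<inter> fst c) \<Longrightarrow> chart_inv c z \<in> W \<inter> fst c \<and> snd c (chart_inv c z) = z"
  using chart_inv_chart by fastforce

lemma chart_at: "chart_at A p \<in> A" "p \<in> fst (chart_at A p)"
proof -
  have "\<exists>c. c \<in> A \<and> p \<in> fst c" using cover by blast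
  from someI_ex[OF this] show "chart_at A p \<in> A" "p \<in> fst (chart_at A p)"
    by (simp_all add: chart_at_def)
qed

lemma smooth_transition:
  assumes "c \<in> A" "c' \<in> A" "V \<subseteq> fst c'"
  shows "smooth_on (snd c ` (V \<inter> fst c)) (transition c c')"
  by (rule smooth_on_subset[OF compatible[OF assms(1,2)]]) (use assms(3) in blast)

text \<open>\<open>tcoord\<close> and \<open>chart_field\<close> are derivatives of transition maps
  from and to the preferred chart. Their inverse relations and their behaviour under a change of
  chart are therefore all instances of this cocycle identity.\<close>

lemma FD_transition_chain:
  assumes c: "c \<in> A" "c' \<in> A" "c'' \<in> A" and p: "p \<in> fst c" "p \<in> fst c'" "p \<in> fst c''"
  shows "FD (transition c' c'') (snd c' p) (FD (transition c c') (snd c p) w) = FD (transition c c'') (snd c p) w"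
proof -
  let ?V = "fst c' \<inter> fst c''"
  let ?S = "snd c ` (?V \<inter> fst c)"
  have S: "open ?S" by (rule open_chart_image) (auto intro: c open_chart_dom)
  have z: "snd c p \<in> ?S" using p by blast
  have cp: "transition c c' (snd c p) = snd c' p" using chart_inv_chart[OF c(1) p(1)] by simp
  have d1: "transition c c' differentiable (at (snd c p))"
    by (rule smooth_on_differentiable[OF smooth_transition[OF c(1,2)] z]) simp
  have d2: "transition c' c'' differentiable (at (transition c c' (snd c p)))"
    unfolding cp by (rule smooth_on_differentiable[OF smooth_transition[OF c(2,3) order_refl]])
      (use p in blast)
  have "FD (transition c c'') (snd c p) = FD (transition c' c'' \<circ> transition c c') (snd c p)"
  proof (rule FD_cong[OF S z])
    fix y assume y: "y \<in> ?S"
    show "transition c c'' y = (transition c' c'' \<circ> transition c c') y"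
      using chart_image_inv[OF c(1) y] chart_inv_chart[OF c(2)] by simp
  qed
  then show ?thesis
    by (simp only: frechet_derivative_compose[OF d1 d2] cp comp_apply[of "FD _ _" "FD _ _"])
qed

lemma FD_transition_self:
  assumes c: "c \<in> A" and p: "p \<in> fst c"
  shows "FD (transition c c) (snd c p) w = w"
proof -
  have "FD (transition c c) (snd c p) = FD (\<lambda>z. z) (snd c p)"
    by (rule FD_cong[OF open_chart_image[OF c open_UNIV]]) (use p chart_image_inv[OF c] in auto)
  then show ?thesis by simp
qed

lemma linear_transition:
  assumes c: "c \<in> A" "c' \<in> A" and p: "p \<in> fst c" "p \<in> fst c'"
  shows "linear (FD (transition c c') (snd c p))"
  by (rule linear_frechet_derivative[OF smooth_on_differentiable[OF smooth_transition[OF c order_refl]]])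
    (use p in blast)

lemma linear_tcoord:
  assumes "c \<in> A" "p \<in> fst c"
  shows "linear (tcoord A c p)"
  unfolding tcoord_def using linear_transition[OF chart_at(1) assms(1) chart_at(2) assms(2)] .

lemma linear_chart_field:
  assumes "c \<in> A" "p \<in> fst c"
  shows "linear (\<lambda>w. chart_field A c w p)"
  unfolding chart_field_def using linear_transition[OF assms(1) chart_at(1) assms(2) chart_at(2)] .

lemma tcoord_chart_field_transition:
  assumes c: "c \<in> A" "c' \<in> A" and p: "p \<in> fst c" "p \<in> fst c'"
  shows "tcoord A c' p (chart_field A c w p) = FD (transition c c') (snd c p) w"
  unfolding tcoord_def chart_field_def
  by (rule FD_transition_chain[OF c(1) chart_at(1) c(2) p(1) chart_at(2) p(2)])

lemma tcoord_chart_field: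
  assumes "c \<in> A" "p \<in> fst c"
  shows "tcoord A c p (chart_field A c w p) = w"
  using tcoord_chart_field_transition[OF assms(1,1,2,2)] FD_transition_self[OF assms] by simp

lemma chart_field_tcoord:
  assumes "c \<in> A" "p \<in> fst c"
  shows "chart_field A c (tcoord A c p v) p = v"
  unfolding tcoord_def chart_field_def
    FD_transition_chain[OF chart_at(1) assms(1) chart_at(1) chart_at(2) assms(2) chart_at(2)]
  by (rule FD_transition_self[OF chart_at])

lemma tcoord_transition:
  assumes c: "c \<in> A" "c' \<in> A" and p: "p \<in> fst c" "p \<in> fst c'"
  shows "tcoord A c' p v = FD (transition c c') (snd c p) (tcoord A c p v)"
  using tcoord_chart_field_transition[OF assms, of "tcoord A c p v"] chart_field_tcoord[OF c(1) p(1)] by simp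

lemma chart_field_transition:
  assumes c: "c \<in> A" "c' \<in> A" and p: "p \<in> fst c" "p \<in> fst c'"
  shows "chart_field A c' (FD (transition c c') (snd c p) w) p = chart_field A c w p"
  using tcoord_chart_field_transition[OF assms, of w] chart_field_tcoord[OF c(2) p(2)] by metis

text \<open>This holds only at \<open>p\<close>: at a nearby point the tangent space is identified
  with the model through the chart preferred there.\<close>

lemma tcoord_chart_at: "tcoord A (chart_at A p) p v = v"
  unfolding tcoord_def by (rule FD_transition_self[OF chart_at])

lemma chart_field_chart_at: "chart_field A (chart_at A p) w p = w"
  unfolding chart_field_def by (rule FD_transition_self[OF chart_at])

lemma bounded_linear_cotangent:
  assumes "c \<in> A" "p \<in> fst c"
  shows "bounded_linear (\<lambda>w. blinfun_apply \<xi> (chart_field A c w p))"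
  by (rule bounded_linear_compose[OF blinfun.bounded_linear_right linear_imp_bounded_linear[OF dim linear_chart_field[OF assms]]])

lemma cotangent_coord_apply:
  assumes "c \<in> A" "p \<in> fst c"
  shows "blinfun_apply (cotangent_coord A c p \<xi>) w = blinfun_apply \<xi> (chart_field A c w p)"
  unfolding cotangent_coord_def by (simp add: bounded_linear_Blinfun_apply[OF bounded_linear_cotangent[OF assms]])

section \<open>Smooth maps on the manifold\<close>

lemma smooth_map_subset: "smooth_map A W f \<Longrightarrow> V \<subseteq> W \<Longrightarrow> smooth_map A V f"
  unfolding smooth_map_def by (meson Int_mono image_mono order_refl smooth_on_subset)

lemma smooth_map_cong:
  assumes "open W" "\<And>x. x \<in> W \<Longrightarrow> f x = g x" "smooth_map A W f"
  shows "smooth_map A W g"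
  unfolding smooth_map_def
proof
  fix c assume c: "c \<in> A"
  show "smooth_on (snd c ` (W \<inter> fst c)) (g \<circ> chart_inv c)"
  proof (rule smooth_on_cong[OF open_chart_image[OF c assms(1)]])
    show "smooth_on (snd c ` (W \<inter> fst c)) (f \<circ> chart_inv c)"
      using assms(3) c by (simp add: smooth_map_def)
  qed (use assms(2) chart_image_inv[OF c] in auto)
qed

lemma smooth_map_local:
  assumes "\<And>x. x \<in> W \<Longrightarrow> \<exists>V. open V \<and> x \<in> V \<and> smooth_map A V f"
  shows "smooth_map A W f"
  unfolding smooth_map_def
proof (intro ballI smooth_on_local)
  fix c z assume c: "c \<in> A" and z: "z \<in> snd c ` (W \<inter> fst c)"
  then obtain x where x: "x \<in> W" "x \<in> fst c" "z = snd c x" by blast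
  with assms obtain V where V: "open V" "x \<in> V" "smooth_map A V f" by blast
  show "\<exists>T. open T \<and> z \<in> T \<and> smooth_on T (f \<circ> chart_inv c)"
    using open_chart_image[OF c V(1)] V x c unfolding smooth_map_def by blast
qed

text \<open>When the domain lies in one chart, any other coordinate expression is the given one
  composed with a transition map.\<close>

lemma smooth_mapI_chart:
  assumes c: "c \<in> A" and W: "open W" "W \<subseteq> fst c" and f: "smooth_on (snd c ` W) (f \<circ> chart_inv c)"
  shows "smooth_map A W f"
  unfolding smooth_map_def
proof
  fix c' assume c': "c' \<in> A"
  let ?S = "snd c' ` (W \<inter> fst c')"
  note S = open_chart_image[OF c' W(1)]
  have "smooth_on ?S (\<lambda>z. (f \<circ> chart_inv c) (transition c' c z))"
  proof (rule smooth_on_compose[OF dim S _ f smooth_transition[OF c' c W(2)]])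
    show "transition c' c ` ?S \<subseteq> snd c ` W" using chart_image_inv[OF c'] by auto
  qed
  then show "smooth_on ?S (f \<circ> chart_inv c')"
    by (rule smooth_on_cong[OF S, rotated])
      (use chart_image_inv[OF c'] chart_inv_chart[OF c] W(2) in auto)
qed

lemma smooth_map_chart:
  "smooth_map A W f \<Longrightarrow> c \<in> A \<Longrightarrow> smooth_on (snd c ` (W \<inter> fst c)) (\<lambda>z. f (chart_inv c z))"
  by (simp add: smooth_map_def o_def)

lemma smooth_map_iff_chart:
  assumes c: "c \<in> A" and W: "open W"
  shows "smooth_map A (W \<inter> fst c) f \<longleftrightarrow> smooth_on (snd c ` (W \<inter> fst c)) (\<lambda>z. f (chart_inv c z))"
proof
  show "smooth_map A (W \<inter> fst c) f \<Longrightarrow> smooth_on (snd c ` (W \<inter> fst c)) (\<lambda>z. f (chart_inv c z))"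
    using smooth_map_chart[OF _ c, of "W \<inter> fst c" f] by (simp add: Int_assoc)
  show "smooth_on (snd c ` (W \<inter> fst c)) (\<lambda>z. f (chart_inv c z)) \<Longrightarrow> smooth_map A (W \<inter> fst c) f"
    by (rule smooth_mapI_chart[OF c]) (use W open_chart_dom[OF c] in \<open>auto simp: o_def\<close>)
qed

lemma smooth_map_bilinear:
  "bounded_bilinear h \<Longrightarrow> open W \<Longrightarrow> smooth_map A W f \<Longrightarrow> smooth_map A W g \<Longrightarrow> smooth_map A W (\<lambda>x. h (f x) (g x))"
  unfolding smooth_map_def o_def by (auto intro: smooth_on_bilinear open_chart_image)

lemma smooth_map_linear:
  "bounded_linear h \<Longrightarrow> open W \<Longrightarrow> smooth_map A W f \<Longrightarrow> smooth_map A W (\<lambda>x. h (f x))"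
  unfolding smooth_map_def o_def by (auto intro: smooth_on_linear open_chart_image)

lemma smooth_map_add:
  "open W \<Longrightarrow> smooth_map A W f \<Longrightarrow> smooth_map A W g \<Longrightarrow> smooth_map A W (\<lambda>x. f x + g x)"
  unfolding smooth_map_def o_def by (auto intro: smooth_on_add open_chart_image)

lemma smooth_map_Pair:
  "open W \<Longrightarrow> smooth_map A W f \<Longrightarrow> smooth_map A W g \<Longrightarrow> smooth_map A W (\<lambda>x. (f x, g x))"
  unfolding smooth_map_def o_def by (auto intro: smooth_on_Pair open_chart_image)

lemma smooth_map_fst: "open W \<Longrightarrow> smooth_map A W f \<Longrightarrow> smooth_map A W (\<lambda>x. fst (f x))"
  and smooth_map_snd: "open W \<Longrightarrow> smooth_map A W f \<Longrightarrow> smooth_map A W (\<lambda>x. snd (f x))"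
  by (erule (1) smooth_map_linear[OF bounded_linear_fst] smooth_map_linear[OF bounded_linear_snd])+

lemma smooth_map_const: "smooth_map A W (\<lambda>x. k)"
  unfolding smooth_map_def o_def by (simp add: smooth_on_const)

lemma smooth_map_blinfunI:
  fixes f :: "'m \<Rightarrow> 'e \<Rightarrow>\<^sub>L real"
  shows "open W \<Longrightarrow> (\<And>w. smooth_map A W (\<lambda>x. blinfun_apply (f x) w)) \<Longrightarrow> smooth_map A W f"
  unfolding smooth_map_def o_def by (auto intro: smooth_on_blinfunI[OF dim] open_chart_image)

lemma smooth_map_FD_transition:
  assumes c: "c \<in> A" "c' \<in> A"
  shows "smooth_map A (fst c \<inter> fst c') (\<lambda>x. FD (transition c c') (snd c x) w)"
proof -
  have o: "open (fst c \<inter> fst c')" using c open_chart_dom by blast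
  have S: "open (snd c ` (fst c \<inter> fst c'))"
    using open_chart_image[OF c(1) o] by (simp add: Int_absorb2)
  show ?thesis
    by (rule smooth_mapI_chart[OF c(1) o], simp, rule smooth_on_cong[OF S _ smooth_on_FD[OF compatible[OF c]]])
      (use chart_chart_inv[OF c(1)] in auto)
qed

end

section \<open>Sections of the standard algebroid\<close>

definition std_triv ::
  "('m, 'e::real_normed_vector) chart set \<Rightarrow> ('m, 'e) chart \<Rightarrow> 'm \<Rightarrow> ('e, 'g) std_fiber \<Rightarrow> ('e, 'g) std_fiber" where
  "std_triv A c x u = (tcoord A c x (fst u), fst (snd u), cotangent_coord A c x (snd (snd u)))"

definition std_triv_inv ::
  "('m, 'e::real_normed_vector) chart set \<Rightarrow> ('m, 'e) chart \<Rightarrow> 'm \<Rightarrow> ('e, 'g) std_fiber \<Rightarrow> ('e, 'g) std_fiber" where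
  "std_triv_inv A c x u = (chart_field A c (fst u) x, fst (snd u),
     Blinfun (\<lambda>v. blinfun_apply (snd (snd u)) (tcoord A c x v)))"

text \<open>The local representative of a section, on which \<open>coord_bracket\<close> acts; it is
  meaningful for \<open>z\<close> in the image of the chart domain.\<close>

definition crd ::
  "('m, 'e::real_normed_vector) chart set \<Rightarrow> ('m, 'e) chart \<Rightarrow> ('m \<Rightarrow> ('e, 'g) std_fiber) \<Rightarrow> 'e \<Rightarrow> ('e, 'g) std_fiber" where
  "crd A c e z = std_triv A c (chart_inv c z) (e (chart_inv c z))"

lemma std_courant_simps:
  "fiber (std_courant A lb ip) x = UNIV"
  "trivs (std_courant A lb ip) = (\<lambda>c. (fst c, std_triv A c)) ` A"
  "anchor (std_courant A lb ip) x = fst"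
  "pairing (std_courant A lb ip) x = std_pairing ip"
  "cbracket (std_courant A lb ip) = std_bracket A lb ip"
  by (auto simp: std_courant_def std_triv_def std_pairing_def fun_eq_iff split: prod.splits intro!: image_cong)

lemma section_std_iff:
  "e \<in> sections A W (std_courant A lb ip) \<longleftrightarrow> (\<forall>c\<in>A. smooth_map A (W \<inter> fst c) (\<lambda>x. std_triv A c x (e x)))"
  by (auto simp: sections_def std_courant_simps)

lemma section_tangent_iff:
  "X \<in> sections A W (tangent_bundle A) \<longleftrightarrow> (\<forall>c\<in>A. smooth_map A (W \<inter> fst c) (\<lambda>x. tcoord A c x (X x)))"
  by (auto simp: sections_def tangent_bundle_def)

lemma section_cotangent_iff:
  "\<xi> \<in> sections A W (cotangent_bundle A) \<longleftrightarrow> (\<forall>c\<in>A. smooth_map A (W \<inter> fst c) (\<lambda>x. cotangent_coord A c x (\<xi> x)))"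
  by (auto simp: sections_def cotangent_bundle_def)

lemma section_trivial_iff: "a \<in> sections A W trivial_bundle \<longleftrightarrow> smooth_map A W a"
  by (auto simp: sections_def trivial_bundle_def)

context smooth_manifold
begin

lemma smooth_map_cover_charts:
  assumes "\<And>c. c \<in> A \<Longrightarrow> smooth_map A (W \<inter> fst c) f" "open W"
  shows "smooth_map A W f"
proof (rule smooth_map_local)
  fix x assume "x \<in> W"
  then show "\<exists>V. open V \<and> x \<in> V \<and> smooth_map A V f"
    using assms(1)[OF chart_at(1)] open_Int[OF assms(2) open_chart_dom[OF chart_at(1)]] chart_at(2)
    by (intro exI[of _ "W \<inter> fst (chart_at A x)"]) blast
qed

text \<open>Coordinates of a covector are its values on the fields with constant coordinates, so by
  \<open>smooth_map_blinfunI\<close> these fields suffice as tests.\<close>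

lemma section_cotangentI:
  assumes "open W" "\<And>c w. c \<in> A \<Longrightarrow> smooth_map A (W \<inter> fst c) (\<lambda>x. blinfun_apply (\<xi> x) (chart_field A c w x))"
  shows "\<xi> \<in> sections A W (cotangent_bundle A)"
  unfolding section_cotangent_iff
proof
  fix c assume c: "c \<in> A"
  have o: "open (W \<inter> fst c)" using assms(1) open_chart_dom[OF c] by blast
  show "smooth_map A (W \<inter> fst c) (\<lambda>x. cotangent_coord A c x (\<xi> x))"
  proof (rule smooth_map_blinfunI[OF o])
    fix w
    show "smooth_map A (W \<inter> fst c) (\<lambda>x. blinfun_apply (cotangent_coord A c x (\<xi> x)) w)"
      by (rule smooth_map_cong[OF o _ assms(2)[OF c, of w]]) (simp add: cotangent_coord_apply[OF c])
  qed
qed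

lemma section_chart_field:
  assumes "c \<in> A"
  shows "chart_field A c w \<in> sections A (W \<inter> fst c) (tangent_bundle A)"
  unfolding section_tangent_iff
proof
  fix c' assume c': "c' \<in> A"
  have o: "open (fst c \<inter> fst c')" using open_chart_dom[OF assms] open_chart_dom[OF c'] by blast
  have "smooth_map A (fst c \<inter> fst c') (\<lambda>x. tcoord A c' x (chart_field A c w x))"
    by (rule smooth_map_cong[OF o _ smooth_map_FD_transition[OF assms c', of w]])
      (simp add: tcoord_chart_field_transition[OF assms c'])
  then show "smooth_map A (W \<inter> fst c \<inter> fst c') (\<lambda>x. tcoord A c' x (chart_field A c w x))"
    by (rule smooth_map_subset) blast
qed

lemma smooth_map_cotangent_apply:
  assumes W: "open W" and \<xi>: "\<xi> \<in> sections A W (cotangent_bundle A)" and X: "X \<in> sections A W (tangent_bundle A)"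
  shows "smooth_map A W (\<lambda>x. blinfun_apply (\<xi> x) (X x))"
proof (rule smooth_map_cover_charts[OF _ W])
  fix c assume c: "c \<in> A"
  have o: "open (W \<inter> fst c)" using W open_chart_dom[OF c] by blast
  have "smooth_map A (W \<inter> fst c) (\<lambda>x. blinfun_apply (cotangent_coord A c x (\<xi> x)) (tcoord A c x (X x)))"
    using \<xi> X c unfolding section_cotangent_iff section_tangent_iff
    by (intro smooth_map_bilinear[OF bounded_bilinear_blinfun_apply o]) auto
  then show "smooth_map A (W \<inter> fst c) (\<lambda>x. blinfun_apply (\<xi> x) (X x))"
    by (rule smooth_map_cong[OF o, rotated])
      (simp add: cotangent_coord_apply[OF c] chart_field_tcoord[OF c])
qed

lemma section_std_components:
  fixes e :: "'m \<Rightarrow> ('e, 'g::real_normed_vector) std_fiber"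
  assumes W: "open W"
  shows "e \<in> sections A W (std_courant A lb ip) \<longleftrightarrow>
    (\<lambda>x. fst (e x)) \<in> sections A W (tangent_bundle A) \<and> smooth_map A W (\<lambda>x. fst (snd (e x)))
    \<and> (\<lambda>x. snd (snd (e x))) \<in> sections A W (cotangent_bundle A)"
proof -
  have "smooth_map A (W \<inter> fst c) (\<lambda>x. std_triv A c x (e x)) \<longleftrightarrow>
    smooth_map A (W \<inter> fst c) (\<lambda>x. tcoord A c x (fst (e x))) \<and>
    smooth_map A (W \<inter> fst c) (\<lambda>x. fst (snd (e x))) \<and>
    smooth_map A (W \<inter> fst c) (\<lambda>x. cotangent_coord A c x (snd (snd (e x))))" if c: "c \<in> A" for c
  proof -
    have o: "open (W \<inter> fst c)" using W open_chart_dom[OF c] by blast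
    let ?f = "\<lambda>x. std_triv A c x (e x)"
    have "smooth_map A (W \<inter> fst c) ?f \<longleftrightarrow> smooth_map A (W \<inter> fst c) (\<lambda>x. fst (?f x)) \<and>
      smooth_map A (W \<inter> fst c) (\<lambda>x. fst (snd (?f x))) \<and> smooth_map A (W \<inter> fst c) (\<lambda>x. snd (snd (?f x)))"
      (is "?l = ?r")
    proof
      assume ?l
      then show ?r by (intro conjI smooth_map_fst[OF o] smooth_map_snd[OF o])
    next
      assume r: ?r
      have "smooth_map A (W \<inter> fst c) (\<lambda>x. (fst (?f x), fst (snd (?f x)), snd (snd (?f x))))"
        using r by (intro smooth_map_Pair[OF o]) blast+
      then show ?l by (simp only: prod.collapse)
    qed
    then show ?thesis by (simp only: std_triv_def fst_conv snd_conv)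
  qed
  moreover have "smooth_map A W f \<longleftrightarrow> (\<forall>c\<in>A. smooth_map A (W \<inter> fst c) f)" for f :: "'m \<Rightarrow> 'g"
    using smooth_map_cover_charts[OF _ W] smooth_map_subset by blast
  ultimately show ?thesis
    unfolding section_std_iff section_tangent_iff section_cotangent_iff by blast
qed

lemma std_triv_chart_at: "std_triv A (chart_at A p) p u = u"
  by (simp add: std_triv_def tcoord_chart_at cotangent_coord_def chart_field_chart_at blinfun_apply_inverse)

lemma bounded_linear_tcoord_form:
  assumes "c \<in> A" "p \<in> fst c"
  shows "bounded_linear (\<lambda>v. blinfun_apply \<xi> (tcoord A c p v))"
  by (rule bounded_linear_compose[OF blinfun.bounded_linear_right linear_imp_bounded_linear[OF dim linear_tcoord[OF assms]]])

lemma std_triv_std_triv_inv: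
  assumes "c \<in> A" "x \<in> fst c"
  shows "std_triv A c x (std_triv_inv A c x u) = u"
  by (simp add: std_triv_def std_triv_inv_def tcoord_chart_field[OF assms] blinfun_eqI cotangent_coord_apply[OF assms]
    bounded_linear_Blinfun_apply[OF bounded_linear_tcoord_form[OF assms]] prod_eq_iff)

lemma std_triv_inv_std_triv:
  assumes "c \<in> A" "x \<in> fst c"
  shows "std_triv_inv A c x (std_triv A c x u) = u"
  by (simp add: std_triv_def std_triv_inv_def chart_field_tcoord[OF assms] cotangent_coord_apply[OF assms]
    blinfun_apply_inverse prod_eq_iff)

lemma bij_std_triv:
  assumes "c \<in> A" "x \<in> fst c"
  shows "bij (std_triv A c x)"
  by (rule o_bij[of "std_triv_inv A c x"])
    (rule ext, simp only: comp_apply id_apply std_triv_std_triv_inv[OF assms] std_triv_inv_std_triv[OF assms])+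

lemma linear_std_triv:
  assumes "c \<in> A" "x \<in> fst c"
  shows "linear (std_triv A c x :: ('e, 'g::real_normed_vector) std_fiber \<Rightarrow> _)"
proof (rule linearI)
  note lt = linear_tcoord[OF assms]
  show "std_triv A c x (u + v) = std_triv A c x u + std_triv A c x v" for u v :: "('e, 'g) std_fiber"
    by (simp add: std_triv_def linear_add[OF lt] blinfun_eqI cotangent_coord_apply[OF assms] blinfun.add_left)
  show "std_triv A c x (r *\<^sub>R v) = r *\<^sub>R std_triv A c x v" for r and v :: "('e, 'g) std_fiber"
    by (simp add: std_triv_def linear_scale[OF lt] blinfun_eqI cotangent_coord_apply[OF assms] blinfun.scaleR_left)
qed

lemma std_pairing_triv:
  assumes "c \<in> A" "x \<in> fst c"
  shows "std_pairing ip (std_triv A c x u) (std_triv A c x v) = std_pairing ip u v"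
  by (simp add: std_pairing_def std_triv_def cotangent_coord_apply[OF assms] chart_field_tcoord[OF assms])

lemma coord_related_std_triv:
  assumes c: "c \<in> A" "c' \<in> A" and p: "x \<in> fst c" "x \<in> fst c'"
  shows "coord_related (FD (transition c c') (snd c x)) (std_triv A c x u) (std_triv A c' x u)"
  by (simp add: coord_related_def std_triv_def tcoord_transition[OF assms] cotangent_coord_apply c p
    chart_field_transition[OF assms])

text \<open>These sections have constant coordinates \<open>u\<close> in \<open>c\<close>. Passing
  them through the gluing maps later gives smoothness of the transition functions of the glued
  bundle.\<close>

lemma section_std_triv_inv:
  fixes u :: "('e, 'g::real_normed_vector) std_fiber"
  assumes c: "c \<in> A" and W: "open W"
  shows "(\<lambda>x. std_triv_inv A c x u) \<in> sections A (W \<inter> fst c) (std_courant A lb ip)"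
proof -
  have o: "open (W \<inter> fst c)" using W open_chart_dom[OF c] by blast
  have 1: "chart_field A c w \<in> sections A (W \<inter> fst c) (tangent_bundle A)" for w
    by (rule section_chart_field[OF c])
  have "(\<lambda>x. Blinfun (\<lambda>v. blinfun_apply (snd (snd u)) (tcoord A c x v))) \<in> sections A (W \<inter> fst c) (cotangent_bundle A)"
  proof (rule section_cotangentI[OF o])
    fix c' w assume c': "c' \<in> A"
    have o': "open (W \<inter> fst c \<inter> fst c')" using o open_chart_dom[OF c'] by blast
    have "smooth_map A (W \<inter> fst c' \<inter> fst c) (\<lambda>x. tcoord A c x (chart_field A c' w x))"
      using section_chart_field[OF c', of w W] c unfolding section_tangent_iff by blast
    then have "smooth_map A (W \<inter> fst c \<inter> fst c') (\<lambda>x. tcoord A c x (chart_field A c' w x))"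
      by (simp add: Int_ac)
    then have "smooth_map A (W \<inter> fst c \<inter> fst c') (\<lambda>x. blinfun_apply (snd (snd u)) (tcoord A c x (chart_field A c' w x)))"
      by (rule smooth_map_linear[OF blinfun.bounded_linear_right o'])
    then show "smooth_map A (W \<inter> fst c \<inter> fst c')
        (\<lambda>x. blinfun_apply (Blinfun (\<lambda>v. blinfun_apply (snd (snd u)) (tcoord A c x v))) (chart_field A c' w x))"
      by (rule smooth_map_cong[OF o', rotated])
        (simp add: bounded_linear_Blinfun_apply[OF bounded_linear_tcoord_form[OF c]])
  qed
  then show ?thesis
    unfolding section_std_components[OF o] std_triv_inv_def using 1 smooth_map_const by simp
qed

lemma smooth_crd:
  assumes "c \<in> A" "open W" "e \<in> sections A W (std_courant A lb ip)"
  shows "smooth_on (snd c ` (W \<inter> fst c)) (crd A c e)"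
  using assms(3) assms(1) smooth_map_iff_chart[OF assms(1,2), of "\<lambda>x. std_triv A c x (e x)"]
  unfolding section_std_iff crd_def by blast

lemma section_stdI:
  assumes "open W" "\<And>c. c \<in> A \<Longrightarrow> smooth_on (snd c ` (W \<inter> fst c)) (crd A c e)"
  shows "e \<in> sections A W (std_courant A lb ip)"
  using assms(2) smooth_map_iff_chart[OF _ assms(1), of _ "\<lambda>x. std_triv A _ x (e x)"]
  unfolding section_std_iff crd_def by blast

lemma section_cong:
  assumes W: "open W" and E: "\<And>V t. (V, t) \<in> trivs E \<Longrightarrow> open V"
    and eq: "\<And>x. x \<in> W \<Longrightarrow> e x = e' x" and e: "e \<in> sections A W E"
  shows "e' \<in> sections A W E"
  unfolding sections_def
proof (rule CollectI, intro conjI ballI)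
  show "e' x \<in> fiber E x" if "x \<in> W" for x using that e eq by (auto simp: sections_def)
  fix p assume p: "p \<in> trivs E"
  obtain V t where [simp]: "p = (V, t)" by (cases p)
  have "smooth_map A (W \<inter> V) (\<lambda>x. t x (e' x))"
    by (rule smooth_map_cong[of _ "\<lambda>x. t x (e x)"]) (use W E p e eq in \<open>auto simp: sections_def\<close>)
  then show "case p of (V, t) \<Rightarrow> smooth_map A (W \<inter> V) (\<lambda>x. t x (e' x))" by simp
qed

lemma section_std_cong:
  assumes "open W" "\<And>x. x \<in> W \<Longrightarrow> e x = e' x" "e \<in> sections A W (std_courant A lb ip)"
  shows "e' \<in> sections A W (std_courant A lb ip)"
  by (rule section_cong[OF assms(1) _ assms(2,3)]) (use open_chart_dom in \<open>auto simp: std_courant_simps\<close>)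

end

lemma section_subset:
  assumes "smooth_manifold A" "e \<in> sections A W E" "V \<subseteq> W"
  shows "e \<in> sections A V E"
proof -
  have "smooth_map A (V \<inter> V') f" if "smooth_map A (W \<inter> V') f" for V' and f :: "_ \<Rightarrow> 'z::real_normed_vector"
    by (rule smooth_manifold.smooth_map_subset[OF assms(1) that]) (use assms(3) in blast)
  then show ?thesis using assms(2,3) unfolding sections_def by fast
qed

text \<open>The extension operation of the record \<open>courant\<close> shadows the extension of tangent vectors.\<close>

hide_const courant.extend
hide_fact courant.extend_def

section \<open>The standard bracket on a manifold\<close>

context standard_model
begin

section \<open>Locality, bilinearity and compatibility with the pairing for the coordinate
  bracket\<close>

lemma cb_cong:
  assumes "open S" "z \<in> S" "\<And>y. y \<in> S \<Longrightarrow> e1 y = e1' y" "\<And>y. y \<in> S \<Longrightarrow> e2 y = e2' y"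
  shows "cb e1 e2 z = cb e1' e2' z"
  unfolding coord_bracket_def
  using FD_cong[OF assms(1-3)] FD_cong[OF assms(1,2,4)] assms(3,4)[OF assms(2)] by simp

lemma FD_lincomb:
  assumes "f differentiable (at z)" "g differentiable (at z)"
  shows "FD (\<lambda>x. r *\<^sub>R f x + g x) z v = r *\<^sub>R FD f z v + FD g z v"
proof -
  have "((\<lambda>x. r *\<^sub>R f x + g x) has_derivative (\<lambda>v. r *\<^sub>R FD f z v + FD g z v)) (at z)"
    by (intro has_derivative_add has_derivative_scaleR_right FD_has_derivative assms)
  from FD_eq[OF this] show ?thesis by simp
qed

lemma cb_linear_right:
  fixes e1 e2 e3 :: "'e \<Rightarrow> ('e, 'g) std_fiber"
  assumes d: "e1 differentiable (at z)" "e2 differentiable (at z)" "e3 differentiable (at z)"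
  shows "cb e1 (\<lambda>x. r *\<^sub>R e2 x + e3 x) z = r *\<^sub>R cb e1 e2 z + cb e1 e3 z"
proof (rule pair_eqI)
  fix w
  note L = linear_frechet_derivative[OF d(1)]
  show "pair (cb e1 (\<lambda>x. r *\<^sub>R e2 x + e3 x) z) w = pair (r *\<^sub>R cb e1 e2 z + cb e1 e3 z) w"
    by (simp add: bilinear_ladd[OF bilinear_pair] bilinear_lmul[OF bilinear_pair] bilinear_radd[OF bilinear_pair]
      bilinear_rmul[OF bilinear_pair] pair_cb[OF d(1)] FD_lincomb[OF d(2,3)] linear_add[OF L] linear_scale[OF L]
      bilinear_radd[OF lb_bilinear] bilinear_rmul[OF lb_bilinear] bilinear_ladd[OF ip_bilinear] bilinear_lmul[OF ip_bilinear])
      (simp add: algebra_simps)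
qed

lemma cb_linear_left:
  fixes e1 e2 e3 :: "'e \<Rightarrow> ('e, 'g) std_fiber"
  assumes d: "e1 differentiable (at z)" "e2 differentiable (at z)" "e3 differentiable (at z)"
  shows "cb (\<lambda>x. r *\<^sub>R e1 x + e2 x) e3 z = r *\<^sub>R cb e1 e3 z + cb e2 e3 z"
proof (rule pair_eqI)
  fix w
  note L = linear_frechet_derivative[OF d(3)]
  have d12: "(\<lambda>x. r *\<^sub>R e1 x + e2 x) differentiable (at z)"
    using d by (intro differentiable_add differentiable_scaleR differentiable_const)
  show "pair (cb (\<lambda>x. r *\<^sub>R e1 x + e2 x) e3 z) w = pair (r *\<^sub>R cb e1 e3 z + cb e2 e3 z) w"
    by (simp add: bilinear_ladd[OF bilinear_pair] bilinear_lmul[OF bilinear_pair]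
      pair_cb[OF d12] pair_cb[OF d(1)] pair_cb[OF d(2)] FD_lincomb[OF d(1,2)] linear_add[OF L] linear_scale[OF L]
      bilinear_ladd[OF lb_bilinear] bilinear_lmul[OF lb_bilinear] bilinear_ladd[OF ip_bilinear] bilinear_lmul[OF ip_bilinear])
      (simp add: algebra_simps)
qed

lemma FD_pair:
  assumes "e1 differentiable (at z)" "e2 differentiable (at z)"
  shows "FD (\<lambda>y. pair (e1 y) (e2 y)) z v = pair (FD e1 z v) (e2 z) + pair (e1 z) (FD e2 z v)"
  using FD_eq[OF bounded_bilinear.FDERIV[OF bounded_bilinear_pair FD_has_derivative[OF assms(1)] FD_has_derivative[OF assms(2)]]]
  by simp

text \<open>The two directional derivatives cancel and the Lie bracket vanishes; the remaining term
  <De(rho w), e> is half the derivative of <e, e>.\<close>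

lemma cb_diag:
  assumes "e differentiable (at z)"
  shows "pair (cb e e z) w = 1/2 * FD (\<lambda>y. pair (e y) (e y)) z (fst w)"
  by (simp add: pair_cb[OF assms] FD_pair[OF assms assms] lb_alternating bilinear_lzero[OF ip_bilinear]
    pair_sym[of "e z"])

text \<open>The terms that differentiate \<open>e1\<close> cancel crosswise between the two
  brackets, the Lie bracket terms cancel by invariance of \<open>ip\<close>, and the product rule
  remains.\<close>

lemma cb_invariant:
  assumes d: "e1 differentiable (at z)" "e2 differentiable (at z)" "e3 differentiable (at z)"
  shows "FD (\<lambda>y. pair (e2 y) (e3 y)) z (fst (e1 z)) = pair (cb e1 e2 z) (e3 z) + pair (e2 z) (cb e1 e3 z)"
  using ip_invariant[of "fst (snd (e1 z))" "fst (snd (e2 z))" "fst (snd (e3 z))"]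
    ip_sym[of "fst (snd (e2 z))"]
  by (simp add: pair_cb[OF d(1)] FD_pair[OF d(2,3)] pair_sym[of "e2 z"])

end

locale manifold_model = M?: smooth_manifold A + Q?: standard_model lb ip "TYPE('e)"
  for A :: "('m::{t2_space,second_countable_topology}, 'e::real_normed_vector) chart set"
    and lb :: "'g::real_normed_vector \<Rightarrow> 'g \<Rightarrow> 'g" and ip :: "'g \<Rightarrow> 'g \<Rightarrow> real"
begin

abbreviation std :: "('m, ('e, 'g) std_fiber, ('e, 'g) std_fiber, 'e) courant" where
  "std \<equiv> std_courant A lb ip"

abbreviation sbr :: "('m \<Rightarrow> ('e, 'g) std_fiber) \<Rightarrow> ('m \<Rightarrow> ('e, 'g) std_fiber) \<Rightarrow> 'm \<Rightarrow> ('e, 'g) std_fiber" where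
  "sbr \<equiv> std_bracket A lb ip"

lemma crd_differentiable:
  fixes e :: "'m \<Rightarrow> ('e, 'g) std_fiber"
  assumes "open W" "e \<in> sections A W std" "c \<in> A" "p \<in> W" "p \<in> fst c"
  shows "crd A c e differentiable (at (snd c p))"
  by (rule smooth_on_differentiable[OF smooth_crd[OF assms(3,1,2)]]) (use assms in blast)

lemma crd_at: "c \<in> A \<Longrightarrow> p \<in> fst c \<Longrightarrow> crd A c e (snd c p) = std_triv A c p (e p)"
  by (simp add: crd_def chart_inv_chart)

text \<open>In the preferred chart of \<open>p\<close> the Cartan formulas become ordinary
  derivatives: extended vectors have constant coordinates, and at \<open>p\<close> itself the
  trivialization is the identity.\<close>

lemma std_bracket_chart_at:
  assumes W: "open W" "p \<in> W" and e1: "e1 \<in> sections A W std" and e2: "e2 \<in> sections A W std"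
  shows "sbr e1 e2 p = cb (crd A (chart_at A p) e1) (crd A (chart_at A p) e2) (snd (chart_at A p) p)"
proof -
  let ?c = "chart_at A p"
  define z E1 E2 where "z = snd ?c p" and "E1 = crd A ?c e1" and "E2 = crd A ?c e2"
  note c = chart_at[of p]
  have z0: "chart_inv ?c z = p" using chart_inv_chart[OF c] by (simp add: z_def)
  have Ez: "E1 z = e1 p" "E2 z = e2 p"
    unfolding E1_def E2_def z_def crd_at[OF c] std_triv_chart_at by simp_all
  let ?S = "snd ?c ` (W \<inter> fst ?c)"
  have S: "open ?S" "z \<in> ?S" using open_chart_image[OF c(1) W(1)] W(2) c(2) by (auto simp: z_def)
  have inS: "chart_inv ?c y \<in> fst ?c" if "y \<in> ?S" for y using chart_image_inv[OF c(1) that] by blast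
  have d: "(E1 has_derivative FD E1 z) (at z)" "(E2 has_derivative FD E2 z) (at z)"
    unfolding E1_def E2_def z_def
    by (rule FD_has_derivative[OF crd_differentiable[OF W(1) _ c(1) W(2) c(2)]], fact)+
  have dX: "dir_deriv A (\<lambda>q. tcoord A ?c q (fst (e q))) p v = fst (FD E z v)"
    if "(E has_derivative FD E z) (at z)" "E = crd A ?c e" for e E v
  proof -
    have "(\<lambda>q. tcoord A ?c q (fst (e q))) \<circ> chart_inv ?c = (\<lambda>y. fst (E y))"
      by (simp add: that(2) crd_def std_triv_def fun_eq_iff)
    then show ?thesis unfolding dir_deriv_def z_def[symmetric]
      using FD_eq[OF has_derivative_fst[OF that(1)]] by simp
  qed
  have da: "dir_deriv A (\<lambda>q. fst (snd (e q))) p v = fst (snd (FD E z v))"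
    if "(E has_derivative FD E z) (at z)" "E = crd A ?c e" for e E v
  proof -
    have "(\<lambda>q. fst (snd (e q))) \<circ> chart_inv ?c = (\<lambda>y. fst (snd (E y)))"
      by (simp add: that(2) crd_def std_triv_def fun_eq_iff)
    then show ?thesis unfolding dir_deriv_def z_def[symmetric]
      using FD_eq[OF has_derivative_fst[OF has_derivative_snd[OF that(1)]]] by simp
  qed
  have d\<xi>: "dir_deriv A (\<lambda>q. blinfun_apply (snd (snd (e q))) (extend A p v q)) p u = blinfun_apply (snd (snd (FD E z u))) v"
    if "(E has_derivative FD E z) (at z)" "E = crd A ?c e" for e E u v
  proof -
    have "((\<lambda>y. blinfun_apply (snd (snd (E y))) v) has_derivative (\<lambda>u. blinfun_apply (snd (snd (FD E z u))) v)) (at z)"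
      by (intro bounded_linear.has_derivative[OF bounded_bilinear.bounded_linear_left[OF bounded_bilinear_blinfun_apply]]
        has_derivative_snd that)
    from FD_eq[OF this] have "FD (\<lambda>y. blinfun_apply (snd (snd (E y))) v) z u = blinfun_apply (snd (snd (FD E z u))) v"
      by (rule fun_cong)
    moreover have "FD ((\<lambda>q. blinfun_apply (snd (snd (e q))) (extend A p v q)) \<circ> chart_inv ?c) z
        = FD (\<lambda>y. blinfun_apply (snd (snd (E y))) v) z"
      by (rule FD_cong[OF S])
        (simp add: that(2) crd_def std_triv_def cotangent_coord_apply[OF c(1) inS] extend_def)
    ultimately show ?thesis unfolding dir_deriv_def z_def[symmetric] by (simp only:)
  qed
  have ext_p: "extend A p v p = v" for v by (simp add: extend_def chart_field_chart_at)
  have dconst: "dir_deriv A (\<lambda>q. tcoord A ?c q (extend A p v q)) p u = 0" for u v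
  proof -
    have "FD ((\<lambda>q. tcoord A ?c q (extend A p v q)) \<circ> chart_inv ?c) z = FD (\<lambda>y. v) z"
      by (rule FD_cong[OF S]) (simp add: extend_def tcoord_chart_field[OF c(1) inS])
    then show ?thesis unfolding dir_deriv_def z_def[symmetric] by simp
  qed
  note D1 = dX[OF d(1) E1_def] da[OF d(1) E1_def] d\<xi>[OF d(1) E1_def]
  note D2 = dX[OF d(2) E2_def] da[OF d(2) E2_def] d\<xi>[OF d(2) E2_def]
  have "E1 differentiable (at z)" using d(1) by (auto simp: differentiable_def)
  note ap = bounded_linear_Blinfun_apply[OF bounded_linear_cb_form[OF this]]
  let ?B = "snd (snd (cb E1 E2 z))"
  have "(\<lambda>v. lie_deriv1 A (\<lambda>q. fst (e1 q)) (\<lambda>q. blinfun_apply (snd (snd (e2 q)))) p v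
      - ext_deriv1 A (\<lambda>q. blinfun_apply (snd (snd (e1 q)))) p (fst (e2 p)) v
      + 2 * ip (fst (snd (e2 p))) (dir_deriv A (\<lambda>q. fst (snd (e1 q))) p v)) = blinfun_apply ?B"
  proof
    fix v
    show "lie_deriv1 A (\<lambda>q. fst (e1 q)) (\<lambda>q. blinfun_apply (snd (snd (e2 q)))) p v
      - ext_deriv1 A (\<lambda>q. blinfun_apply (snd (snd (e1 q)))) p (fst (e2 p)) v
      + 2 * ip (fst (snd (e2 p))) (dir_deriv A (\<lambda>q. fst (snd (e1 q))) p v) = blinfun_apply ?B v"
    proof -
      have "blinfun_apply ?B v = blinfun_apply (snd (snd (FD E2 z (fst (e1 p))))) v
          - blinfun_apply (snd (snd (FD E1 z (fst (e2 p))))) v + 2 * pair (FD E1 z v) (e2 p)"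
        by (simp only: coord_bracket_def Ez snd_add snd_diff snd_conv blinfun.add_left blinfun.diff_left ap)
      \<comment> \<open>These three summands are the ones supplied by the exterior derivative, the
        Lie derivative and the last term of the bracket, in this order.\<close>
      moreover have "2 * pair (FD E1 z v) (e2 p) = blinfun_apply (snd (snd (FD E1 z v))) (fst (e2 p))
          + blinfun_apply (snd (snd (e2 p))) (fst (FD E1 z v)) + 2 * ip (fst (snd (e2 p))) (fst (snd (FD E1 z v)))"
        unfolding std_pairing_def ip_sym[of "fst (snd (e2 p))"] by (simp add: algebra_simps)
      ultimately show ?thesis
        unfolding lie_deriv1_def ext_deriv1_def lie_bracket_def D1 D2 dconst ext_p
        by (simp add: blinfun.minus_right)
    qed
  qed
  then have "sbr e1 e2 p = cb E1 E2 z"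
    unfolding std_bracket_def Let_def lie_bracket_def D1 D2
    by (simp only: blinfun_apply_inverse) (simp add: coord_bracket_def Ez prod_eq_iff)
  then show ?thesis by (simp add: E1_def E2_def z_def)
qed

text \<open>The relation constrains the transformed covector on the range of \<open>L\<close> alone,
  whence surjectivity.\<close>

lemma coord_related_unique:
  fixes u v w :: "('e, 'g) std_fiber"
  assumes "coord_related L u v" "coord_related L u w" "surj L"
  shows "v = w"
proof -
  have "snd (snd v) = snd (snd w)"
  proof (rule blinfun_eqI)
    fix x
    obtain y where "x = L y" using assms(3) by (metis surjD)
    then show "blinfun_apply (snd (snd v)) x = blinfun_apply (snd (snd w)) x"
      using assms(1,2) by (simp add: coord_related_def)
  qed
  then show ?thesis using assms(1,2) by (simp add: coord_related_def prod_eq_iff)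
qed

text \<open>Both sides are related, through the transition from the preferred chart, to the value
  computed there: the left one because it is the same fibre element in two charts, the right one by
  \<open>coord_related_cb\<close>. This derivative is invertible, so they agree.\<close>

lemma std_bracket_chart:
  assumes W: "open W" "p \<in> W" and e1: "e1 \<in> sections A W std" and e2: "e2 \<in> sections A W std"
    and c: "c \<in> A" "p \<in> fst c"
  shows "std_triv A c p (sbr e1 e2 p) = cb (crd A c e1) (crd A c e2) (snd c p)"
proof -
  let ?c = "chart_at A p"
  let ?\<psi> = "transition ?c c"
  let ?z = "snd ?c p"
  let ?S = "snd ?c ` ((W \<inter> fst c) \<inter> fst ?c)"
  note c0 = chart_at[of p]
  have S: "open ?S" "?z \<in> ?S"
    using open_chart_image[OF c0(1) open_Int[OF W(1) open_chart_dom[OF c(1)]]] W(2) c(2) c0(2) by auto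
  have z: "?\<psi> ?z = snd c p" using chart_inv_chart[OF c0] by simp
  have sm: "smooth_on ?S ?\<psi>" by (rule smooth_transition[OF c0(1) c(1)]) simp
  have rel: "coord_related (FD ?\<psi> y) (crd A ?c e y) (crd A c e (?\<psi> y))" if y: "y \<in> ?S" for e :: "'m \<Rightarrow> ('e, 'g) std_fiber" and y
  proof -
    obtain q where q: "q \<in> fst c" "q \<in> fst ?c" "y = snd ?c q" using y by blast
    show ?thesis
      using coord_related_std_triv[OF c0(1) c(1) q(2,1), of "e q"] q
      by (simp add: crd_def chart_inv_chart[OF c0(1) q(2)] chart_inv_chart[OF c(1) q(1)])
  qed
  note d = crd_differentiable[OF W(1) e1 c0(1) W(2) c0(2)] crd_differentiable[OF W(1) e2 c0(1) W(2) c0(2)]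
    crd_differentiable[OF W(1) e1 c(1) W(2) c(2), folded z] crd_differentiable[OF W(1) e2 c(1) W(2) c(2), folded z]
  have "coord_related (FD ?\<psi> ?z) (cb (crd A ?c e1) (crd A ?c e2) ?z) (cb (crd A c e1) (crd A c e2) (?\<psi> ?z))"
    by (rule coord_related_cb[OF S sm d(1,3) d(2,4)]) (rule rel; assumption)+
  then have 1: "coord_related (FD ?\<psi> ?z) (sbr e1 e2 p) (cb (crd A c e1) (crd A c e2) (snd c p))"
    unfolding z std_bracket_chart_at[OF W e1 e2] .
  have 2: "coord_related (FD ?\<psi> ?z) (sbr e1 e2 p) (std_triv A c p (sbr e1 e2 p))"
    using coord_related_std_triv[OF c0(1) c(1) c0(2) c(2), of "sbr e1 e2 p"] by (simp only: std_triv_chart_at)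
  have "FD ?\<psi> ?z (FD (transition c ?c) (snd c p) w) = w" for w
    by (simp only: FD_transition_chain[OF c(1) c0(1) c(1) c(2) c0(2) c(2)] FD_transition_self[OF c])
  then have "surj (FD ?\<psi> ?z)" by (metis surjI)
  from coord_related_unique[OF 2 1 this] show ?thesis .
qed

text \<open>The identity holds throughout the image of \<open>W\<close> in one fixed chart and may
  therefore be differentiated, as nested brackets require.\<close>

lemma crd_std_bracket:
  assumes W: "open W" and e1: "e1 \<in> sections A W std" and e2: "e2 \<in> sections A W std"
    and c: "c \<in> A" and z: "z \<in> snd c ` (W \<inter> fst c)"
  shows "crd A c (sbr e1 e2) z = cb (crd A c e1) (crd A c e2) z"
  using std_bracket_chart[OF W _ e1 e2 c, of "chart_inv c z"] chart_image_inv[OF c z]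
  by (simp add: crd_def)

lemma std_bracket_sections:
  assumes W: "open W" and e1: "e1 \<in> sections A W std" and e2: "e2 \<in> sections A W std"
  shows "sbr e1 e2 \<in> sections A W std"
proof (rule section_stdI[OF W])
  fix c assume c: "c \<in> A"
  show "smooth_on (snd c ` (W \<inter> fst c)) (crd A c (sbr e1 e2))"
    by (rule smooth_on_cong[OF open_chart_image[OF c W] crd_std_bracket[OF W e1 e2 c, symmetric]
      smooth_cb[OF open_chart_image[OF c W] smooth_crd[OF c W e1] smooth_crd[OF c W e2]]])
qed

lemma std_bracket_leibniz:
  assumes W: "open W" "p \<in> W" and e: "e1 \<in> sections A W std" "e2 \<in> sections A W std" "e3 \<in> sections A W std"
  shows "sbr e1 (sbr e2 e3) p = sbr (sbr e1 e2) e3 p + sbr e2 (sbr e1 e3) p"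
proof -
  let ?c = "chart_at A p"
  let ?S = "snd ?c ` (W \<inter> fst ?c)"
  note c = chart_at[of p]
  have S: "open ?S" "snd ?c p \<in> ?S" using open_chart_image[OF c(1) W(1)] W(2) c(2) by auto
  note sec = std_bracket_sections[OF W(1)]
  note crd = crd_std_bracket[OF W(1) _ _ c(1)]
  let ?E = "crd A ?c" and ?z = "snd ?c p"
  have "cb (?E e1) (?E (sbr e2 e3)) ?z = cb (?E e1) (cb (?E e2) (?E e3)) ?z"
    by (rule cb_cong[OF S refl crd[OF e(2,3)]])
  moreover have "cb (?E (sbr e1 e2)) (?E e3) ?z = cb (cb (?E e1) (?E e2)) (?E e3) ?z"
    by (rule cb_cong[OF S crd[OF e(1,2)] refl])
  moreover have "cb (?E e2) (?E (sbr e1 e3)) ?z = cb (?E e2) (cb (?E e1) (?E e3)) ?z"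
    by (rule cb_cong[OF S refl crd[OF e(1,3)]])
  ultimately show ?thesis
    unfolding std_bracket_chart_at[OF W e(1) sec[OF e(2,3)]] std_bracket_chart_at[OF W sec[OF e(1,2)] e(3)]
      std_bracket_chart_at[OF W e(2) sec[OF e(1,3)]]
    by (simp only: cb_leibniz[OF S smooth_crd[OF c(1) W(1) e(1)] smooth_crd[OF c(1) W(1) e(2)] smooth_crd[OF c(1) W(1) e(3)]])
qed

text \<open>Sections are constrained over \<open>W\<close> only, and the identifications with the
  local models satisfy their relations only on overlaps; the bracket must not see anything
  else.\<close>

lemma std_bracket_cong:
  assumes W: "open W" "p \<in> W" and e: "e1 \<in> sections A W std" "e2 \<in> sections A W std"
    and eq: "\<And>x. x \<in> W \<Longrightarrow> e1 x = e1' x" "\<And>x. x \<in> W \<Longrightarrow> e2 x = e2' x"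
  shows "sbr e1 e2 p = sbr e1' e2' p"
proof -
  let ?c = "chart_at A p"
  let ?S = "snd ?c ` (W \<inter> fst ?c)"
  note c = chart_at[of p]
  have S: "open ?S" "snd ?c p \<in> ?S" using open_chart_image[OF c(1) W(1)] W(2) c(2) by auto
  have e': "e1' \<in> sections A W std" "e2' \<in> sections A W std"
    using section_std_cong[OF W(1) eq(1) e(1)] section_std_cong[OF W(1) eq(2) e(2)] by blast+
  show ?thesis
    unfolding std_bracket_chart_at[OF W e] std_bracket_chart_at[OF W e']
    by (rule cb_cong[OF S]) (use chart_image_inv[OF c(1)] eq in \<open>auto simp: crd_def\<close>)
qed

lemma crd_lincomb:
  fixes e f :: "'m \<Rightarrow> ('e, 'g) std_fiber"
  assumes c: "c \<in> A" and y: "y \<in> snd c ` (W \<inter> fst c)"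
  shows "crd A c (\<lambda>x. r *\<^sub>R e x + f x) y = r *\<^sub>R crd A c e y + crd A c f y"
proof -
  have "linear (std_triv A c (chart_inv c y) :: ('e, 'g) std_fiber \<Rightarrow> _)"
    using chart_image_inv[OF c y] by (intro linear_std_triv[OF c]) blast
  then show ?thesis by (simp add: crd_def linear_add linear_scale)
qed

lemma section_lincomb:
  assumes W: "open W" and e: "e \<in> sections A W std" "f \<in> sections A W std"
  shows "(\<lambda>x. r *\<^sub>R e x + f x) \<in> sections A W std"
proof (rule section_stdI[OF W])
  fix c assume c: "c \<in> A"
  note S = open_chart_image[OF c W]
  show "smooth_on (snd c ` (W \<inter> fst c)) (crd A c (\<lambda>x. r *\<^sub>R e x + f x))"
    by (rule smooth_on_cong[OF S crd_lincomb[OF c, symmetric]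
      smooth_on_add[OF S smooth_on_scaleR_left[OF S smooth_crd[OF c W e(1)]] smooth_crd[OF c W e(2)]]])
qed

lemma std_bracket_linear_right:
  assumes W: "open W" "p \<in> W" and e: "e1 \<in> sections A W std" "e2 \<in> sections A W std" "e3 \<in> sections A W std"
  shows "sbr e1 (\<lambda>x. r *\<^sub>R e2 x + e3 x) p = r *\<^sub>R sbr e1 e2 p + sbr e1 e3 p"
proof -
  let ?c = "chart_at A p"
  let ?S = "snd ?c ` (W \<inter> fst ?c)"
  note c = chart_at[of p]
  have S: "open ?S" "snd ?c p \<in> ?S" using open_chart_image[OF c(1) W(1)] W(2) c(2) by auto
  note d = crd_differentiable[OF W(1) _ c(1) W(2) c(2)]
  have "cb (crd A ?c e1) (crd A ?c (\<lambda>x. r *\<^sub>R e2 x + e3 x)) (snd ?c p)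
      = cb (crd A ?c e1) (\<lambda>x. r *\<^sub>R crd A ?c e2 x + crd A ?c e3 x) (snd ?c p)"
    by (rule cb_cong[OF S refl crd_lincomb[OF c(1)]])
  then show ?thesis
    unfolding std_bracket_chart_at[OF W e(1) section_lincomb[OF W(1) e(2,3)]] std_bracket_chart_at[OF W e(1,2)]
      std_bracket_chart_at[OF W e(1,3)]
    by (simp only: cb_linear_right[OF d[OF e(1)] d[OF e(2)] d[OF e(3)]])
qed

lemma std_bracket_linear_left:
  assumes W: "open W" "p \<in> W" and e: "e1 \<in> sections A W std" "e2 \<in> sections A W std" "e3 \<in> sections A W std"
  shows "sbr (\<lambda>x. r *\<^sub>R e1 x + e2 x) e3 p = r *\<^sub>R sbr e1 e3 p + sbr e2 e3 p"
proof -
  let ?c = "chart_at A p"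
  let ?S = "snd ?c ` (W \<inter> fst ?c)"
  note c = chart_at[of p]
  have S: "open ?S" "snd ?c p \<in> ?S" using open_chart_image[OF c(1) W(1)] W(2) c(2) by auto
  note d = crd_differentiable[OF W(1) _ c(1) W(2) c(2)]
  have "cb (crd A ?c (\<lambda>x. r *\<^sub>R e1 x + e2 x)) (crd A ?c e3) (snd ?c p)
      = cb (\<lambda>x. r *\<^sub>R crd A ?c e1 x + crd A ?c e2 x) (crd A ?c e3) (snd ?c p)"
    by (rule cb_cong[OF S crd_lincomb[OF c(1)] refl])
  then show ?thesis
    unfolding std_bracket_chart_at[OF W section_lincomb[OF W(1) e(1,2)] e(3)] std_bracket_chart_at[OF W e(1,3)]
      std_bracket_chart_at[OF W e(2,3)]
    by (simp only: cb_linear_left[OF d[OF e(1)] d[OF e(2)] d[OF e(3)]])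
qed

lemma dir_deriv_pair:
  assumes W: "open W" "p \<in> W"
  shows "dir_deriv A (\<lambda>q. pair (e q) (f q)) p v
    = FD (\<lambda>y. pair (crd A (chart_at A p) e y) (crd A (chart_at A p) f y)) (snd (chart_at A p) p) v"
proof -
  let ?c = "chart_at A p"
  let ?S = "snd ?c ` (W \<inter> fst ?c)"
  note c = chart_at[of p]
  have S: "open ?S" "snd ?c p \<in> ?S" using open_chart_image[OF c(1) W(1)] W(2) c(2) by auto
  have "FD ((\<lambda>q. pair (e q) (f q)) \<circ> chart_inv ?c) (snd ?c p) = FD (\<lambda>y. pair (crd A ?c e y) (crd A ?c f y)) (snd ?c p)"
    by (rule FD_cong[OF S]) (use chart_image_inv[OF c(1)] in \<open>auto simp: crd_def std_pairing_triv[OF c(1)]\<close>)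
  then show ?thesis by (simp add: dir_deriv_def)
qed

lemma std_bracket_diag:
  assumes W: "open W" "p \<in> W" and e: "e \<in> sections A W std"
  shows "pair (sbr e e p) w = 1/2 * dir_deriv A (\<lambda>q. pair (e q) (e q)) p (fst w)"
  unfolding std_bracket_chart_at[OF W e e] dir_deriv_pair[OF W]
  by (rule cb_diag[OF crd_differentiable[OF W(1) e chart_at(1) W(2) chart_at(2)]])

lemma std_bracket_invariant:
  assumes W: "open W" "p \<in> W" and e: "e1 \<in> sections A W std" "e2 \<in> sections A W std" "e3 \<in> sections A W std"
  shows "dir_deriv A (\<lambda>q. pair (e2 q) (e3 q)) p (fst (e1 p)) = pair (sbr e1 e2 p) (e3 p) + pair (e2 p) (sbr e1 e3 p)"
proof -
  note d = crd_differentiable[OF W(1) _ chart_at(1) W(2) chart_at(2)]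
  show ?thesis
    using cb_invariant[OF d[OF e(1)] d[OF e(2)] d[OF e(3)]]
    unfolding std_bracket_chart_at[OF W e(1,2)] std_bracket_chart_at[OF W e(1,3)] dir_deriv_pair[OF W]
      crd_at[OF chart_at] std_triv_chart_at .
qed

lemma smooth_map_pair:
  assumes W: "open W" and e: "e1 \<in> sections A W std" "e2 \<in> sections A W std"
  shows "smooth_map A W (\<lambda>x. pair (e1 x) (e2 x))"
proof (rule smooth_map_cover_charts[OF _ W])
  fix c assume c: "c \<in> A"
  have o: "open (W \<inter> fst c)" using W open_chart_dom[OF c] by blast
  have "smooth_map A (W \<inter> fst c) (\<lambda>x. pair (std_triv A c x (e1 x)) (std_triv A c x (e2 x)))"
    by (rule smooth_map_bilinear[OF bounded_bilinear_pair o]) (use e c in \<open>auto simp: section_std_iff\<close>)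
  then show "smooth_map A (W \<inter> fst c) (\<lambda>x. pair (e1 x) (e2 x))"
    by (rule smooth_map_cong[OF o, rotated]) (simp add: std_pairing_triv[OF c])
qed

end

section \<open>Gluing\<close>

lemma lin_on_UNIV: "lin_on UNIV f \<longleftrightarrow> linear f"
  by (simp add: lin_on_def linear_iff)

lemma tangent_bundle_fiber: "fiber (tangent_bundle A) x = UNIV"
  by (simp add: tangent_bundle_def)

lemma (in smooth_manifold) dir_deriv_cong:
  assumes "open W" "p \<in> W" "\<And>x. x \<in> W \<Longrightarrow> f x = g x"
  shows "dir_deriv A f p = dir_deriv A g p"
proof -
  let ?c = "chart_at A p"
  have "FD (f \<circ> chart_inv ?c) (snd ?c p) = FD (g \<circ> chart_inv ?c) (snd ?c p)"
    by (rule FD_cong[OF open_chart_image[OF chart_at(1)[of p] assms(1)]])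
      (use assms(2,3) chart_at[of p] chart_image_inv[OF chart_at(1)[of p]] in auto)
  then show ?thesis by (simp add: dir_deriv_def fun_eq_iff)
qed

locale gluing_data = manifold_model A lb ip + D?: transitive_courant_data A lb ip U \<theta> B \<phi> \<tau> \<beta>
  for A :: "('m::{t2_space,second_countable_topology}, 'e::real_normed_vector) chart set"
    and lb :: "'g::real_normed_vector \<Rightarrow> 'g \<Rightarrow> 'g" and ip :: "'g \<Rightarrow> 'g \<Rightarrow> real"
    and U :: "'i \<Rightarrow> 'm set" and \<theta> B \<phi> \<tau> \<beta> +
  assumes U_open: "\<And>i. open (U i)" and U_cover: "(\<Union>i. U i) = UNIV"
begin

definition idx :: "'m \<Rightarrow> 'i" where "idx x = (SOME i. x \<in> U i)"

lemma idx: "x \<in> U (idx x)"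
proof -
  have "\<exists>i. x \<in> U i" using U_cover by blast
  then show ?thesis unfolding idx_def by (rule someI_ex)
qed

abbreviation G :: "'i \<Rightarrow> 'i \<Rightarrow> 'm \<Rightarrow> ('e, 'g) std_fiber \<Rightarrow> ('e, 'g) std_fiber" where
  "G i j \<equiv> gluing_map ip (\<phi> i j) (\<tau> i j) (\<beta> i j)"

text \<open>
  The fibre of the glued bundle over \<open>x\<close> is the standard fibre belonging to the chosen index
  \<open>idx x\<close>; \<open>\<Psi> i x\<close> is its identification with the standard fibre belonging to \<open>i\<close>.
\<close>

definition \<Psi> :: "'i \<Rightarrow> 'm \<Rightarrow> ('e, 'g) std_fiber \<Rightarrow> ('e, 'g) std_fiber" where
  "\<Psi> i x = G i (idx x) x"

section \<open>Transition maps and identifications with the local models\<close>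

lemma G_iso: "courant_iso A (U i \<inter> U j) (sections A (U i \<inter> U j) std) std std (G i j)"
  by (rule automorphism)

lemma linear_G: "x \<in> U i \<inter> U j \<Longrightarrow> linear (G i j x)"
  using G_iso[of i j] by (simp add: courant_iso_def bundle_map_def std_courant_simps lin_on_UNIV)

lemma bij_G: "x \<in> U i \<inter> U j \<Longrightarrow> bij (G i j x)"
  using G_iso[of i j] by (simp add: courant_iso_def std_courant_simps)

lemma pair_G: "x \<in> U i \<inter> U j \<Longrightarrow> pair (G i j x u) (G i j x v) = pair u v"
  using G_iso[of i j] unfolding courant_iso_def std_courant_simps by blast

lemma section_G:
  "open W \<Longrightarrow> W \<subseteq> U i \<inter> U j \<Longrightarrow> e \<in> sections A W std \<Longrightarrow> (\<lambda>x. G i j x (e x)) \<in> sections A W std"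
  using G_iso[of i j] unfolding courant_iso_def bundle_map_def by blast

lemma bracket_G:
  "x \<in> U i \<inter> U j \<Longrightarrow> e1 \<in> sections A (U i \<inter> U j) std \<Longrightarrow> e2 \<in> sections A (U i \<inter> U j) std \<Longrightarrow>
    G i j x (sbr e1 e2 x) = sbr (\<lambda>y. G i j y (e1 y)) (\<lambda>y. G i j y (e2 y)) x"
  using G_iso[of i j] unfolding courant_iso_def std_courant_simps by blast

lemma fst_G: "fst (G i j x u) = fst u"
  by (simp add: gluing_map_def split: prod.split)

text \<open>The cocycle condition with three equal indices makes the map idempotent, and an
  injective idempotent is the identity.\<close>

lemma G_self:
  assumes "x \<in> U i"
  shows "G i i x u = u"
proof -
  have "G i i x (G i i x u) = G i i x u" using cocycle[of x i i i u] assms by simp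
  then show ?thesis using bij_G[of x i i] assms by (simp add: bij_def inj_eq)
qed

lemma \<Psi>_idx: "\<Psi> (idx x) x u = u"
  unfolding \<Psi>_def by (rule G_self[OF idx])

lemma G_\<Psi>: "x \<in> U i \<inter> U j \<Longrightarrow> G i j x (\<Psi> j x u) = \<Psi> i x u"
  unfolding \<Psi>_def by (rule cocycle) (simp add: idx)

lemma linear_\<Psi>: "x \<in> U i \<Longrightarrow> linear (\<Psi> i x)"
  and bij_\<Psi>: "x \<in> U i \<Longrightarrow> bij (\<Psi> i x)"
  and pair_\<Psi>: "x \<in> U i \<Longrightarrow> pair (\<Psi> i x u) (\<Psi> i x v) = pair u v"
  and fst_\<Psi>: "fst (\<Psi> i x u) = fst u"
  unfolding \<Psi>_def by (simp_all add: linear_G bij_G pair_G fst_G idx)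

text \<open>One copy of the standard fibre at each point replaces a quotient of the disjoint union.
  The implied identification jumps with \<open>idx x\<close>, so smoothness is read through the
  \<open>\<Psi> i\<close>. Anchor and pairing carry no index because the transition maps preserve
  them; the bracket at \<open>x\<close> is computed in the patch chosen for
  \<open>x\<close>.\<close>

definition C :: "('m, ('e, 'g) std_fiber, ('e, 'g) std_fiber, 'e) courant" where
  "C = \<lparr>fiber = (\<lambda>_. UNIV),
     trivs = {(U i \<inter> fst c, \<lambda>x u. std_triv A c x (\<Psi> i x u)) |i c. c \<in> A},
     anchor = (\<lambda>_. fst),
     pairing = (\<lambda>_. pair),
     cbracket = (\<lambda>e1 e2 x. sbr (\<lambda>y. \<Psi> (idx x) y (e1 y)) (\<lambda>y. \<Psi> (idx x) y (e2 y)) x)\<rparr>"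

lemma C_simps: "fiber C x = UNIV" "anchor C x = fst" "pairing C x = pair"
  "cbracket C e1 e2 x = sbr (\<lambda>y. \<Psi> (idx x) y (e1 y)) (\<lambda>y. \<Psi> (idx x) y (e2 y)) x"
  "trivs C = {(U i \<inter> fst c, \<lambda>x u. std_triv A c x (\<Psi> i x u)) |i c. c \<in> A}"
  by (simp_all add: C_def)

lemma ball_trivs_C:
  "(\<forall>p\<in>trivs C. Q p) \<longleftrightarrow> (\<forall>i. \<forall>c\<in>A. Q (U i \<inter> fst c, \<lambda>x u. std_triv A c x (\<Psi> i x u)))"
  unfolding C_simps by blast

lemma section_C_iff:
  "e \<in> sections A W C \<longleftrightarrow> (\<forall>i. (\<lambda>x. \<Psi> i x (e x)) \<in> sections A (W \<inter> U i) std)"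
proof -
  have "e \<in> sections A W C \<longleftrightarrow> (\<forall>i. \<forall>c\<in>A. smooth_map A (W \<inter> (U i \<inter> fst c)) (\<lambda>x. std_triv A c x (\<Psi> i x (e x))))"
    unfolding sections_def mem_Collect_eq ball_trivs_C prod.case C_simps(1) by simp
  then show ?thesis unfolding section_std_iff Int_assoc .
qed

lemma section_\<Psi>: "e \<in> sections A UNIV C \<Longrightarrow> (\<lambda>x. \<Psi> i x (e x)) \<in> sections A (U i) std"
  using section_C_iff[of e UNIV] by simp

lemma vector_bundle_C: "vector_bundle A C"
  unfolding vector_bundle_def
proof (intro conjI)
  show "finite_dim TYPE(('e, 'g) std_fiber)" by (rule model_dim)
  show "\<forall>x. subspace (fiber C x)" by (simp add: C_simps)
  have bij: "bij (\<lambda>u. std_triv A c x (\<Psi> i x u))" if "c \<in> A" "x \<in> U i \<inter> fst c" for c i x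
    using bij_comp[OF bij_\<Psi> bij_std_triv[OF that(1)], of x i] that(2) by (simp add: o_def)
  have "linear (\<lambda>u. std_triv A c x (\<Psi> i x u))" if "c \<in> A" "x \<in> U i \<inter> fst c" for c i x
    using linear_compose[OF linear_\<Psi> linear_std_triv[OF that(1)], of x i] that(2) by (simp add: o_def)
  with bij show "\<forall>(V, t)\<in>trivs C. open V \<and> (\<forall>x\<in>V. lin_on (fiber C x) (t x) \<and> bij_betw (t x) (fiber C x) UNIV)"
    unfolding ball_trivs_C prod.case C_simps(1) lin_on_UNIV using U_open open_chart_dom open_Int by metis
  have "x \<in> (\<Union>(V, t)\<in>trivs C. V)" for x
  proof (rule UN_I)
    show "(U (idx x) \<inter> fst (chart_at A x), \<lambda>y u. std_triv A (chart_at A x) y (\<Psi> (idx x) y u)) \<in> trivs C"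
      unfolding C_simps using chart_at(1)[of x] by blast
  qed (simp add: idx chart_at)
  then show "(\<Union>(V, t)\<in>trivs C. V) = UNIV" by blast
  \<comment> \<open>A fixed \<open>w\<close> comes back through the trivialization of
    \<open>i\<close> and \<open>c\<close> as a section of constant coordinates in patch
    \<open>i\<close>. The map \<open>G j i\<close> carries it to patch \<open>j\<close>, and
    automorphisms preserve smooth sections.\<close>
  have "smooth_map A ((U i \<inter> fst c) \<inter> (U j \<inter> fst c'))
      (\<lambda>x. std_triv A c' x (\<Psi> j x (inv_into UNIV (\<lambda>u. std_triv A c x (\<Psi> i x u)) w)))"
    if c: "c \<in> A" "c' \<in> A" for i j c c' w
  proof -
    let ?W = "U j \<inter> U i"
    have W: "open ?W" using U_open by blast
    have o: "open (?W \<inter> fst c)" using W open_chart_dom[OF c(1)] by blast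
    have "(\<lambda>x. G j i x (std_triv_inv A c x w)) \<in> sections A (?W \<inter> fst c) std"
      by (rule section_G[OF o _ section_std_triv_inv[OF c(1) W]]) blast
    then have "smooth_map A ((?W \<inter> fst c) \<inter> fst c') (\<lambda>x. std_triv A c' x (G j i x (std_triv_inv A c x w)))"
      using c(2) unfolding section_std_iff by blast
    then show ?thesis
    proof (rule smooth_map_cong[rotated 2, OF smooth_map_subset])
      show "open ((U i \<inter> fst c) \<inter> (U j \<inter> fst c'))"
        by (intro open_Int U_open open_chart_dom c)
      fix x assume x: "x \<in> (U i \<inter> fst c) \<inter> (U j \<inter> fst c')"
      let ?t = "\<lambda>u. std_triv A c x (\<Psi> i x u)"
      have b: "bij ?t" using bij[OF c(1)] x by blast
      then obtain u where u: "?t u = w" by (metis bij_pointE)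
      have "inv_into UNIV ?t w = u" unfolding u[symmetric] by (rule inv_f_f[OF bij_is_inj[OF b]])
      moreover have "std_triv_inv A c x w = \<Psi> i x u"
        using x unfolding u[symmetric] by (simp add: std_triv_inv_std_triv[OF c(1)])
      ultimately show "std_triv A c' x (G j i x (std_triv_inv A c x w))
        = std_triv A c' x (\<Psi> j x (inv_into UNIV ?t w))"
        using x by (simp add: G_\<Psi>)
    qed blast
  qed
  then show "\<forall>(V, t)\<in>trivs C. \<forall>(V', t')\<in>trivs C. \<forall>w.
      smooth_map A (V \<inter> V') (\<lambda>x. t' x (inv_into (fiber C x) (t x) w))"
    unfolding ball_trivs_C prod.case C_simps(1) by blast
qed

text \<open>Independence of the chosen index: the bracket at \<open>x\<close> is defined in the
  patch of \<open>idx x\<close>, and the transition map to patch \<open>i\<close> preserves brackets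
  of sections over the overlap. Locality then replaces the transported sections by their expressions
  in patch \<open>i\<close>.\<close>

lemma \<Psi>_bracket:
  assumes e: "e1 \<in> sections A UNIV C" "e2 \<in> sections A UNIV C" and x: "x \<in> U i"
  shows "\<Psi> i x (cbracket C e1 e2 x) = sbr (\<lambda>y. \<Psi> i y (e1 y)) (\<lambda>y. \<Psi> i y (e2 y)) x"
proof -
  let ?j = "idx x"
  let ?W = "U i \<inter> U ?j"
  have W: "open ?W" "x \<in> ?W" using U_open x idx by auto
  have s: "(\<lambda>y. \<Psi> ?j y (e y)) \<in> sections A ?W std" if "e \<in> sections A UNIV C" for e
    by (rule section_subset[OF M.smooth_manifold_axioms section_\<Psi>[OF that]]) blast
  have "\<Psi> i x (cbracket C e1 e2 x) = G i ?j x (sbr (\<lambda>y. \<Psi> ?j y (e1 y)) (\<lambda>y. \<Psi> ?j y (e2 y)) x)"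
    by (simp add: C_simps \<Psi>_def)
  also have "\<dots> = sbr (\<lambda>y. G i ?j y (\<Psi> ?j y (e1 y))) (\<lambda>y. G i ?j y (\<Psi> ?j y (e2 y))) x"
    by (rule bracket_G[OF W(2) s[OF e(1)] s[OF e(2)]])
  also have "\<dots> = sbr (\<lambda>y. \<Psi> i y (e1 y)) (\<lambda>y. \<Psi> i y (e2 y)) x"
    by (rule std_bracket_cong[OF W section_G[OF W(1) order_refl s[OF e(1)]] section_G[OF W(1) order_refl s[OF e(2)]]])
      (simp_all add: G_\<Psi>)
  finally show ?thesis .
qed

lemma bracket_section:
  assumes e: "e1 \<in> sections A UNIV C" "e2 \<in> sections A UNIV C"
  shows "cbracket C e1 e2 \<in> sections A UNIV C"
  unfolding section_C_iff
proof
  fix i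
  show "(\<lambda>x. \<Psi> i x (cbracket C e1 e2 x)) \<in> sections A (UNIV \<inter> U i) std"
    using section_std_cong[OF U_open \<Psi>_bracket[OF e, symmetric]
      std_bracket_sections[OF U_open section_\<Psi>[OF e(1)] section_\<Psi>[OF e(2)]]] by simp
qed

lemma smooth_map_cover:
  assumes "open W" "\<And>i. smooth_map A (W \<inter> U i) f"
  shows "smooth_map A W f"
proof (rule smooth_map_local)
  fix x assume "x \<in> W"
  then show "\<exists>V. open V \<and> x \<in> V \<and> smooth_map A V f"
    using assms idx[of x] U_open by (intro exI[of _ "W \<inter> U (idx x)"]) auto
qed

lemma anchor_bundle_map: "bundle_map A UNIV C (tangent_bundle A) (anchor C)"
  unfolding bundle_map_def
proof (intro conjI ballI allI impI)
  show "lin_on (fiber C x) (anchor C x)" for x by (simp add: C_simps lin_on_UNIV linear_fst)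
  show "anchor C x ` fiber C x \<subseteq> fiber (tangent_bundle A) x" for x by (simp add: tangent_bundle_fiber)
  fix W e assume W: "open W" and e: "e \<in> sections A W C"
  have "(\<lambda>x. fst (e x)) \<in> sections A (W \<inter> U i) (tangent_bundle A)" for i
  proof -
    have "(\<lambda>x. \<Psi> i x (e x)) \<in> sections A (W \<inter> U i) std" using e section_C_iff by blast
    then have "(\<lambda>x. fst (\<Psi> i x (e x))) \<in> sections A (W \<inter> U i) (tangent_bundle A)"
      using section_std_components[OF open_Int[OF W U_open], of "\<lambda>x. \<Psi> i x (e x)" i lb ip] by blast
    then show ?thesis by (simp only: fst_\<Psi>)
  qed
  then have "smooth_map A ((W \<inter> fst c) \<inter> U i) (\<lambda>x. tcoord A c x (fst (e x)))" if "c \<in> A" for c i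
    using that unfolding section_tangent_iff by (simp add: Int_ac)
  then show "(\<lambda>x. anchor C x (e x)) \<in> sections A W (tangent_bundle A)"
    unfolding section_tangent_iff C_simps
    using smooth_map_cover[OF open_Int[OF W open_chart_dom]] by blast
qed

lemma courant_algebroid_C: "transitive_courant_algebroid A C"
proof unfold_locales
  show "vector_bundle A C" by (rule vector_bundle_C)
  show "bundle_map A UNIV C (tangent_bundle A) (anchor C)" by (rule anchor_bundle_map)
  show "lin_on (fiber C x) (pairing C x u)" for u x
    using bilinear_pair unfolding bilinear_def C_simps lin_on_UNIV by blast
  show "pairing C x u v = pairing C x v u" for u v x by (simp add: C_simps pair_sym)
  show "\<forall>v\<in>fiber C x. pairing C x u v = 0 \<Longrightarrow> u = 0" for u x
    using pair_nondegenerate unfolding C_simps by blast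
  show "anchor C x ` fiber C x = UNIV" for x by (auto simp: C_simps image_def)
  show "smooth_map A W (\<lambda>x. pairing C x (e1 x) (e2 x))"
    if W: "open W" and e: "e1 \<in> sections A W C" "e2 \<in> sections A W C" for W e1 e2
  proof (rule smooth_map_cover[OF W])
    fix i
    have o: "open (W \<inter> U i)" using W U_open by blast
    have "smooth_map A (W \<inter> U i) (\<lambda>x. pair (\<Psi> i x (e1 x)) (\<Psi> i x (e2 x)))"
      by (rule smooth_map_pair[OF o]) (use e section_C_iff in blast)+
    then show "smooth_map A (W \<inter> U i) (\<lambda>x. pairing C x (e1 x) (e2 x))"
      by (rule smooth_map_cong[OF o, rotated]) (simp add: C_simps pair_\<Psi>)
  qed
next
  fix e1 e2 assume e: "e1 \<in> sections A UNIV C" "e2 \<in> sections A UNIV C"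
  show "cbracket C e1 e2 \<in> sections A UNIV C" by (rule bracket_section[OF e])
  fix x
  \<comment> \<open>With this index the bracket of \<open>C\<close> at \<open>x\<close> is by
    definition a standard bracket over \<open>U ?i\<close>, so the axiom reduces to its standard
    version.\<close>
  let ?i = "idx x"
  note W = U_open[of ?i] idx[of x]
  note s = section_\<Psi>[where i = ?i]
  show "pairing C x (cbracket C e1 e1 x) (e2 x)
    = 1/2 * dir_deriv A (\<lambda>y. pairing C y (e1 y) (e1 y)) x (anchor C x (e2 x))"
    using std_bracket_diag[OF W s[OF e(1)], of "e2 x"]
      dir_deriv_cong[OF W, of "\<lambda>y. pair (\<Psi> ?i y (e1 y)) (\<Psi> ?i y (e1 y))" "\<lambda>y. pair (e1 y) (e1 y)"]
    by (simp add: C_simps pair_\<Psi>)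
next
  fix e1 e2 e3 x
  assume e: "e1 \<in> sections A UNIV C" "e2 \<in> sections A UNIV C" "e3 \<in> sections A UNIV C"
  let ?i = "idx x"
  note W = U_open[of ?i] idx[of x]
  note s = section_\<Psi>[where i = ?i]
  note s1 = s[OF e(1)] and s2 = s[OF e(2)] and s3 = s[OF e(3)]
  \<comment> \<open>Linearity of the identification is available over \<open>U ?i\<close> only and
    enters the arguments of the bracket by locality.\<close>
  have lin: "sbr (\<lambda>y. \<Psi> ?i y (r *\<^sub>R f y + g y)) h x = sbr (\<lambda>y. r *\<^sub>R \<Psi> ?i y (f y) + \<Psi> ?i y (g y)) h x"
      "sbr h (\<lambda>y. \<Psi> ?i y (r *\<^sub>R f y + g y)) x = sbr h (\<lambda>y. r *\<^sub>R \<Psi> ?i y (f y) + \<Psi> ?i y (g y)) x"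
    if f: "f \<in> sections A UNIV C" "g \<in> sections A UNIV C" and h: "h \<in> sections A (U ?i) std" for f g h r
  proof -
    note L = section_lincomb[OF W(1) s[OF f(1)] s[OF f(2)], of r]
    have eq: "r *\<^sub>R \<Psi> ?i y (f y) + \<Psi> ?i y (g y) = \<Psi> ?i y (r *\<^sub>R f y + g y)" if "y \<in> U ?i" for y
      using linear_\<Psi>[OF that] by (simp add: linear_add linear_scale)
    show "sbr (\<lambda>y. \<Psi> ?i y (r *\<^sub>R f y + g y)) h x = sbr (\<lambda>y. r *\<^sub>R \<Psi> ?i y (f y) + \<Psi> ?i y (g y)) h x"
      by (rule std_bracket_cong[OF W L h eq refl, symmetric])
    show "sbr h (\<lambda>y. \<Psi> ?i y (r *\<^sub>R f y + g y)) x = sbr h (\<lambda>y. r *\<^sub>R \<Psi> ?i y (f y) + \<Psi> ?i y (g y)) x"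
      by (rule std_bracket_cong[OF W h L refl eq, symmetric])
  qed
  show "cbracket C e1 (\<lambda>x. r *\<^sub>R e2 x + e3 x) x = r *\<^sub>R cbracket C e1 e2 x + cbracket C e1 e3 x" for r
    unfolding C_simps lin(2)[OF e(2,3) s1] by (rule std_bracket_linear_right[OF W s1 s2 s3])
  show "cbracket C (\<lambda>x. r *\<^sub>R e1 x + e2 x) e3 x = r *\<^sub>R cbracket C e1 e3 x + cbracket C e2 e3 x" for r
    unfolding C_simps lin(1)[OF e(1,2) s3] by (rule std_bracket_linear_left[OF W s1 s2 s3])
  \<comment> \<open>The inner bracket is evaluated at points \<open>y\<close> with their own
    \<open>idx y\<close>; \<open>\<Psi>_bracket\<close> rewrites it in the fixed patch
    \<open>?i\<close>.\<close>
  have nest: "sbr h (\<lambda>y. \<Psi> ?i y (cbracket C f g y)) x = sbr h (sbr (\<lambda>y. \<Psi> ?i y (f y)) (\<lambda>y. \<Psi> ?i y (g y))) x"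
    "sbr (\<lambda>y. \<Psi> ?i y (cbracket C f g y)) h x = sbr (sbr (\<lambda>y. \<Psi> ?i y (f y)) (\<lambda>y. \<Psi> ?i y (g y))) h x"
    if f: "f \<in> sections A UNIV C" "g \<in> sections A UNIV C" and h: "h \<in> sections A (U ?i) std" for f g h
  proof -
    note S = s[OF bracket_section[OF f]]
    show "sbr h (\<lambda>y. \<Psi> ?i y (cbracket C f g y)) x = sbr h (sbr (\<lambda>y. \<Psi> ?i y (f y)) (\<lambda>y. \<Psi> ?i y (g y))) x"
      by (rule std_bracket_cong[OF W h S refl \<Psi>_bracket[OF f]])
    show "sbr (\<lambda>y. \<Psi> ?i y (cbracket C f g y)) h x = sbr (sbr (\<lambda>y. \<Psi> ?i y (f y)) (\<lambda>y. \<Psi> ?i y (g y))) h x"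
      by (rule std_bracket_cong[OF W S h]) (simp_all add: \<Psi>_bracket[OF f])
  qed
  show "cbracket C e1 (cbracket C e2 e3) x = cbracket C (cbracket C e1 e2) e3 x + cbracket C e2 (cbracket C e1 e3) x"
    unfolding C_simps(4)[of e1 "cbracket C e2 e3"] C_simps(4)[of "cbracket C e1 e2" e3] C_simps(4)[of e2 "cbracket C e1 e3"]
      nest(1)[OF e(2,3) s1] nest(1)[OF e(1,3) s2] nest(2)[OF e(1,2) s3]
    by (rule std_bracket_leibniz[OF W s1 s2 s3])
  show "dir_deriv A (\<lambda>y. pairing C y (e2 y) (e3 y)) x (anchor C x (e1 x))
    = pairing C x (cbracket C e1 e2 x) (e3 x) + pairing C x (e2 x) (cbracket C e1 e3 x)"
    using std_bracket_invariant[OF W s1 s2 s3]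
      dir_deriv_cong[OF W, of "\<lambda>y. pair (\<Psi> ?i y (e2 y)) (\<Psi> ?i y (e3 y))" "\<lambda>y. pair (e2 y) (e3 y)"]
    by (simp add: C_simps pair_\<Psi> \<Psi>_idx)
qed

end

section \<open>The connection\<close>

context gluing_data
begin

lemma linear_\<theta>: "x \<in> U i \<Longrightarrow> linear (\<theta> i x)"
  using \<theta>_form[of i] by (simp add: one_form_def bundle_map_def tangent_bundle_fiber lin_on_UNIV)

lemma linear_B: "x \<in> U i \<Longrightarrow> linear (B i x)"
  using B_form[of i] by (simp add: two_form_def bundle_map_def tangent_bundle_fiber lin_on_UNIV)

lemma linear_\<phi>: "x \<in> U i \<inter> U j \<Longrightarrow> linear (\<phi> i j x)"
  using \<phi>_map[of i j] by (simp add: bundle_map_def tangent_bundle_fiber lin_on_UNIV)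

lemma B_skew:
  assumes "x \<in> U i"
  shows "blinfun_apply (B i x v) w = - blinfun_apply (B i x w) v"
proof -
  have "blinfun_apply (B i x u) u = 0" for u
    using B_form[of i] assms by (simp add: two_form_def)
  from this[of "v + w"] this[of v] this[of w] show ?thesis
    using linear_add[OF linear_B[OF assms]] by (simp add: blinfun.add_left blinfun.add_right)
qed

lemma star_apply:
  fixes f :: "'e \<Rightarrow> 'g"
  assumes "linear f"
  shows "blinfun_apply (star ip f a) v = ip a (f v)"
  unfolding star_def
  by (simp add: bounded_linear_Blinfun_apply[OF bounded_linear_compose[OF
    bounded_bilinear.bounded_linear_right[OF bounded_bilinear_ip] linear_imp_bounded_linear[OF base_dim assms]]])

text \<open>The last term makes the section isotropic: in the pairing of two values the B terms
  cancel by skewness, and the halves of the two star terms add up to minus the product of the middle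
  components.\<close>

definition s_loc :: "'i \<Rightarrow> 'm \<Rightarrow> 'e \<Rightarrow> ('e, 'g) std_fiber" where
  "s_loc i x v = (v, \<theta> i x v, - B i x v - star ip (\<theta> i x) (\<theta> i x v))"

text \<open>The factor 2 offsets the 1/2 in the pairing, so that the covector cancels the product of
  \<open>a\<close> with the middle component of \<open>s_loc\<close>.\<close>

definition \<sigma>_loc :: "'i \<Rightarrow> 'm \<Rightarrow> 'g \<Rightarrow> ('e, 'g) std_fiber" where
  "\<sigma>_loc i x a = (0, a, - 2 *\<^sub>R star ip (\<theta> i x) a)"

text \<open>The compatibility conditions for \<theta> and \<open>B\<close> are precisely the middle
  and the covector component of this equation.\<close>

lemma G_s_loc:
  assumes "x \<in> U i \<inter> U j"
  shows "G i j x (s_loc j x v) = s_loc i x v"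
proof -
  have "\<beta> i j x v - 2 *\<^sub>R star ip (\<phi> i j x) (\<tau> i j x (\<theta> j x v)) + (- B j x v - star ip (\<theta> j x) (\<theta> j x v))
    = - B i x v - star ip (\<theta> i x) (\<theta> i x v)"
    using B_compatible[OF assms, of v] by (simp add: algebra_simps)
  then show ?thesis
    using \<theta>_compatible[OF assms, of v] by (simp add: s_loc_def gluing_map_def add.commute)
qed

text \<open>By orthogonality of \<tau>, pairing \<tau> a with \<theta> of index \<open>i\<close>
  splits into its pairing with \<phi> and that of \<open>a\<close> with \<theta> of index
  \<open>j\<close>. The first part is the covector that the gluing map produces.\<close>

lemma G_\<sigma>_loc:
  assumes x: "x \<in> U i \<inter> U j" and u: "fst u = 0"
  shows "G i j x (\<sigma>_loc j x (fst (snd u))) = \<sigma>_loc i x (fst (snd (G i j x u)))"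
proof -
  have xi: "x \<in> U i" "x \<in> U j" using x by auto
  have z: "\<phi> i j x 0 = 0" by (rule linear_0[OF linear_\<phi>[OF x]])
  have b: "\<beta> i j x 0 = 0"
    using \<beta>_map[of i j] x by (simp add: bundle_map_def tangent_bundle_fiber lin_on_UNIV linear_0)
  have "ip (\<tau> i j x a) (\<theta> i x v) = ip (\<tau> i j x a) (\<phi> i j x v) + ip a (\<theta> j x v)" for a v
    by (simp add: \<theta>_compatible[OF x] bilinear_radd[OF ip_bilinear] \<tau>_orthogonal[OF x])
  then have "star ip (\<theta> i x) (\<tau> i j x a) = star ip (\<phi> i j x) (\<tau> i j x a) + star ip (\<theta> j x) a" for a
    by (intro blinfun_eqI) (simp add: star_apply[OF linear_\<theta>[OF xi(1)]] star_apply[OF linear_\<theta>[OF xi(2)]]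
      star_apply[OF linear_\<phi>[OF x]] blinfun.add_left)
  note star = this
  obtain a \<xi> where "u = (0, a, \<xi>)" using u by (metis prod.collapse)
  then show ?thesis
    by (simp add: \<sigma>_loc_def gluing_map_def z b star scaleR_add_right)
qed

definition s :: "'m \<Rightarrow> 'e \<Rightarrow> ('e, 'g) std_fiber" where
  "s x = s_loc (idx x) x"

text \<open>Any representative of the coset serves: the middle component, on which alone the value
  depends, is constant on a class by \<open>g_class_C\<close>.\<close>

definition \<sigma> :: "'m \<Rightarrow> ('e, 'g) std_fiber set \<Rightarrow> ('e, 'g) std_fiber" where
  "\<sigma> x K = \<sigma>_loc (idx x) x (fst (snd (SOME u. u \<in> K)))"

lemma \<Psi>_s: "x \<in> U i \<Longrightarrow> \<Psi> i x (s x v) = s_loc i x v"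
  unfolding \<Psi>_def s_def by (rule G_s_loc) (simp add: idx)

lemma ker_anchor_C: "ker_anchor C x = {u. fst u = 0}"
  by (simp add: ker_anchor_def C_simps)

lemma ker_perp_C: "ker_perp C x = {u. fst u = 0 \<and> fst (snd u) = 0}"
proof -
  have "fst u = 0 \<and> fst (snd u) = 0" if u: "\<And>w. fst w = 0 \<Longrightarrow> pair u w = 0" for u
  proof -
    \<comment> \<open>Dropping the covector of \<open>u\<close> has the same effect as dropping the
      tangent part of \<open>w\<close>, which places \<open>w\<close> in the kernel; nondegeneracy
      on the full fibre then applies.\<close>
    have "pair (fst u, fst (snd u), 0) w = 0" for w
      using u[of "(0, snd w)"] by (simp add: std_pairing_def)
    then have "(fst u, fst (snd u), 0) = (0 :: ('e, 'g) std_fiber)" by (rule pair_nondegenerate)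
    then show ?thesis by (simp add: zero_prod_def)
  qed
  moreover have "pair u w = 0" if "fst u = 0 \<and> fst (snd u) = 0" "fst w = 0" for u w
    using that by (simp add: std_pairing_def bilinear_lzero[OF ip_bilinear])
  ultimately show ?thesis unfolding ker_perp_def ker_anchor_C C_simps by blast
qed

lemma g_class_C: "fst u = 0 \<Longrightarrow> g_class C x u = {w. fst w = 0 \<and> fst (snd w) = fst (snd u)}"
  by (auto simp: g_class_def ker_anchor_C ker_perp_C)

lemma \<sigma>_g_class:
  assumes "fst u = 0"
  shows "\<sigma> x (g_class C x u) = \<sigma>_loc (idx x) x (fst (snd u))"
proof -
  have "u \<in> g_class C x u" by (simp add: g_class_C assms)
  from someI[where P = "\<lambda>w. w \<in> g_class C x u", OF this]
  have "fst (snd (SOME w. w \<in> g_class C x u)) = fst (snd u)"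
    by (simp add: g_class_C[OF assms])
  then show ?thesis by (simp add: \<sigma>_def)
qed

lemma \<Psi>_\<sigma>_loc:
  assumes "x \<in> U i" "fst u = 0"
  shows "\<Psi> i x (\<sigma>_loc (idx x) x (fst (snd u))) = \<sigma>_loc i x (fst (snd (\<Psi> i x u)))"
  unfolding \<Psi>_def by (rule G_\<sigma>_loc) (use assms idx in auto)

lemma smooth_map_\<theta>:
  "open W \<Longrightarrow> W \<subseteq> U i \<Longrightarrow> X \<in> sections A W (tangent_bundle A) \<Longrightarrow> smooth_map A W (\<lambda>x. \<theta> i x (X x))"
  using \<theta>_form[of i] unfolding one_form_def bundle_map_def section_trivial_iff by blast

lemma section_star_\<theta>:
  assumes W: "open W" "W \<subseteq> U i" and a: "smooth_map A W a"
  shows "(\<lambda>x. star ip (\<theta> i x) (a x)) \<in> sections A W (cotangent_bundle A)"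
proof (rule section_cotangentI[OF W(1)])
  fix c w assume c: "c \<in> A"
  have o: "open (W \<inter> fst c)" using W open_chart_dom[OF c] by blast
  have "smooth_map A (W \<inter> fst c) (\<lambda>x. ip (a x) (\<theta> i x (chart_field A c w x)))"
    by (rule smooth_map_bilinear[OF bounded_bilinear_ip o smooth_map_subset[OF a]
      smooth_map_\<theta>[OF o _ section_chart_field[OF c]]]) (use W in auto)
  then show "smooth_map A (W \<inter> fst c) (\<lambda>x. blinfun_apply (star ip (\<theta> i x) (a x)) (chart_field A c w x))"
    by (rule smooth_map_cong[OF o, rotated]) (use W in \<open>auto simp: star_apply linear_\<theta>\<close>)
qed

lemma section_cotangent_lincomb:
  assumes W: "open W" and \<xi>: "\<xi> \<in> sections A W (cotangent_bundle A)" and \<eta>: "\<eta> \<in> sections A W (cotangent_bundle A)"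
  shows "(\<lambda>x. r *\<^sub>R \<xi> x + t *\<^sub>R \<eta> x) \<in> sections A W (cotangent_bundle A)"
proof (rule section_cotangentI[OF W])
  fix c w assume c: "c \<in> A"
  have o: "open (W \<inter> fst c)" using W open_chart_dom[OF c] by blast
  have sm: "smooth_map A (W \<inter> fst c) (\<lambda>x. k *\<^sub>R blinfun_apply (\<zeta> x) (chart_field A c w x))"
    if "\<zeta> \<in> sections A W (cotangent_bundle A)" for \<zeta> and k
    by (rule smooth_map_linear[OF bounded_linear_scaleR_right o smooth_map_cotangent_apply[OF o
      section_subset[OF M.smooth_manifold_axioms that] section_chart_field[OF c]]]) blast
  show "smooth_map A (W \<inter> fst c) (\<lambda>x. blinfun_apply (r *\<^sub>R \<xi> x + t *\<^sub>R \<eta> x) (chart_field A c w x))"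
    using smooth_map_add[OF o sm[OF \<xi>] sm[OF \<eta>]] by (simp add: blinfun.add_left blinfun.scaleR_left)
qed

lemma section_s_loc:
  assumes W: "open W" "W \<subseteq> U i" and X: "X \<in> sections A W (tangent_bundle A)"
  shows "(\<lambda>x. s_loc i x (X x)) \<in> sections A W std"
proof -
  note \<theta> = smooth_map_\<theta>[OF W X]
  have "(\<lambda>x. B i x (X x)) \<in> sections A W (cotangent_bundle A)"
    using B_form[of i] W X unfolding two_form_def bundle_map_def by blast
  from section_cotangent_lincomb[OF W(1) this section_star_\<theta>[OF W \<theta>], of "-1" "-1"]
  show ?thesis unfolding section_std_components[OF W(1)] s_loc_def using X \<theta> by simp
qed

lemma section_\<sigma>_loc:
  assumes W: "open W" "W \<subseteq> U i" and a: "smooth_map A W a"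
  shows "(\<lambda>x. \<sigma>_loc i x (a x)) \<in> sections A W std"
proof -
  have "(\<lambda>x. 0) \<in> sections A W (tangent_bundle A)"
    unfolding section_tangent_iff
  proof
    fix c assume c: "c \<in> A"
    have o: "open (W \<inter> fst c)" using W open_chart_dom[OF c] by blast
    show "smooth_map A (W \<inter> fst c) (\<lambda>x. tcoord A c x 0)"
      by (rule smooth_map_cong[OF o _ smooth_map_const]) (simp add: linear_0[OF linear_tcoord[OF c]])
  qed
  \<comment> \<open>A single covector field is to be scaled by -2; the second slot of the linear
    combination is filled with coefficient 0.\<close>
  then show ?thesis
    using section_cotangent_lincomb[OF W(1) section_star_\<theta>[OF W a] section_star_\<theta>[OF W a], of "-2" 0] a
    unfolding section_std_components[OF W(1)] \<sigma>_loc_def by simp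
qed

lemma courant_connection_C: "courant_connection A C s \<sigma>"
proof unfold_locales
  fix x
  note xi = idx[of x]
  note \<theta>lin = linear_\<theta>[OF xi]
  show "anchor C x (s x v) = v" for v by (simp add: C_simps s_def s_loc_def)
  show "pairing C x (s x v) (s x w) = 0" for v w
    by (simp add: C_simps s_def s_loc_def std_pairing_def blinfun.diff_left blinfun.minus_left star_apply[OF \<theta>lin]
      B_skew[OF xi, of v w] ip_sym[of "\<theta> (idx x) x w"])
  show "\<sigma> x (g_class C x u) \<in> g_class C x u" if "u \<in> ker_anchor C x" for u
  proof -
    have u: "fst u = 0" using that by (simp add: ker_anchor_C)
    have "\<sigma>_loc (idx x) x (fst (snd u)) \<in> g_class C x u"
      unfolding g_class_C[OF u] by (simp add: \<sigma>_loc_def)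
    then show ?thesis by (simp only: \<sigma>_g_class[OF u])
  qed
  have star_lin: "star ip (\<theta> (idx x) x) (a + b) = star ip (\<theta> (idx x) x) a + star ip (\<theta> (idx x) x) b"
    "star ip (\<theta> (idx x) x) (r *\<^sub>R a) = r *\<^sub>R star ip (\<theta> (idx x) x) a" for a b r
    by (auto intro!: blinfun_eqI simp: star_apply[OF \<theta>lin] blinfun.add_left blinfun.scaleR_left
      bilinear_ladd[OF ip_bilinear] bilinear_lmul[OF ip_bilinear])
  show "lin_on (ker_anchor C x) (\<lambda>u. \<sigma> x (g_class C x u))"
    unfolding lin_on_def ker_anchor_C by (simp add: \<sigma>_g_class) (simp add: \<sigma>_loc_def star_lin scaleR_add_right)
  show "pairing C x (s x v) (\<sigma> x (g_class C x u)) = 0" if "u \<in> ker_anchor C x" for u v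
    using that by (simp add: ker_anchor_C \<sigma>_g_class C_simps)
      (simp add: s_def s_loc_def \<sigma>_loc_def std_pairing_def star_apply[OF \<theta>lin] blinfun.minus_left blinfun.scaleR_left ip_sym)
next
  show "bundle_map A UNIV (tangent_bundle A) C s"
    unfolding bundle_map_def
  proof (intro conjI ballI allI impI)
    fix x
    note \<theta>lin = linear_\<theta>[OF idx[of x]] and Blin = linear_B[OF idx[of x]]
    show "lin_on (fiber (tangent_bundle A) x) (s x)"
      unfolding tangent_bundle_fiber lin_on_UNIV
    proof (rule linearI)
      note lin = linear_add[OF \<theta>lin] linear_scale[OF \<theta>lin] linear_add[OF Blin] linear_scale[OF Blin]
      show "s x (u + v) = s x u + s x v" for u v
        by (auto simp: s_def s_loc_def lin intro!: blinfun_eqI)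
          (simp add: star_apply[OF \<theta>lin] blinfun.add_left blinfun.diff_left blinfun.minus_left bilinear_ladd[OF ip_bilinear])
      show "s x (r *\<^sub>R v) = r *\<^sub>R s x v" for r v
        by (auto simp: s_def s_loc_def lin intro!: blinfun_eqI)
          (simp add: star_apply[OF \<theta>lin] blinfun.scaleR_left blinfun.diff_left blinfun.minus_left bilinear_lmul[OF ip_bilinear] algebra_simps)
    qed
    show "s x ` fiber (tangent_bundle A) x \<subseteq> fiber C x" by (simp add: C_simps)
  next
    fix W e assume W: "open W" and e: "e \<in> sections A W (tangent_bundle A)"
    show "(\<lambda>x. s x (e x)) \<in> sections A W C"
      unfolding section_C_iff
    proof
      fix i
      have o: "open (W \<inter> U i)" using W U_open by blast
      have "(\<lambda>x. s_loc i x (e x)) \<in> sections A (W \<inter> U i) std"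
        by (rule section_s_loc[OF o _ section_subset[OF M.smooth_manifold_axioms e]]) auto
      then show "(\<lambda>x. \<Psi> i x (s x (e x))) \<in> sections A (W \<inter> U i) std"
        by (rule section_std_cong[OF o, rotated]) (simp add: \<Psi>_s)
    qed
  qed
next
  fix W e assume W: "open W" and e: "e \<in> sections A W C" and ker: "\<forall>x\<in>W. e x \<in> ker_anchor C x"
  show "(\<lambda>x. \<sigma> x (g_class C x (e x))) \<in> sections A W C"
    unfolding section_C_iff
  proof
    fix i
    have o: "open (W \<inter> U i)" using W U_open by blast
    have "(\<lambda>x. \<Psi> i x (e x)) \<in> sections A (W \<inter> U i) std" using e section_C_iff by blast
    then have "smooth_map A (W \<inter> U i) (\<lambda>x. fst (snd (\<Psi> i x (e x))))"
      using section_std_components[OF o, of "\<lambda>x. \<Psi> i x (e x)" lb ip] by blast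
    then have "(\<lambda>x. \<sigma>_loc i x (fst (snd (\<Psi> i x (e x))))) \<in> sections A (W \<inter> U i) std"
      by (rule section_\<sigma>_loc[OF o, rotated]) simp
    then show "(\<lambda>x. \<Psi> i x (\<sigma> x (g_class C x (e x)))) \<in> sections A (W \<inter> U i) std"
      by (rule section_std_cong[OF o, rotated])
        (use ker in \<open>simp add: ker_anchor_C \<sigma>_g_class \<Psi>_\<sigma>_loc\<close>)
  qed
qed

lemma arises_from_data_C: "arises_from_data A lb ip U \<theta> B \<phi> \<tau> \<beta> C s"
  unfolding arises_from_data_def
proof (intro exI[of _ \<Psi>] conjI allI ballI)
  show "\<Psi> i x e = G i j x (\<Psi> j x e)" if "x \<in> U i \<inter> U j" for i j x e using G_\<Psi>[OF that] by simp
  show "\<Psi> i x (s x v) = (v, \<theta> i x v, - B i x v - star ip (\<theta> i x) (\<theta> i x v))" if "x \<in> U i" for i x v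
    using \<Psi>_s[OF that] by (simp add: s_loc_def)
  fix i
  show "courant_iso A (U i) (sections A UNIV C) C std (\<Psi> i)"
    unfolding courant_iso_def bundle_map_def C_simps(1-3) std_courant_simps lin_on_UNIV
  proof (intro conjI ballI allI impI)
    show "(\<lambda>x. \<Psi> i x (e x)) \<in> sections A W std" if "W \<subseteq> U i" "e \<in> sections A W C" for W e
    proof -
      have "W \<inter> U i = W" using that(1) by blast
      moreover have "(\<lambda>x. \<Psi> i x (e x)) \<in> sections A (W \<inter> U i) std"
        using that(2) section_C_iff by blast
      ultimately show ?thesis by (simp only:)
    qed
  qed (simp_all add: linear_\<Psi> bij_\<Psi> fst_\<Psi> pair_\<Psi> \<Psi>_bracket)
qed

end

theorem proposition4p4:
  fixes A :: "('m::{t2_space,second_countable_topology}, 'e::real_normed_vector) chart set"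
    and lb :: "'g::real_normed_vector \<Rightarrow> 'g \<Rightarrow> 'g"
    and ip :: "'g \<Rightarrow> 'g \<Rightarrow> real"
    and U :: "'i \<Rightarrow> 'm set"
    and \<theta> :: "'i \<Rightarrow> 'm \<Rightarrow> 'e \<Rightarrow> 'g"
    and B :: "'i \<Rightarrow> 'm \<Rightarrow> 'e \<Rightarrow> ('e \<Rightarrow>\<^sub>L real)"
    and \<phi> :: "'i \<Rightarrow> 'i \<Rightarrow> 'm \<Rightarrow> 'e \<Rightarrow> 'g"
    and \<tau> :: "'i \<Rightarrow> 'i \<Rightarrow> 'm \<Rightarrow> 'g \<Rightarrow> 'g"
    and \<beta> :: "'i \<Rightarrow> 'i \<Rightarrow> 'm \<Rightarrow> 'e \<Rightarrow> ('e \<Rightarrow>\<^sub>L real)"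
  assumes "quadratic_lie_algebra lb ip"
    and "smooth_manifold A"
    and "\<And>i. open (U i)" and "(\<Union>i. U i) = UNIV"
    and "transitive_courant_data A lb ip U \<theta> B \<phi> \<tau> \<beta>"
  shows "\<exists>(C :: ('m, ('e, 'g) std_fiber, ('e, 'g) std_fiber, 'e) courant) s \<sigma>.
           transitive_courant_algebroid A C \<and>
           courant_connection A C s \<sigma> \<and>
           arises_from_data A lb ip U \<theta> B \<phi> \<tau> \<beta> C s"
proof -
  interpret gluing_data A lb ip U \<theta> B \<phi> \<tau> \<beta>
    by (intro gluing_data.intro manifold_model.intro standard_model.intro standard_model_axioms.intro
        gluing_data_axioms.intro assms smooth_manifold.dim[OF assms(2)])
  show ?thesis
    using courant_algebroid_C courant_connection_C arises_from_data_C by blast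
qed

end
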